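(* Let $X$ and $Y$ be Banach spaces, $n\in\mathbb N$, $\vec\ell\in\mathbb N^n$, and $\mu\in\mathbb R$. Then the classical symbols embed continuously into the $\mathcal R$-bounded symbols: $$S^{\mu;\vec\ell}_{\mathrm{cl}}(\mathbb R^n;X,Y)\hookrightarrow S^{\mu;\vec\ell}_{\mathcal R}(\mathbb R^n;X,Y).$$
   Context: $\mathbb N$ denotes the positive integers, $\mathbb N_0=\mathbb N\cup\{0\}$. $\mathcal R$-boundedness: a set $\mathcal T\subset\mathscr L(X,Y)$ is $\mathcal R$-bounded if for some $1\le p<\infty$ and some constant $C_p\ge0$, $\bigl(\sum_{\varepsilon_1,\dots,\varepsilon_N\in\{-1,1\}}\|\sum_{j}\varepsilon_jT_jx_j\|^p\bigr)^{1/p}\le C_p\bigl(\sum_{\varepsilon_1,\dots,\varepsilon_N\in\{-1,1\}}\|\sum_{j}\varepsilon_jx_j\|^p\bigr)^{1/p}$ for all $N\in\mathbb N$, $T_j\in\mathcal T$, $x_j\in X$; the best constant is the $\mathcal R$-bound $\mathcal R(\mathcal T)$ (independent of $p$ up to equivalence). For $\vec\ell=(\ell_1,\dots,\ell_n)\in\mathbb N^n$ put $\pi_j=\prod_{i\ne j}\ell_i$, $|\xi|_{\vec\ell}=(\sum_j\xi_j^{2\pi_j})^{1/(2\ell_1\cdots\ell_n)}$, $\langle\xi\rangle_{\vec\ell}=(1+\sum_j\xi_j^{2\pi_j})^{1/(2\ell_1\cdots\ell_n)}$, and $|\beta|_{\vec\ell}=\sum_j\ell_j\beta_j$ for $\beta\in\mathbb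 N_0^n$. $S^{\mu;\vec\ell}(\mathbb R^n;X,Y)$ is the Fréchet space of $a\in C^\infty(\mathbb R^n,\mathscr L(X,Y))$ with $\sup_\xi\|\langle\xi\rangle_{\vec\ell}^{-\mu+|\beta|_{\vec\ell}}\partial_\xi^\beta a(\xi)\|<\infty$ for all $\beta\in\mathbb N_0^n$. $S^{\mu;\vec\ell}_{\mathcal R}(\mathbb R^n;X,Y)$ is the Fréchet space of $a\in C^\infty(\mathbb R^n,\mathscr L(X,Y))$ with finite seminorms $|a|^{(\mu;\vec\ell)}_\beta=\mathcal R(\{\langle\xi\rangle_{\vec\ell}^{-\mu+|\beta|_{\vec\ell}}\partial_\xi^\beta a(\xi):\xi\in\mathbb R^n\})$ for all $\beta\in\mathbb N_0^n$. A function $b\in C^\infty(\mathbb R^n\setminus\{0\},\mathscr L(X,Y))$ is anisotropic homogeneous of degree $m$ if $b(\varrho^{\ell_1}\xi_1,\dots,\varrho^{\ell_n}\xi_n)=\varrho^mb(\xi)$ for $\varrho>0$, $\xi\ne0$. $S^{\mu;\vec\ell}_{\mathrm{cl}}(\mathbb R^n;X,Y)$ consists of all $a\in S^{\mu;\vec\ell}(\mathbb R^n;X,Y)$ for which there are anisotropic homogeneous functions $a_{(\mu-j)}$ of degree $\mu-j$, $j\in\mathbb N_0$, such that $a\sim\sum_{j\ge0}\chi a_{(\mu-j)}$, i.e. $a-\sum_{j=0}^N\chi a_{(\mu-j)}\in S^{\mu-N-1;\vec\ell}(\mathbb R^n;X,Y)$ for all $N\ge-1$, where $\chi\in C^\infty(\mathbb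 R^n)$, $\chi\equiv0$ near the origin and $\chi\equiv1$ near infinity. It is a Fréchet space in the projective topology with respect to the maps $a\mapsto a-\sum_{j=0}^N\chi a_{(\mu-j)}\in S^{\mu-N-1;\vec\ell}(\mathbb R^n;X,Y)$, $N=-1,0,1,\dots$, and $a\mapsto a_{(\mu-j)}|_{\{|\xi|_{\vec\ell}=1\}}\in C^\infty(\{|\xi|_{\vec\ell}=1\},\mathscr L(X,Y))$, $j\in\mathbb N_0$. *)

theory Defs
  imports "HOL-Analysis.Analysis"
begin

section \<open>Smooth functions and iterated partial derivatives\<close>

primrec higher_differentiable_on ::
    "'a::euclidean_space set \<Rightarrow> ('a \<Rightarrow> 'b::real_normed_vector) \<Rightarrow> nat \<Rightarrow> bool" where
  "higher_differentiable_on W f 0 \<longleftrightarrow> continuous_on W f"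
| "higher_differentiable_on W f (Suc k) \<longleftrightarrow>
     (\<forall>x\<in>W. f differentiable (at x)) \<and>
     (\<forall>v. higher_differentiable_on W (\<lambda>x. frechet_derivative f (at x) v) k)"

text \<open>Used only for open \<open>W\<close>; the values of \<open>f\<close> outside \<open>W\<close> are then irrelevant.\<close>

definition smooth_on ::
    "'a::euclidean_space set \<Rightarrow> ('a \<Rightarrow> 'b::real_normed_vector) \<Rightarrow> bool" where
  "smooth_on W f \<longleftrightarrow> (\<forall>k. higher_differentiable_on W f k)"

definition partial_deriv ::
    "'n \<Rightarrow> (real^'n::finite \<Rightarrow> 'b::real_normed_vector) \<Rightarrow> real^'n \<Rightarrow> 'b" where
  "partial_deriv j f = (\<lambda>x. frechet_derivative f (at x) (axis j 1))"

text \<open>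
  The index type carries no order, so an enumeration of it is fixed once and for all.
  On smooth functions partial derivatives commute, and the choice does not matter.
\<close>

definition coords :: "'n::finite list" where
  "coords = (SOME js. distinct js \<and> set js = UNIV)"

definition multi_deriv ::
    "('n::finite \<Rightarrow> nat) \<Rightarrow> (real^'n \<Rightarrow> 'b::real_normed_vector) \<Rightarrow> real^'n \<Rightarrow> 'b" where
  "multi_deriv \<beta> f = foldr (\<lambda>j g. (partial_deriv j ^^ \<beta> j) g) coords f"


section \<open>Topologies on function spaces\<close>

text \<open>
  The locally convex topology on \<open>V\<close> given by a family \<open>Q\<close> of seminorms. The
  difference is taken pointwise.
\<close>

definition seminorm_topology ::
    "('v \<Rightarrow> 'e::real_normed_vector) set \<Rightarrow> (('v \<Rightarrow> 'e) \<Rightarrow> real) set \<Rightarrow> ('v \<Rightarrow> 'e) topology" where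
  "seminorm_topology V Q = topology_generated_by
     (insert V {{b \<in> V. q (\<lambda>x. b x - a x) < r} | q a r. q \<in> Q \<and> a \<in> V \<and> 0 < r})"

text \<open>
  The projective (initial) topology on \<open>V\<close> with respect to a set of maps, each paired with
  the topology on its target.
\<close>

definition projective_topology :: "'a set \<Rightarrow> (('a \<Rightarrow> 'b) \<times> 'b topology) set \<Rightarrow> 'a topology" where
  "projective_topology V F = topology_generated_by
     (insert V {{a \<in> V. f a \<in> U} | f T U. (f, T) \<in> F \<and> openin T U})"

lemma topspace_seminorm_topology [simp]: "topspace (seminorm_topology V Q) = V"
  by (auto simp: seminorm_topology_def)

lemma topspace_projective_topology [simp]: "topspace (projective_topology V F) = V"
  by (auto simp: projective_topology_def)

definition smooth_topology ::
    "(real^'n::finite) set \<Rightarrow> (real^'n \<Rightarrow> 'e::real_normed_vector) topology" where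
  "smooth_topology W = seminorm_topology {f. smooth_on W f}
     {(\<lambda>f. SUP x\<in>K. norm (multi_deriv \<beta> f x)) | K \<beta>. compact K \<and> K \<noteq> {} \<and> K \<subseteq> W}"

text \<open>
  The space of smooth functions on an embedded submanifold \<open>M\<close> of euclidean space and its
  standard topology, both tested by pull-back along all smooth maps \<open>\<phi>\<close> from open sets into \<open>M\<close>.
  Local parametrisations of \<open>M\<close>, composed with a coordinate projection to have their domain
  in the ambient space, are such maps; conversely the pull-back along any smooth map into
  \<open>M\<close> is continuous for the topology of uniform convergence of all derivatives in local
  coordinates. Values of functions off \<open>M\<close> play no role.
\<close>

definition smooth_on_submanifold ::
    "(real^'n::finite) set \<Rightarrow> (real^'n \<Rightarrow> 'e::real_normed_vector) \<Rightarrow> bool" where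
  "smooth_on_submanifold M f \<longleftrightarrow>
     (\<forall>W (\<phi> :: real^'n \<Rightarrow> real^'n).
        open W \<and> smooth_on W \<phi> \<and> \<phi> ` W \<subseteq> M \<longrightarrow> smooth_on W (f \<circ> \<phi>))"

definition submanifold_smooth_topology ::
    "(real^'n::finite) set \<Rightarrow> (real^'n \<Rightarrow> 'e::real_normed_vector) topology" where
  "submanifold_smooth_topology M = projective_topology {f. smooth_on_submanifold M f}
     {((\<lambda>f. f \<circ> \<phi>), smooth_topology W) | W (\<phi> :: real^'n \<Rightarrow> real^'n).
        open W \<and> smooth_on W \<phi> \<and> \<phi> ` W \<subseteq> M}"


section \<open>R-boundedness\<close>

definition R_estimate ::
    "real \<Rightarrow> real \<Rightarrow> ('x::real_normed_vector \<Rightarrow>\<^sub>L 'y::real_normed_vector) set \<Rightarrow> bool" where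
  "R_estimate p C \<T> \<longleftrightarrow>
     (\<forall>(N::nat) T x. N \<ge> 1 \<and> (\<forall>j<N. T j \<in> \<T>) \<longrightarrow>
        (\<Sum>\<epsilon>\<in>{..<N} \<rightarrow>\<^sub>E {-1, 1::real}.
            norm (\<Sum>j<N. \<epsilon> j *\<^sub>R blinfun_apply (T j) (x j)) powr p) powr (1 / p)
        \<le> C * (\<Sum>\<epsilon>\<in>{..<N} \<rightarrow>\<^sub>E {-1, 1::real}.
            norm (\<Sum>j<N. \<epsilon> j *\<^sub>R x j) powr p) powr (1 / p))"

text \<open>
  The exponent \<open>p \<in> [1, \<infinity>)\<close> is kept as a parameter. By the Khintchine--Kahane inequality,
  R-boundedness does not depend on \<open>p\<close>, and neither does the R-bound up to equivalence.
\<close>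

definition R_bounded ::
    "real \<Rightarrow> ('x::real_normed_vector \<Rightarrow>\<^sub>L 'y::real_normed_vector) set \<Rightarrow> bool" where
  "R_bounded p \<T> \<longleftrightarrow> (\<exists>C\<ge>0. R_estimate p C \<T>)"

definition R_bound ::
    "real \<Rightarrow> ('x::real_normed_vector \<Rightarrow>\<^sub>L 'y::real_normed_vector) set \<Rightarrow> real" where
  "R_bound p \<T> = Inf {C. 0 \<le> C \<and> R_estimate p C \<T>}"


section \<open>Anisotropic symbols\<close>

definition co_weight :: "('n::finite \<Rightarrow> nat) \<Rightarrow> 'n \<Rightarrow> nat" where
  "co_weight l j = (\<Prod>i\<in>UNIV - {j}. l i)"

definition aniso_length :: "('n::finite \<Rightarrow> nat) \<Rightarrow> real^'n \<Rightarrow> real" where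
  "aniso_length l \<xi> =
     (\<Sum>j\<in>UNIV. (\<xi> $ j) ^ (2 * co_weight l j)) powr (1 / (2 * real (\<Prod>j\<in>UNIV. l j)))"

definition aniso_bracket :: "('n::finite \<Rightarrow> nat) \<Rightarrow> real^'n \<Rightarrow> real" where
  "aniso_bracket l \<xi> =
     (1 + (\<Sum>j\<in>UNIV. (\<xi> $ j) ^ (2 * co_weight l j))) powr (1 / (2 * real (\<Prod>j\<in>UNIV. l j)))"

definition aniso_order :: "('n::finite \<Rightarrow> nat) \<Rightarrow> ('n \<Rightarrow> nat) \<Rightarrow> nat" where
  "aniso_order l \<beta> = (\<Sum>j\<in>UNIV. l j * \<beta> j)"

definition aniso_dilate :: "('n::finite \<Rightarrow> nat) \<Rightarrow> real \<Rightarrow> real^'n \<Rightarrow> real^'n" where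
  "aniso_dilate l \<rho> \<xi> = (\<chi> j. \<rho> ^ l j * \<xi> $ j)"

definition weighted_deriv ::
    "('n::finite \<Rightarrow> nat) \<Rightarrow> real \<Rightarrow> ('n \<Rightarrow> nat) \<Rightarrow> (real^'n \<Rightarrow> 'e::real_normed_vector) \<Rightarrow> real^'n \<Rightarrow> 'e"
  where
  "weighted_deriv l \<mu> \<beta> a \<xi> =
     (aniso_bracket l \<xi> powr (- \<mu> + real (aniso_order l \<beta>))) *\<^sub>R multi_deriv \<beta> a \<xi>"

definition symbols ::
    "('n::finite \<Rightarrow> nat) \<Rightarrow> real \<Rightarrow>
     (real^'n \<Rightarrow> 'x::real_normed_vector \<Rightarrow>\<^sub>L 'y::real_normed_vector) set" where
  "symbols l \<mu> =
     {a. smooth_on UNIV a \<and> (\<forall>\<beta>. bdd_above (range (\<lambda>\<xi>. norm (weighted_deriv l \<mu> \<beta> a \<xi>))))}"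

definition symbol_topology ::
    "('n::finite \<Rightarrow> nat) \<Rightarrow> real \<Rightarrow>
     (real^'n \<Rightarrow> 'x::real_normed_vector \<Rightarrow>\<^sub>L 'y::real_normed_vector) topology" where
  "symbol_topology l \<mu> = seminorm_topology (symbols l \<mu>)
     {(\<lambda>a. SUP \<xi>. norm (weighted_deriv l \<mu> \<beta> a \<xi>)) | \<beta>. True}"

definition R_symbols ::
    "real \<Rightarrow> ('n::finite \<Rightarrow> nat) \<Rightarrow> real \<Rightarrow>
     (real^'n \<Rightarrow> 'x::real_normed_vector \<Rightarrow>\<^sub>L 'y::real_normed_vector) set" where
  "R_symbols p l \<mu> =
     {a. smooth_on UNIV a \<and> (\<forall>\<beta>. R_bounded p (range (weighted_deriv l \<mu> \<beta> a)))}"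

definition R_symbol_topology ::
    "real \<Rightarrow> ('n::finite \<Rightarrow> nat) \<Rightarrow> real \<Rightarrow>
     (real^'n \<Rightarrow> 'x::real_normed_vector \<Rightarrow>\<^sub>L 'y::real_normed_vector) topology" where
  "R_symbol_topology p l \<mu> = seminorm_topology (R_symbols p l \<mu>)
     {(\<lambda>a. R_bound p (range (weighted_deriv l \<mu> \<beta> a))) | \<beta>. True}"


section \<open>Classical symbols\<close>

definition aniso_homogeneous ::
    "('n::finite \<Rightarrow> nat) \<Rightarrow> real \<Rightarrow> (real^'n \<Rightarrow> 'e::real_normed_vector) \<Rightarrow> bool" where
  "aniso_homogeneous l m b \<longleftrightarrow> smooth_on (- {0}) b \<and>
     (\<forall>\<rho> \<xi>. 0 < \<rho> \<and> \<xi> \<noteq> 0 \<longrightarrow> b (aniso_dilate l \<rho> \<xi>) = (\<rho> powr m) *\<^sub>R b \<xi>)"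

definition excision :: "(real^'n::finite \<Rightarrow> real) \<Rightarrow> bool" where
  "excision c \<longleftrightarrow> smooth_on UNIV c \<and> (\<forall>\<^sub>F \<xi> in nhds 0. c \<xi> = 0) \<and> (\<forall>\<^sub>F \<xi> in at_infinity. c \<xi> = 1)"

text \<open>
  \<open>k\<close> is the number of subtracted terms, so the remainder is required to have order \<open>\<mu> - k\<close>;
  \<open>k = 0\<close> says that \<open>a\<close> itself is a symbol of order \<open>\<mu>\<close>. The value of \<open>h j\<close> at the
  origin is irrelevant since the excision function \<open>c\<close> vanishes there.
\<close>

definition expansion_remainder ::
    "(real^'n::finite \<Rightarrow> real) \<Rightarrow> (nat \<Rightarrow> real^'n \<Rightarrow> 'e::real_normed_vector) \<Rightarrow> nat \<Rightarrow>
     (real^'n \<Rightarrow> 'e) \<Rightarrow> real^'n \<Rightarrow> 'e" where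
  "expansion_remainder c h k a = (\<lambda>\<xi>. a \<xi> - (\<Sum>j<k. c \<xi> *\<^sub>R h j \<xi>))"

definition homogeneous_expansion ::
    "(real^'n::finite \<Rightarrow> real) \<Rightarrow> ('n \<Rightarrow> nat) \<Rightarrow> real \<Rightarrow>
     (real^'n \<Rightarrow> 'x::real_normed_vector \<Rightarrow>\<^sub>L 'y::real_normed_vector) \<Rightarrow>
     (nat \<Rightarrow> real^'n \<Rightarrow> 'x \<Rightarrow>\<^sub>L 'y) \<Rightarrow> bool" where
  "homogeneous_expansion c l \<mu> a h \<longleftrightarrow>
     (\<forall>j. aniso_homogeneous l (\<mu> - real j) (h j)) \<and>
     (\<forall>k. expansion_remainder c h k a \<in> symbols l (\<mu> - real k))"

definition classical_symbols ::
    "(real^'n::finite \<Rightarrow> real) \<Rightarrow> ('n \<Rightarrow> nat) \<Rightarrow> real \<Rightarrow>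
     (real^'n \<Rightarrow> 'x::real_normed_vector \<Rightarrow>\<^sub>L 'y::real_normed_vector) set" where
  "classical_symbols c l \<mu> = {a \<in> symbols l \<mu>. \<exists>h. homogeneous_expansion c l \<mu> a h}"

text \<open>The components are uniquely determined by \<open>a\<close> away from the origin.\<close>

definition homogeneous_components ::
    "(real^'n::finite \<Rightarrow> real) \<Rightarrow> ('n \<Rightarrow> nat) \<Rightarrow> real \<Rightarrow>
     (real^'n \<Rightarrow> 'x::real_normed_vector \<Rightarrow>\<^sub>L 'y::real_normed_vector) \<Rightarrow>
     nat \<Rightarrow> real^'n \<Rightarrow> 'x \<Rightarrow>\<^sub>L 'y" where
  "homogeneous_components c l \<mu> a = (SOME h. homogeneous_expansion c l \<mu> a h)"

definition classical_symbol_topology ::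
    "(real^'n::finite \<Rightarrow> real) \<Rightarrow> ('n \<Rightarrow> nat) \<Rightarrow> real \<Rightarrow>
     (real^'n \<Rightarrow> 'x::real_normed_vector \<Rightarrow>\<^sub>L 'y::real_normed_vector) topology" where
  "classical_symbol_topology c l \<mu> = projective_topology (classical_symbols c l \<mu>)
     ({((\<lambda>a. expansion_remainder c (homogeneous_components c l \<mu> a) k a),
        symbol_topology l (\<mu> - real k)) | k. True} \<union>
      {((\<lambda>a. homogeneous_components c l \<mu> a j),
        submanifold_smooth_topology {\<xi>. aniso_length l \<xi> = 1}) | j. True})"

end

theory Submission
  imports Defs "HOL-Library.Multiset"
begin

text \<open>
  A family of operators is R-bounded as soon as it is generated from single operators by a few
  operations under which R-bounds are stable: multiplication by bounded scalar functions
  (\<open>contraction_principle\<close>), sums of families, decompositions of the index set with a summable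
  sequence of bounds (\<open>R_estimate_cover\<close>), and pointwise limits. The fundamental theorem of
  calculus, applied in one coordinate after the other, writes the values of a smooth function on
  a cube in this way, starting from single values of its derivatives. Hence on a cube with sides of length \<open>s\<close> the R-bound of a smooth operator-valued
  function is at most \<open>(1 + s)\<^sup>n\<close> times a bound for the operator norms of its derivatives of order
  up to \<open>n\<close> (\<open>R_estimate_cube\<close>). Scalar weights never have to be differentiated, since they
  are taken care of by the contraction principle.

  Two kinds of symbols are then R-bounded. If \<open>r\<close> has order \<open>\<mu> - k\<close> with \<open>k\<close> large, the R-bounds of
  the weighted derivatives of order \<open>\<mu>\<close> over the unit cubes with integer corners are dominated by
  a convergent sum over the lattice (\<open>R_estimate_low_order\<close>). If \<open>h\<close> is homogeneous of degree
  at most \<open>\<mu>\<close> and \<open>c\<close> is an excision function, the dilations move every large \<open>\<xi>\<close> into one fixed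
  cube, at the price of a scalar factor that is bounded after weighting
  (\<open>R_estimate_homogeneous\<close>). A classical symbol is the sum of a remainder of the first kind and
  of finitely many terms of the second kind (\<open>R_estimate_classical\<close>).

  All estimates are linear in finitely many of the seminorms that define the topology of classical
  symbols. For the homogeneous components these are seminorms of the pull-back along the
  retraction of \<open>\<real>\<^sup>n\<close> without the origin onto the anisotropic unit sphere. Continuity
  is checked at one classical symbol \<open>a\<close>: the chosen components of \<open>b\<close> and \<open>a\<close> differ by homogeneous
  functions and the remainders by a symbol, and the difference \<open>b - a\<close> is recovered from them.
\<close>

section \<open>Rademacher averages and R-bounds\<close>

text \<open>
  Convexity extends from the open half line to the end point \<open>0\<close> because \<open>w powr p \<le> w\<close> for
  \<open>0 \<le> w \<le> 1\<close>.
\<close>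

lemma powr_convex_nonneg:
  fixes x y u v p :: real
  assumes "1 \<le> p" "0 \<le> x" "0 \<le> y" "0 \<le> u" "0 \<le> v" "u + v = 1"
  shows "(u * x + v * y) powr p \<le> u * x powr p + v * y powr p"
proof -
  have le: "t powr p \<le> t" if "0 \<le> t" "t \<le> 1" for t :: real
    using powr_mono'[OF \<open>1 \<le> p\<close> that] that by simp
  have edge: "(w * z) powr p \<le> w * z powr p" if "0 \<le> w" "w \<le> 1" "0 \<le> z" for w z :: real
    using le[OF that(1,2)] that by (simp add: powr_mult mult_right_mono)
  consider "x = 0" | "y = 0" | "0 < x" "0 < y" using assms by force
  then show ?thesis
  proof cases
    case 1 then show ?thesis using edge[of v y] assms by simp
  next
    case 2 then show ?thesis using edge[of u x] assms by simp
  next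
    case 3
    have "u = 1 - v" using assms by simp
    then show ?thesis
      using convex_onD[OF powr_convex[OF \<open>1 \<le> p\<close>], of v x y] 3 assms(5) assms(4) by simp
  qed
qed

text \<open>
  If \<open>A\<close> and \<open>B\<close> are the norms of the two summands, then \<open>(a + b) / (A + B)\<close> is a convex
  combination of the normalised functions \<open>a / A\<close> and \<open>b / B\<close>, to which convexity applies
  pointwise.
\<close>

lemma minkowski_powr_sum:
  fixes a b :: "'i \<Rightarrow> real"
  assumes I: "finite I" and p: "1 \<le> p" and a: "\<And>i. i \<in> I \<Longrightarrow> 0 \<le> a i" and b: "\<And>i. i \<in> I \<Longrightarrow> 0 \<le> b i"
  shows "(\<Sum>i\<in>I. (a i + b i) powr p) powr (1 / p)
    \<le> (\<Sum>i\<in>I. a i powr p) powr (1 / p) + (\<Sum>i\<in>I. b i powr p) powr (1 / p)"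
proof -
  define A where "A = (\<Sum>i\<in>I. a i powr p) powr (1 / p)"
  define B where "B = (\<Sum>i\<in>I. b i powr p) powr (1 / p)"
  have Ap: "A powr p = (\<Sum>i\<in>I. a i powr p)" and Bp: "B powr p = (\<Sum>i\<in>I. b i powr p)"
    using p by (auto simp: A_def B_def powr_powr sum_nonneg)
  have AB0: "0 \<le> A" "0 \<le> B" by (auto simp: A_def B_def)
  have zero: "\<forall>i\<in>I. f i = 0" if "(\<Sum>i\<in>I. f i powr p) powr (1 / p) = 0" for f :: "'i \<Rightarrow> real"
    using that I by (simp add: sum_nonneg_eq_0_iff)
  consider "A = 0" | "B = 0" | "0 < A" "0 < B" using AB0 by force
  then show ?thesis
  proof cases
    case 1
    then have "\<forall>i\<in>I. a i = 0" using zero A_def by simp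
    then show ?thesis by simp
  next
    case 2
    then have "\<forall>i\<in>I. b i = 0" using zero B_def by simp
    then show ?thesis by simp
  next
    case 3
    define u where "u = A / (A + B)"
    define v where "v = B / (A + B)"
    have uv: "0 \<le> u" "0 \<le> v" "u + v = 1" using 3 by (auto simp: u_def v_def simp flip: add_divide_distrib)
    have pt: "(a i + b i) powr p \<le> (A + B) powr p * (u * (a i / A) powr p + v * (b i / B) powr p)"
      if i: "i \<in> I" for i
    proof -
      have "a i + b i = (A + B) * (u * (a i / A) + v * (b i / B))"
        using 3 by (simp add: u_def v_def distrib_left)
      then have "(a i + b i) powr p = (A + B) powr p * (u * (a i / A) + v * (b i / B)) powr p"
        using 3 a[OF i] b[OF i] uv by (simp add: powr_mult)
      then show ?thesis
        using powr_convex_nonneg[OF p _ _ uv, of "a i / A" "b i / B"] 3 a[OF i] b[OF i]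
        by (simp add: mult_left_mono)
    qed
    have "(\<Sum>i\<in>I. (a i + b i) powr p)
        \<le> (\<Sum>i\<in>I. (A + B) powr p * (u * (a i / A) powr p + v * (b i / B) powr p))"
      by (intro sum_mono pt)
    also have "\<dots> = (A + B) powr p * (u * (\<Sum>i\<in>I. a i powr p) / A powr p + v * (\<Sum>i\<in>I. b i powr p) / B powr p)"
    proof -
      have "(\<Sum>i\<in>I. (A + B) powr p * (u * (a i / A) powr p + v * (b i / B) powr p))
          = (\<Sum>i\<in>I. (A + B) powr p * (u * (a i powr p / A powr p) + v * (b i powr p / B powr p)))"
        using 3 a b by (intro sum.cong) (simp_all add: powr_divide)
      then show ?thesis
        by (simp add: sum.distrib flip: sum_distrib_left sum_divide_distrib)
    qed
    also have "\<dots> = (A + B) powr p"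
      unfolding Ap[symmetric] Bp[symmetric] using 3 uv by simp
    finally have "(\<Sum>i\<in>I. (a i + b i) powr p) powr (1 / p) \<le> ((A + B) powr p) powr (1 / p)"
      using p by (intro powr_mono2) (auto intro: sum_nonneg)
    also have "\<dots> = A + B" using p 3 by (simp add: powr_powr)
    finally show ?thesis by (simp add: A_def B_def)
  qed
qed

text \<open>
  These averages are seminorms in \<open>x\<close> that are invariant under changes of sign of single
  entries, and \<open>R_estimate\<close> compares two of them.
\<close>

definition rademacher_norm :: "real \<Rightarrow> nat \<Rightarrow> (nat \<Rightarrow> 'v::real_normed_vector) \<Rightarrow> real" where
  "rademacher_norm p N x =
     (\<Sum>\<epsilon>\<in>{..<N} \<rightarrow>\<^sub>E {-1, 1::real}. norm (\<Sum>j<N. \<epsilon> j *\<^sub>R x j) powr p) powr (1 / p)"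

lemma R_estimate_iff:
  "R_estimate p C \<T> \<longleftrightarrow> (\<forall>N T x. 1 \<le> N \<and> (\<forall>j<N. T j \<in> \<T>) \<longrightarrow>
     rademacher_norm p N (\<lambda>j. blinfun_apply (T j) (x j)) \<le> C * rademacher_norm p N x)"
  unfolding R_estimate_def rademacher_norm_def ..

lemma rademacher_norm_nonneg [simp]: "0 \<le> rademacher_norm p N x"
  by (simp add: rademacher_norm_def)

lemma rademacher_norm_cong:
  "(\<And>j. j < N \<Longrightarrow> x j = y j) \<Longrightarrow> rademacher_norm p N x = rademacher_norm p N y"
  by (simp add: rademacher_norm_def)

lemma rademacher_norm_mono:
  assumes "1 \<le> p"
    and "\<And>\<epsilon>. norm (\<Sum>j<N. \<epsilon> j *\<^sub>R x j) \<le> norm (\<Sum>j<N. \<epsilon> j *\<^sub>R y j)"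
  shows "rademacher_norm p N x \<le> rademacher_norm p N y"
  unfolding rademacher_norm_def using assms
  by (intro powr_mono2 sum_mono) (auto intro: sum_nonneg)

lemma rademacher_norm_scaleR:
  assumes "1 \<le> p"
  shows "rademacher_norm p N (\<lambda>j. c *\<^sub>R x j) = \<bar>c\<bar> * rademacher_norm p N x"
proof -
  have "norm (\<Sum>j<N. \<epsilon> j *\<^sub>R c *\<^sub>R x j) powr p = \<bar>c\<bar> powr p * norm (\<Sum>j<N. \<epsilon> j *\<^sub>R x j) powr p"
    for \<epsilon> :: "nat \<Rightarrow> real"
  proof -
    have "(\<Sum>j<N. \<epsilon> j *\<^sub>R c *\<^sub>R x j) = c *\<^sub>R (\<Sum>j<N. \<epsilon> j *\<^sub>R x j)"
      unfolding scaleR_sum_right by (intro sum.cong) (simp_all add: mult.commute)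
    then show ?thesis by (simp add: powr_mult)
  qed
  then have "rademacher_norm p N (\<lambda>j. c *\<^sub>R x j)
      = (\<bar>c\<bar> powr p * (\<Sum>\<epsilon>\<in>{..<N} \<rightarrow>\<^sub>E {-1, 1}. norm (\<Sum>j<N. \<epsilon> j *\<^sub>R x j) powr p)) powr (1 / p)"
    by (simp only: rademacher_norm_def sum_distrib_left)
  then show ?thesis
    using assms by (simp add: rademacher_norm_def powr_mult powr_powr sum_nonneg)
qed

lemma rademacher_norm_zero [simp]: "1 \<le> p \<Longrightarrow> rademacher_norm p N (\<lambda>j. 0) = 0"
  using rademacher_norm_scaleR[of p N 0 "\<lambda>_. 0"] by simp

lemma rademacher_norm_add:
  assumes p: "1 \<le> p"
  shows "rademacher_norm p N (\<lambda>j. x j + y j) \<le> rademacher_norm p N x + rademacher_norm p N y"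
proof -
  let ?E = "{..<N} \<rightarrow>\<^sub>E {-1, 1::real}"
  have fin: "finite ?E" by (intro finite_PiE) auto
  have "rademacher_norm p N (\<lambda>j. x j + y j)
      \<le> (\<Sum>\<epsilon>\<in>?E. (norm (\<Sum>j<N. \<epsilon> j *\<^sub>R x j) + norm (\<Sum>j<N. \<epsilon> j *\<^sub>R y j)) powr p) powr (1 / p)"
  proof -
    have "norm (\<Sum>j<N. \<epsilon> j *\<^sub>R (x j + y j)) \<le> norm (\<Sum>j<N. \<epsilon> j *\<^sub>R x j) + norm (\<Sum>j<N. \<epsilon> j *\<^sub>R y j)"
      for \<epsilon> :: "nat \<Rightarrow> real"
      using norm_triangle_ineq by (simp add: scaleR_add_right sum.distrib)
    then show ?thesis
      unfolding rademacher_norm_def using p by (intro powr_mono2 sum_mono) (simp_all add: sum_nonneg)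
  qed
  also have "\<dots> \<le> rademacher_norm p N x + rademacher_norm p N y"
    unfolding rademacher_norm_def by (intro minkowski_powr_sum fin p) auto
  finally show ?thesis .
qed

lemma rademacher_norm_sum:
  assumes "1 \<le> p" "finite I"
  shows "rademacher_norm p N (\<lambda>j. \<Sum>i\<in>I. x i j) \<le> (\<Sum>i\<in>I. rademacher_norm p N (x i))"
  using assms(2)
proof (induction I)
  case (insert i I)
  then show ?case
    using rademacher_norm_add[OF assms(1), of N "x i" "\<lambda>j. \<Sum>i\<in>I. x i j"] by simp
qed (use assms in simp)

lemma rademacher_norm_flip_sign:
  assumes "m < N"
  shows "rademacher_norm p N (x(m := - x m)) = rademacher_norm p N x"
proof -
  let ?E = "{..<N} \<rightarrow>\<^sub>E {-1, 1::real}"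
  let ?f = "\<lambda>\<epsilon>::nat\<Rightarrow>real. \<epsilon>(m := - \<epsilon> m)"
  have E: "?f \<epsilon> \<in> ?E" if "\<epsilon> \<in> ?E" for \<epsilon>
  proof (rule PiE_I)
    fix j assume "j \<in> {..<N}"
    then show "?f \<epsilon> j \<in> {-1, 1}" using PiE_mem[OF that, of j] PiE_mem[OF that, of m] assms by auto
  next
    fix j assume "j \<notin> {..<N}"
    then show "?f \<epsilon> j = undefined" using PiE_arb[OF that, of j] assms by auto
  qed
  define f where "f = ?f"
  define g where "g y \<epsilon> = norm (\<Sum>j<N. \<epsilon> j *\<^sub>R y j) powr p" for y :: "nat \<Rightarrow> 'a" and \<epsilon>
  have f: "f \<epsilon> \<in> ?E" if "\<epsilon> \<in> ?E" for \<epsilon>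
    using E[OF that] by (simp only: f_def)
  have ff: "f (f \<epsilon>) = \<epsilon>" for \<epsilon> by (simp add: f_def)
  have gf: "g x (f \<epsilon>) = g (x(m := - x m)) \<epsilon>" for \<epsilon>
  proof -
    have "(\<Sum>j<N. f \<epsilon> j *\<^sub>R x j) = (\<Sum>j<N. \<epsilon> j *\<^sub>R (x(m := - x m)) j)"
      unfolding f_def by (intro sum.cong) auto
    then show ?thesis by (simp only: g_def)
  qed
  have "sum (g (x(m := - x m))) ?E = sum (g x) ?E"
    by (rule sum.reindex_bij_witness[where i = f and j = f]) (simp_all only: ff gf f)
  then show ?thesis unfolding rademacher_norm_def g_def by (simp only:)
qed

text \<open>
  Multiplication by \<open>c \<in> [-1, 1]\<close> is a convex combination of the identity and of a change of
  sign.
\<close>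

lemma rademacher_norm_shrink_one:
  assumes p: "1 \<le> p" and m: "m < N" and c: "\<bar>c\<bar> \<le> 1"
  shows "rademacher_norm p N (x(m := c *\<^sub>R x m)) \<le> rademacher_norm p N x"
proof -
  \<comment> \<open>the convex coefficient with \<open>c = \<theta> - (1 - \<theta>)\<close>\<close>
  define \<theta> where "\<theta> = (1 + c) / 2"
  have \<theta>: "0 \<le> \<theta>" "\<theta> \<le> 1" using c by (auto simp: \<theta>_def)
  have "x(m := c *\<^sub>R x m) = (\<lambda>j. \<theta> *\<^sub>R x j + (1 - \<theta>) *\<^sub>R (x(m := - x m)) j)"
  proof
    fix j
    have "c = \<theta> - (1 - \<theta>)" by (simp add: \<theta>_def field_simps)
    then have "c *\<^sub>R x m = \<theta> *\<^sub>R x m - (1 - \<theta>) *\<^sub>R x m" by (metis scaleR_left_diff_distrib)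
    moreover have "x j = \<theta> *\<^sub>R x j + (1 - \<theta>) *\<^sub>R x j" by (simp only: flip: scaleR_left_distrib) simp
    ultimately show "(x(m := c *\<^sub>R x m)) j = \<theta> *\<^sub>R x j + (1 - \<theta>) *\<^sub>R (x(m := - x m)) j"
      by (cases "j = m") (simp_all only: fun_upd_apply if_True if_False refl scaleR_minus_right add_uminus_conv_diff)
  qed
  then have "rademacher_norm p N (x(m := c *\<^sub>R x m))
      \<le> \<bar>\<theta>\<bar> * rademacher_norm p N x + \<bar>1 - \<theta>\<bar> * rademacher_norm p N (x(m := - x m))"
    using rademacher_norm_add[OF p] by (simp only: rademacher_norm_scaleR[OF p, symmetric])
  also have "\<dots> = rademacher_norm p N x"
    using \<theta> by (simp add: rademacher_norm_flip_sign[OF m] algebra_simps)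
  finally show ?thesis .
qed

text \<open>
  Kahane's contraction principle for real multipliers, obtained by shrinking one coordinate
  after the other.
\<close>

lemma contraction_principle:
  assumes p: "1 \<le> p" and c: "0 \<le> c" and w: "\<And>j. j < N \<Longrightarrow> \<bar>w j\<bar> \<le> c"
  shows "rademacher_norm p N (\<lambda>j. w j *\<^sub>R x j) \<le> c * rademacher_norm p N x"
proof (cases "c = 0")
  case True
  then have "rademacher_norm p N (\<lambda>j. w j *\<^sub>R x j) = rademacher_norm p N (\<lambda>j. 0::'a)"
    using w by (intro rademacher_norm_cong) auto
  then show ?thesis using p True by simp
next
  case False
  define \<theta> where "\<theta> j = w j / c" for j
  have \<theta>: "\<bar>\<theta> j\<bar> \<le> 1" if "j < N" for j
    using w[OF that] c False by (simp add: \<theta>_def field_simps abs_mult)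
  have "rademacher_norm p N (\<lambda>j. if j < m then \<theta> j *\<^sub>R x j else x j) \<le> rademacher_norm p N x"
    if "m \<le> N" for m
    using that
  proof (induction m)
    case (Suc m)
    let ?y = "\<lambda>j. if j < m then \<theta> j *\<^sub>R x j else x j"
    have "(\<lambda>j. if j < Suc m then \<theta> j *\<^sub>R x j else x j) = ?y(m := \<theta> m *\<^sub>R ?y m)"
      by (auto simp: less_Suc_eq)
    then show ?case
      using rademacher_norm_shrink_one[OF p, of m N "\<theta> m" ?y] Suc \<theta>[of m] by simp
  qed simp
  from this[of N] have "rademacher_norm p N (\<lambda>j. \<theta> j *\<^sub>R x j) \<le> rademacher_norm p N x"
    using rademacher_norm_cong[of N "\<lambda>j. if j < N then \<theta> j *\<^sub>R x j else x j" "\<lambda>j. \<theta> j *\<^sub>R x j" p]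
    by simp
  then have "\<bar>c\<bar> * rademacher_norm p N (\<lambda>j. \<theta> j *\<^sub>R x j) \<le> c * rademacher_norm p N x"
    using c by (simp add: mult_left_mono)
  then show ?thesis
    using False by (simp add: rademacher_norm_scaleR[OF p, symmetric] \<theta>_def)
qed

text \<open>
  For an indexed family one may choose indices instead of operators. Different indices may give
  the same operator, so in later arguments scalars and cells can depend on the index.
\<close>

lemma R_estimate_image:
  "R_estimate p C (F ` A) \<longleftrightarrow> (\<forall>N \<xi> x. 1 \<le> N \<and> (\<forall>j<N. \<xi> j \<in> A) \<longrightarrow>
     rademacher_norm p N (\<lambda>j. blinfun_apply (F (\<xi> j)) (x j)) \<le> C * rademacher_norm p N x)"
proof safe
  fix N :: nat and \<xi> x
  assume R: "R_estimate p C (F ` A)" and N: "1 \<le> N" and "\<forall>j<N. \<xi> j \<in> A"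
  then show "rademacher_norm p N (\<lambda>j. blinfun_apply (F (\<xi> j)) (x j)) \<le> C * rademacher_norm p N x"
    using R[unfolded R_estimate_iff, rule_format, of N "\<lambda>j. F (\<xi> j)" x] N by simp
next
  assume *: "\<forall>N \<xi> x. 1 \<le> N \<and> (\<forall>j<N. \<xi> j \<in> A) \<longrightarrow>
     rademacher_norm p N (\<lambda>j. blinfun_apply (F (\<xi> j)) (x j)) \<le> C * rademacher_norm p N x"
  show "R_estimate p C (F ` A)"
    unfolding R_estimate_iff
  proof safe
    fix N :: nat and T x
    assume N: "1 \<le> N" and "\<forall>j<N. T j \<in> F ` A"
    then have "\<forall>j. \<exists>\<xi>. j < N \<longrightarrow> \<xi> \<in> A \<and> T j = F \<xi>" by auto
    then obtain \<xi> where \<xi>: "\<And>j. j < N \<Longrightarrow> \<xi> j \<in> A \<and> T j = F (\<xi> j)" by metis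
    have "rademacher_norm p N (\<lambda>j. blinfun_apply (T j) (x j))
        = rademacher_norm p N (\<lambda>j. blinfun_apply (F (\<xi> j)) (x j))"
      by (intro rademacher_norm_cong) (simp add: \<xi>)
    then show "rademacher_norm p N (\<lambda>j. blinfun_apply (T j) (x j)) \<le> C * rademacher_norm p N x"
      using * N \<xi> by simp
  qed
qed

lemma R_estimate_mono:
  assumes "R_estimate p C \<T>" "\<S> \<subseteq> \<T>" "C \<le> D"
  shows "R_estimate p D \<S>"
  unfolding R_estimate_iff
proof safe
  fix N :: nat and T x
  assume "1 \<le> N" "\<forall>j<N. T j \<in> \<S>"
  then have "rademacher_norm p N (\<lambda>j. blinfun_apply (T j) (x j)) \<le> C * rademacher_norm p N x"
    using assms unfolding R_estimate_iff by blast
  also have "\<dots> \<le> D * rademacher_norm p N x" using assms by (simp add: mult_right_mono)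
  finally show "rademacher_norm p N (\<lambda>j. blinfun_apply (T j) (x j)) \<le> D * rademacher_norm p N x" .
qed

lemma R_estimate_singleton:
  assumes p: "1 \<le> p" and S: "norm S \<le> C"
  shows "R_estimate p C {S}"
  unfolding R_estimate_iff
proof safe
  fix N :: nat and T x
  assume "\<forall>j<N. T j \<in> {S}"
  then have "rademacher_norm p N (\<lambda>j. blinfun_apply (T j) (x j)) = rademacher_norm p N (\<lambda>j. blinfun_apply S (x j))"
    by (intro rademacher_norm_cong) auto
  also have "\<dots> \<le> rademacher_norm p N (\<lambda>j. C *\<^sub>R x j)"
  proof (rule rademacher_norm_mono[OF p])
    fix \<epsilon> :: "nat \<Rightarrow> real"
    have "norm (\<Sum>j<N. \<epsilon> j *\<^sub>R blinfun_apply S (x j)) = norm (blinfun_apply S (\<Sum>j<N. \<epsilon> j *\<^sub>R x j))"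
      by (simp add: blinfun.sum_right blinfun.scaleR_right)
    also have "\<dots> \<le> C * norm (\<Sum>j<N. \<epsilon> j *\<^sub>R x j)"
      using norm_blinfun[of S] S by (meson mult_right_mono norm_ge_zero order_trans)
    also have "\<dots> = norm (C *\<^sub>R (\<Sum>j<N. \<epsilon> j *\<^sub>R x j))"
      using order_trans[OF norm_ge_zero S] by simp
    also have "C *\<^sub>R (\<Sum>j<N. \<epsilon> j *\<^sub>R x j) = (\<Sum>j<N. \<epsilon> j *\<^sub>R C *\<^sub>R x j)"
      unfolding scaleR_sum_right by (intro sum.cong) (simp_all add: mult.commute)
    finally show "norm (\<Sum>j<N. \<epsilon> j *\<^sub>R blinfun_apply S (x j)) \<le> norm (\<Sum>j<N. \<epsilon> j *\<^sub>R C *\<^sub>R x j)" .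
  qed
  also have "\<dots> = C * rademacher_norm p N x"
    using order_trans[OF norm_ge_zero S] p by (simp add: rademacher_norm_scaleR)
  finally show "rademacher_norm p N (\<lambda>j. blinfun_apply (T j) (x j)) \<le> C * rademacher_norm p N x" .
qed

lemma R_estimate_add:
  assumes p: "1 \<le> p" and F: "R_estimate p C (F ` A)" and G: "R_estimate p D (G ` A)"
  shows "R_estimate p (C + D) ((\<lambda>\<xi>. F \<xi> + G \<xi>) ` A)"
  unfolding R_estimate_image
proof safe
  fix N :: nat and \<xi> x
  assume *: "1 \<le> N" "\<forall>j<N. \<xi> j \<in> A"
  have "rademacher_norm p N (\<lambda>j. blinfun_apply (F (\<xi> j) + G (\<xi> j)) (x j))
    \<le> rademacher_norm p N (\<lambda>j. blinfun_apply (F (\<xi> j)) (x j)) + rademacher_norm p N (\<lambda>j. blinfun_apply (G (\<xi> j)) (x j))"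
    using rademacher_norm_add[OF p] by (simp add: blinfun.add_left)
  also have "\<dots> \<le> C * rademacher_norm p N x + D * rademacher_norm p N x"
    using F G * unfolding R_estimate_image by (intro add_mono) auto
  finally show "rademacher_norm p N (\<lambda>j. blinfun_apply (F (\<xi> j) + G (\<xi> j)) (x j)) \<le> (C + D) * rademacher_norm p N x"
    by (simp add: distrib_right)
qed

text \<open>
  The multiplier may vary with the index, only its bound is uniform. This is how scalar weights
  are removed from a family without differentiating them.
\<close>

lemma R_estimate_scaleR:
  assumes p: "1 \<le> p" and F: "R_estimate p C \<T>" and sub: "\<And>\<xi>. \<xi> \<in> A \<Longrightarrow> F \<xi> \<in> \<T>"
    and c: "0 \<le> c" and w: "\<And>\<xi>. \<xi> \<in> A \<Longrightarrow> \<bar>w \<xi>\<bar> \<le> c"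
  shows "R_estimate p (c * C) ((\<lambda>\<xi>. w \<xi> *\<^sub>R F \<xi>) ` A)"
  unfolding R_estimate_image
proof safe
  fix N :: nat and \<xi> x
  assume *: "1 \<le> N" "\<forall>j<N. \<xi> j \<in> A"
  have "rademacher_norm p N (\<lambda>j. blinfun_apply (w (\<xi> j) *\<^sub>R F (\<xi> j)) (x j))
      \<le> c * rademacher_norm p N (\<lambda>j. blinfun_apply (F (\<xi> j)) (x j))"
    using contraction_principle[OF p c, of N "\<lambda>j. w (\<xi> j)"] w * by (simp add: blinfun.scaleR_left)
  also have "\<dots> \<le> c * (C * rademacher_norm p N x)"
    using F sub * c unfolding R_estimate_iff by (intro mult_left_mono) auto
  finally show "rademacher_norm p N (\<lambda>j. blinfun_apply (w (\<xi> j) *\<^sub>R F (\<xi> j)) (x j)) \<le> c * C * rademacher_norm p N x"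
    by simp
qed

lemma R_estimate_sum:
  assumes p: "1 \<le> p" and I: "finite I" and F: "\<And>i. i \<in> I \<Longrightarrow> R_estimate p (C i) (F i ` A)"
  shows "R_estimate p (\<Sum>i\<in>I. C i) ((\<lambda>\<xi>. \<Sum>i\<in>I. F i \<xi>) ` A)"
  using I F
proof (induction I)
  case empty
  show ?case using p by (auto simp: R_estimate_image)
next
  case (insert i I)
  then show ?case using R_estimate_add[OF p, of "C i" "F i" A] by simp
qed

text \<open>
  Finitely many points meet only finitely many cells. The sum over the points splits according to
  the cells; in the part that belongs to one cell the vectors at all other points are replaced
  by \<open>0\<close>, which does not increase the average by the contraction principle.
\<close>

lemma R_estimate_cover:
  fixes F :: "'a \<Rightarrow> 'x::real_normed_vector \<Rightarrow>\<^sub>L 'y::real_normed_vector"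
  assumes p: "1 \<le> p" and A: "A \<subseteq> (\<Union>i\<in>I. Q i)"
    and F: "\<And>i. i \<in> I \<Longrightarrow> R_estimate p (C i) (F ` Q i)" and C: "\<And>i. i \<in> I \<Longrightarrow> 0 \<le> C i"
    and D: "\<And>J. finite J \<Longrightarrow> J \<subseteq> I \<Longrightarrow> (\<Sum>i\<in>J. C i) \<le> D"
  shows "R_estimate p D (F ` A)"
  unfolding R_estimate_image
proof safe
  fix N :: nat and \<xi> and x :: "nat \<Rightarrow> 'x"
  assume N: "1 \<le> N" and \<xi>: "\<forall>j<N. \<xi> j \<in> A"
  have "\<forall>j. \<exists>i. j < N \<longrightarrow> i \<in> I \<and> \<xi> j \<in> Q i" using \<xi> A by blast
  then obtain m where m: "\<And>j. j < N \<Longrightarrow> m j \<in> I \<and> \<xi> j \<in> Q (m j)" by metis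
  define J where "J = m ` {..<N}"
  have J: "finite J" "J \<subseteq> I" using m by (auto simp: J_def)
  define y where "y i j = (if m j = i then x j else 0)" for i j
  have y: "rademacher_norm p N (y i) \<le> rademacher_norm p N x" for i
  proof -
    have "y i = (\<lambda>j. (if m j = i then 1 else 0) *\<^sub>R x j)" by (auto simp: y_def)
    then show ?thesis using contraction_principle[OF p, of 1 N "\<lambda>j. if m j = i then 1 else 0" x] by simp
  qed
  have "rademacher_norm p N (\<lambda>j. blinfun_apply (F (\<xi> j)) (x j))
      = rademacher_norm p N (\<lambda>j. \<Sum>i\<in>J. blinfun_apply (F (\<xi> j)) (y i j))"
  proof (rule rademacher_norm_cong)
    fix j assume "j < N"
    then have "m j \<in> J" by (simp add: J_def)
    show "blinfun_apply (F (\<xi> j)) (x j) = (\<Sum>i\<in>J. blinfun_apply (F (\<xi> j)) (y i j))"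
    proof -
      have "(\<Sum>i\<in>J. y i j) = x j" using J \<open>m j \<in> J\<close> by (simp add: y_def)
      then show ?thesis by (metis blinfun.sum_right)
    qed
  qed
  also have "\<dots> \<le> (\<Sum>i\<in>J. rademacher_norm p N (\<lambda>j. blinfun_apply (F (\<xi> j)) (y i j)))"
    by (rule rademacher_norm_sum[OF p J(1)])
  also have "\<dots> \<le> (\<Sum>i\<in>J. C i * rademacher_norm p N x)"
  proof (rule sum_mono)
    fix i assume i: "i \<in> J"
    then obtain j0 where j0: "j0 < N" "i = m j0" by (auto simp: J_def)
    \<comment> \<open>points outside the cell are moved into it, which is harmless as their vectors are \<open>0\<close>\<close>
    define \<eta> where "\<eta> j = (if m j = i then \<xi> j else \<xi> j0)" for j
    have "rademacher_norm p N (\<lambda>j. blinfun_apply (F (\<xi> j)) (y i j)) = rademacher_norm p N (\<lambda>j. blinfun_apply (F (\<eta> j)) (y i j))"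
      by (intro rademacher_norm_cong) (auto simp: \<eta>_def y_def blinfun.zero_right)
    also have "\<dots> \<le> C i * rademacher_norm p N (y i)"
    proof -
      have "\<forall>j<N. \<eta> j \<in> Q i" using m j0 unfolding \<eta>_def by metis
      then show ?thesis using F[of i] i J N unfolding R_estimate_image by blast
    qed
    also have "\<dots> \<le> C i * rademacher_norm p N x"
      using y C i J by (intro mult_left_mono) auto
    finally show "rademacher_norm p N (\<lambda>j. blinfun_apply (F (\<xi> j)) (y i j)) \<le> C i * rademacher_norm p N x" .
  qed
  also have "\<dots> \<le> D * rademacher_norm p N x"
    unfolding sum_distrib_right[symmetric] by (intro mult_right_mono D J rademacher_norm_nonneg)
  finally show "rademacher_norm p N (\<lambda>j. blinfun_apply (F (\<xi> j)) (x j)) \<le> D * rademacher_norm p N x" .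
qed

text \<open>
  The estimate involves finitely many points at a time, so pointwise convergence is enough.
\<close>

lemma R_estimate_limit:
  assumes p: "1 \<le> p" and F: "\<And>m. R_estimate p C (F m ` A)"
    and lim: "\<And>\<xi>. \<xi> \<in> A \<Longrightarrow> (\<lambda>m. F m \<xi>) \<longlonglongrightarrow> G \<xi>"
  shows "R_estimate p C (G ` A)"
  unfolding R_estimate_image
proof safe
  fix N :: nat and \<xi> x
  assume *: "1 \<le> N" "\<forall>j<N. \<xi> j \<in> A"
  have "(\<lambda>m. rademacher_norm p N (\<lambda>j. blinfun_apply (F m (\<xi> j)) (x j)))
      \<longlonglongrightarrow> rademacher_norm p N (\<lambda>j. blinfun_apply (G (\<xi> j)) (x j))"
  proof -
    have "(\<lambda>m. norm (\<Sum>j<N. \<epsilon> j *\<^sub>R blinfun_apply (F m (\<xi> j)) (x j)) powr p)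
        \<longlonglongrightarrow> norm (\<Sum>j<N. \<epsilon> j *\<^sub>R blinfun_apply (G (\<xi> j)) (x j)) powr p" for \<epsilon> :: "nat \<Rightarrow> real"
    proof -
      have "(\<lambda>m. \<Sum>j<N. \<epsilon> j *\<^sub>R blinfun_apply (F m (\<xi> j)) (x j)) \<longlonglongrightarrow> (\<Sum>j<N. \<epsilon> j *\<^sub>R blinfun_apply (G (\<xi> j)) (x j))"
        using lim * by (intro tendsto_sum tendsto_scaleR blinfun.tendsto tendsto_const) auto
      then show ?thesis using p by (intro tendsto_powr'[OF _ tendsto_const] tendsto_norm) auto
    qed
    then show ?thesis
      unfolding rademacher_norm_def using p
      by (intro tendsto_powr'[OF tendsto_sum tendsto_const]) (simp_all add: sum_nonneg)
  qed
  then show "rademacher_norm p N (\<lambda>j. blinfun_apply (G (\<xi> j)) (x j)) \<le> C * rademacher_norm p N x"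
    by (rule LIMSEQ_le_const2) (use F * in \<open>auto simp: R_estimate_image\<close>)
qed

lemma R_bound_le: "0 \<le> C \<Longrightarrow> R_estimate p C \<T> \<Longrightarrow> R_bound p \<T> \<le> C"
  unfolding R_bound_def by (rule cInf_lower) (auto intro: bdd_belowI[of _ 0])

lemma R_bound_add_le:
  assumes p: "1 \<le> p" and F: "R_bounded p (F ` A)" and G: "R_bounded p (G ` A)"
  shows "R_bound p ((\<lambda>\<xi>. F \<xi> + G \<xi>) ` A) \<le> R_bound p (F ` A) + R_bound p (G ` A)"
proof -
  let ?S = "\<lambda>\<T>. {C. 0 \<le> C \<and> R_estimate p C \<T>}"
  have FG: "?S (F ` A) \<noteq> {}" "?S (G ` A) \<noteq> {}" using F G by (auto simp: R_bounded_def)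
  have 1: "R_bound p ((\<lambda>\<xi>. F \<xi> + G \<xi>) ` A) \<le> C + D" if "C \<in> ?S (F ` A)" "D \<in> ?S (G ` A)" for C D
    using that R_estimate_add[OF p, of C F A D G] by (intro R_bound_le) auto
  have 2: "R_bound p ((\<lambda>\<xi>. F \<xi> + G \<xi>) ` A) - D \<le> R_bound p (F ` A)" if "D \<in> ?S (G ` A)" for D
    unfolding R_bound_def[of p "F ` A"] using FG 1[OF _ that] by (intro cInf_greatest) force+
  have "R_bound p ((\<lambda>\<xi>. F \<xi> + G \<xi>) ` A) - R_bound p (F ` A) \<le> R_bound p (G ` A)"
    unfolding R_bound_def[of p "G ` A"] using FG 2 by (intro cInf_greatest) force+
  then show ?thesis by simp
qed

lemma R_bounded_add:
  assumes "1 \<le> p" "R_bounded p (F ` A)" "R_bounded p (G ` A)"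
  shows "R_bounded p ((\<lambda>\<xi>. F \<xi> + G \<xi>) ` A)"
  using assms R_estimate_add unfolding R_bounded_def by (metis add_nonneg_nonneg)

lemma R_bounded_uminus:
  assumes "1 \<le> p" "R_bounded p (F ` A)"
  shows "R_bounded p ((\<lambda>\<xi>. - F \<xi>) ` A)"
proof -
  obtain C where C: "0 \<le> C" "R_estimate p C (F ` A)" using assms by (auto simp: R_bounded_def)
  have "R_estimate p (1 * C) ((\<lambda>\<xi>. (-1) *\<^sub>R F \<xi>) ` A)"
    by (rule R_estimate_scaleR[OF assms(1) C(2)]) auto
  then show ?thesis using C by (auto simp: R_bounded_def)
qed


section \<open>Smooth functions on open sets\<close>

abbreviation frechet :: "('a::real_normed_vector \<Rightarrow> 'b::real_normed_vector) \<Rightarrow> 'a \<Rightarrow> 'a \<Rightarrow> 'b" where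
  "frechet f x \<equiv> frechet_derivative f (at x)"

lemma higher_differentiable_on_cong:
  assumes "open W" "\<And>x. x \<in> W \<Longrightarrow> f x = g x" "higher_differentiable_on W f k"
  shows "higher_differentiable_on W g k"
  using assms(2,3)
proof (induction k arbitrary: f g)
  case 0
  then show ?case by (simp cong: continuous_on_cong)
next
  case (Suc k)
  have d: "(g has_derivative frechet f x) (at x)" if "x \<in> W" for x
    using has_derivative_transform_within_open[OF _ assms(1) that, of f "frechet f x" UNIV g] Suc.prems that
    by (auto simp: frechet_derivative_works)
  show ?case
    unfolding higher_differentiable_on.simps
  proof safe
    fix x assume "x \<in> W"
    then show "g differentiable at x" using d by (auto simp: differentiable_def)
  next
    fix v
    show "higher_differentiable_on W (\<lambda>x. frechet g x v) k"
      by (rule Suc.IH[of "\<lambda>x. frechet f x v"]) (use Suc.prems frechet_derivative_at[OF d] in auto)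
  qed
qed

text \<open>
  Any formula for the derivative on \<open>W\<close> can replace the abstract one.
\<close>

lemma higher_differentiable_on_SucI:
  assumes "open W" "\<And>x. x \<in> W \<Longrightarrow> (f has_derivative F x) (at x)"
    "\<And>v. higher_differentiable_on W (\<lambda>x. F x v) k"
  shows "higher_differentiable_on W f (Suc k)"
  unfolding higher_differentiable_on.simps
proof safe
  fix x assume "x \<in> W"
  then show "f differentiable at x" using assms(2) by (auto simp: differentiable_def)
next
  fix v
  show "higher_differentiable_on W (\<lambda>x. frechet f x v) k"
    by (rule higher_differentiable_on_cong[OF assms(1) _ assms(3)[of v]])
       (simp add: frechet_derivative_at[OF assms(2)])
qed

lemma higher_differentiable_on_SucD:
  assumes "higher_differentiable_on W f (Suc k)"
  shows "x \<in> W \<Longrightarrow> (f has_derivative frechet f x) (at x)"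
    and "higher_differentiable_on W (\<lambda>x. frechet f x v) k"
  using assms by (auto simp: frechet_derivative_works)

lemma higher_differentiable_on_pred: "higher_differentiable_on W f (Suc k) \<Longrightarrow> higher_differentiable_on W f k"
proof (induction k arbitrary: f)
  case 0
  then show ?case
    by (auto intro!: continuous_at_imp_continuous_on differentiable_imp_continuous_within)
next
  case (Suc k)
  then show ?case by (metis higher_differentiable_on.simps(2))
qed

lemma higher_differentiable_on_subset:
  "W' \<subseteq> W \<Longrightarrow> higher_differentiable_on W f k \<Longrightarrow> higher_differentiable_on W' f k"
  by (induction k arbitrary: f) (auto intro: continuous_on_subset)

lemma higher_differentiable_on_const: "open W \<Longrightarrow> higher_differentiable_on W (\<lambda>x. c) k"
proof (induction k arbitrary: c)
  case (Suc k)
  show ?case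
    by (rule higher_differentiable_on_SucI[where F = "\<lambda>x v. 0"]) (use Suc in auto)
qed simp

lemma higher_differentiable_on_add:
  assumes "open W"
  shows "higher_differentiable_on W f k \<Longrightarrow> higher_differentiable_on W g k
    \<Longrightarrow> higher_differentiable_on W (\<lambda>x. f x + g x) k"
proof (induction k arbitrary: f g)
  case (Suc k)
  note f = higher_differentiable_on_SucD[OF Suc.prems(1)] and g = higher_differentiable_on_SucD[OF Suc.prems(2)]
  show ?case
    by (rule higher_differentiable_on_SucI[where F = "\<lambda>x v. frechet f x v + frechet g x v"])
       (intro assms has_derivative_add f g Suc.IH; assumption)+
qed (auto intro: continuous_on_add)

lemma higher_differentiable_on_scaleR:
  fixes \<sigma> :: "'a::euclidean_space \<Rightarrow> real"
  assumes "open W"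
  shows "higher_differentiable_on W \<sigma> k \<Longrightarrow> higher_differentiable_on W f k
    \<Longrightarrow> higher_differentiable_on W (\<lambda>x. \<sigma> x *\<^sub>R f x) k"
proof (induction k arbitrary: \<sigma> f)
  case (Suc k)
  note s = higher_differentiable_on_SucD[OF Suc.prems(1)] and f = higher_differentiable_on_SucD[OF Suc.prems(2)]
  show ?case
    by (rule higher_differentiable_on_SucI[where F = "\<lambda>x v. \<sigma> x *\<^sub>R frechet f x v + frechet \<sigma> x v *\<^sub>R f x"])
       (intro assms has_derivative_scaleR higher_differentiable_on_add s f Suc.IH higher_differentiable_on_pred[OF Suc.prems(1)]
         higher_differentiable_on_pred[OF Suc.prems(2)]; assumption)+
qed (auto intro: continuous_on_scaleR)

lemma higher_differentiable_on_bounded_linear: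
  assumes "open W" "bounded_linear L"
  shows "higher_differentiable_on W f k \<Longrightarrow> higher_differentiable_on W (\<lambda>x. L (f x)) k"
proof (induction k arbitrary: f)
  case 0
  then show ?case using assms(2) by (auto intro: bounded_linear.continuous_on)
next
  case (Suc k)
  note f = higher_differentiable_on_SucD[OF Suc.prems(1)]
  show ?case
    by (rule higher_differentiable_on_SucI[where F = "\<lambda>x v. L (frechet f x v)"])
       (intro assms bounded_linear.has_derivative[OF assms(2)] f Suc.IH; assumption)+
qed

lemma higher_differentiable_on_sum:
  assumes "open W" "finite I" "\<And>i. i \<in> I \<Longrightarrow> higher_differentiable_on W (f i) k"
  shows "higher_differentiable_on W (\<lambda>x. \<Sum>i\<in>I. f i x) k"
  using assms(2,3) by (induction I) (auto intro: higher_differentiable_on_const higher_differentiable_on_add assms)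

lemma smooth_on_cong: "open W \<Longrightarrow> (\<And>x. x \<in> W \<Longrightarrow> f x = g x) \<Longrightarrow> smooth_on W f \<Longrightarrow> smooth_on W g"
  unfolding smooth_on_def by (metis higher_differentiable_on_cong)

lemma smooth_on_subset: "W' \<subseteq> W \<Longrightarrow> smooth_on W f \<Longrightarrow> smooth_on W' f"
  unfolding smooth_on_def by (metis higher_differentiable_on_subset)

lemma smooth_on_imp_continuous_on: "smooth_on W f \<Longrightarrow> continuous_on W f"
  unfolding smooth_on_def by (metis higher_differentiable_on.simps(1))

lemma smooth_on_has_derivative: "smooth_on W f \<Longrightarrow> x \<in> W \<Longrightarrow> (f has_derivative frechet f x) (at x)"
  unfolding smooth_on_def by (metis higher_differentiable_on_SucD(1))

lemma smooth_on_const: "open W \<Longrightarrow> smooth_on W (\<lambda>x. c)"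
  unfolding smooth_on_def by (metis higher_differentiable_on_const)

lemma smooth_on_add: "open W \<Longrightarrow> smooth_on W f \<Longrightarrow> smooth_on W g \<Longrightarrow> smooth_on W (\<lambda>x. f x + g x)"
  unfolding smooth_on_def by (metis higher_differentiable_on_add)

lemma smooth_on_scaleR:
  "open W \<Longrightarrow> smooth_on W \<sigma> \<Longrightarrow> smooth_on W f \<Longrightarrow> smooth_on W (\<lambda>x. \<sigma> x *\<^sub>R f x)"
  unfolding smooth_on_def by (metis higher_differentiable_on_scaleR)

lemma smooth_on_mult:
  "open W \<Longrightarrow> smooth_on W f \<Longrightarrow> smooth_on W g \<Longrightarrow> smooth_on W (\<lambda>x. f x * g x :: real)"
  using smooth_on_scaleR[of W f g] by simp

lemma smooth_on_minus: "open W \<Longrightarrow> smooth_on W f \<Longrightarrow> smooth_on W (\<lambda>x. - f x)"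
  using smooth_on_scaleR[OF _ smooth_on_const, of W f "-1"] by simp

lemma smooth_on_diff: "open W \<Longrightarrow> smooth_on W f \<Longrightarrow> smooth_on W g \<Longrightarrow> smooth_on W (\<lambda>x. f x - g x)"
  using smooth_on_add[OF _ _ smooth_on_minus, of W f g] by simp

lemma smooth_on_sum:
  "open W \<Longrightarrow> finite I \<Longrightarrow> (\<And>i. i \<in> I \<Longrightarrow> smooth_on W (f i)) \<Longrightarrow> smooth_on W (\<lambda>x. \<Sum>i\<in>I. f i x)"
  unfolding smooth_on_def using higher_differentiable_on_sum by blast

lemma smooth_on_power: "open W \<Longrightarrow> smooth_on W f \<Longrightarrow> smooth_on W (\<lambda>x. f x ^ m :: real)"
  by (induction m) (auto intro: smooth_on_const smooth_on_mult)

lemma smooth_on_id: "open W \<Longrightarrow> smooth_on W (\<lambda>x. x)"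
  unfolding smooth_on_def
proof
  fix k assume "open W"
  then show "higher_differentiable_on W (\<lambda>x. x) k"
  proof (cases k)
    case (Suc m)
    then show ?thesis using \<open>open W\<close>
      by (auto intro!: higher_differentiable_on_SucI[where F = "\<lambda>x v. v"] higher_differentiable_on_const)
  qed auto
qed

lemma smooth_on_bounded_linear:
  "open W \<Longrightarrow> bounded_linear L \<Longrightarrow> smooth_on W f \<Longrightarrow> smooth_on W (\<lambda>x. L (f x))"
  unfolding smooth_on_def by (metis higher_differentiable_on_bounded_linear)

text \<open>
  Differentiation lowers the exponent by one, so all exponents are treated simultaneously in the
  induction on the order of differentiability.
\<close>

lemma smooth_on_powr:
  fixes \<sigma> :: "'a::euclidean_space \<Rightarrow> real"
  assumes "open W" "smooth_on W \<sigma>" "\<And>x. x \<in> W \<Longrightarrow> 0 < \<sigma> x"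
  shows "smooth_on W (\<lambda>x. \<sigma> x powr s)"
proof -
  have "higher_differentiable_on W (\<lambda>x. \<sigma> x powr s) k" for k
  proof (induction k arbitrary: s)
    case 0
    have "continuous_on W (\<lambda>x. \<sigma> x powr s)"
      using assms(3) by (intro continuous_intros smooth_on_imp_continuous_on[OF assms(2)]) force
    then show ?case by simp
  next
    case (Suc k)
    have s: "higher_differentiable_on W \<sigma> (Suc k)" using assms(2) unfolding smooth_on_def by blast
    show ?case
    proof (rule higher_differentiable_on_SucI[where F = "\<lambda>x v. \<sigma> x powr (s - 1) *\<^sub>R (s *\<^sub>R frechet \<sigma> x v)"])
      fix x assume x: "x \<in> W"
      have "((\<lambda>x. \<sigma> x powr s) has_derivative (\<lambda>h. \<sigma> x powr s * (0 * ln (\<sigma> x) + frechet \<sigma> x h * s / \<sigma> x))) (at x)"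
        by (rule has_derivative_powr[OF higher_differentiable_on_SucD(1)[OF s x]])
           (use assms(3)[OF x] in auto)
      moreover have "\<sigma> x powr (s - 1) = \<sigma> x powr s / \<sigma> x"
        using assms(3)[OF x] by (simp add: powr_diff)
      ultimately show "((\<lambda>x. \<sigma> x powr s) has_derivative (\<lambda>v. \<sigma> x powr (s - 1) *\<^sub>R (s *\<^sub>R frechet \<sigma> x v))) (at x)"
        by (simp add: algebra_simps)
    next
      fix v
      show "higher_differentiable_on W (\<lambda>x. \<sigma> x powr (s - 1) *\<^sub>R (s *\<^sub>R frechet \<sigma> x v)) k"
        by (intro higher_differentiable_on_scaleR Suc assms higher_differentiable_on_const
              higher_differentiable_on_SucD[OF s])
    qed (rule assms)
  qed
  then show ?thesis by (simp add: smooth_on_def)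
qed

text \<open>
  In an orthonormal basis the chain rule expresses the derivative of a composition by products of
  scalar functions with compositions of one order less.
\<close>

lemma smooth_on_compose:
  fixes f :: "'b::euclidean_space \<Rightarrow> 'c::real_normed_vector" and \<phi> :: "'a::euclidean_space \<Rightarrow> 'b"
  assumes "open W" "open V" "\<phi> ` W \<subseteq> V" "smooth_on V f" "smooth_on W \<phi>"
  shows "smooth_on W (f \<circ> \<phi>)"
proof -
  have "higher_differentiable_on W (f \<circ> \<phi>) k"
    if "higher_differentiable_on V f k" "higher_differentiable_on W \<phi> k" for k
    using that
  proof (induction k arbitrary: f)
    case 0
    then have "continuous_on (\<phi> ` W) f" using assms(3) by (auto intro: continuous_on_subset)
    then show ?case using 0 continuous_on_compose[of W \<phi> f] by simp
  next
    case (Suc k)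
    note f = higher_differentiable_on_SucD[OF Suc.prems(1)] and p = higher_differentiable_on_SucD[OF Suc.prems(2)]
    let ?F = "\<lambda>x v. \<Sum>b\<in>Basis. (frechet \<phi> x v \<bullet> b) *\<^sub>R ((\<lambda>y. frechet f y b) \<circ> \<phi>) x"
    show ?case
    proof (rule higher_differentiable_on_SucI[where F = ?F])
      fix x assume x: "x \<in> W"
      then have px: "\<phi> x \<in> V" using assms(3) by auto
      have "(f \<circ> \<phi> has_derivative frechet f (\<phi> x) \<circ> frechet \<phi> x) (at x)"
        by (intro diff_chain_at p f x px)
      moreover have "frechet f (\<phi> x) \<circ> frechet \<phi> x = ?F x"
      proof
        fix v
        have lin: "linear (frechet f (\<phi> x))" using f(1)[OF px] has_derivative_linear by blast
        have "frechet f (\<phi> x) (frechet \<phi> x v) = frechet f (\<phi> x) (\<Sum>b\<in>Basis. (frechet \<phi> x v \<bullet> b) *\<^sub>R b)"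
          by (simp add: euclidean_representation)
        then show "(frechet f (\<phi> x) \<circ> frechet \<phi> x) v = ?F x v"
          by (simp add: linear_sum[OF lin] linear_cmul[OF lin])
      qed
      ultimately show "(f \<circ> \<phi> has_derivative ?F x) (at x)" by simp
    next
      fix v
      show "higher_differentiable_on W (\<lambda>x. ?F x v) k"
        by (intro higher_differentiable_on_sum higher_differentiable_on_scaleR assms(1) finite_Basis Suc.IH f p
            higher_differentiable_on_pred[OF Suc.prems(2)]
            higher_differentiable_on_bounded_linear[OF assms(1) bounded_linear_inner_left])
    qed (rule assms)
  qed
  then show ?thesis using assms by (simp add: smooth_on_def)
qed

lemma smooth_on_Un:
  assumes "open U" "open V" "smooth_on U f" "smooth_on V f"
  shows "smooth_on (U \<union> V) f"
proof -
  have "higher_differentiable_on (U \<union> V) f k"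
    if "higher_differentiable_on U f k" "higher_differentiable_on V f k" for k
    using that assms(1,2) by (induction k arbitrary: f) (auto intro: continuous_on_open_Un)
  then show ?thesis using assms by (simp add: smooth_on_def)
qed


section \<open>Iterated partial derivatives\<close>

text \<open>
  Lists of directions allow induction on the order of differentiation. Multi-indices, which
  define the seminorms, are recovered once partial derivatives are known to commute.
\<close>

definition iter_partial :: "'n list \<Rightarrow> (real^'n::finite \<Rightarrow> 'b::real_normed_vector) \<Rightarrow> real^'n \<Rightarrow> 'b" where
  "iter_partial js f = foldr partial_deriv js f"

lemma iter_partial_Nil [simp]: "iter_partial [] f = f"
  and iter_partial_Cons [simp]: "iter_partial (j # js) f = partial_deriv j (iter_partial js f)"
  and iter_partial_append: "iter_partial (js @ ks) f = iter_partial js (iter_partial ks f)"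
  by (simp_all add: iter_partial_def)

lemma iter_partial_replicate: "iter_partial (replicate m j) f = (partial_deriv j ^^ m) f"
  by (induction m) auto

lemma smooth_on_partial_deriv: "smooth_on W f \<Longrightarrow> smooth_on W (partial_deriv j f)"
  unfolding smooth_on_def partial_deriv_def by (metis higher_differentiable_on_SucD(2))

lemma smooth_on_iter_partial: "smooth_on W f \<Longrightarrow> smooth_on W (iter_partial js f)"
  by (induction js) (auto intro: smooth_on_partial_deriv)

lemma partial_deriv_cong:
  assumes "open W" "x \<in> W" "\<And>x. x \<in> W \<Longrightarrow> f x = g x" "f differentiable at x"
  shows "partial_deriv j f x = partial_deriv j g x"
  unfolding partial_deriv_def
  using frechet_derivative_transform_within_open[OF assms(4,1,2), of g] assms(3) by simp

lemma iter_partial_cong: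
  assumes "open W" "\<And>x. x \<in> W \<Longrightarrow> f x = g x" "smooth_on W f" "x \<in> W"
  shows "iter_partial js f x = iter_partial js g x"
  using assms(4)
proof (induction js arbitrary: x)
  case (Cons j js)
  have "(iter_partial js f) differentiable at x"
    using smooth_on_has_derivative[OF smooth_on_iter_partial[OF assms(3)] Cons.prems]
    by (auto simp: differentiable_def)
  then show ?case using partial_deriv_cong[OF assms(1) Cons.prems Cons.IH] by simp
qed (use assms in simp)

lemma partial_deriv_add:
  assumes "smooth_on W f" "smooth_on W g" "x \<in> W"
  shows "partial_deriv j (\<lambda>x. f x + g x) x = partial_deriv j f x + partial_deriv j g x"
  unfolding partial_deriv_def
  using frechet_derivative_at[OF has_derivative_add[OF smooth_on_has_derivative[OF assms(1,3)] smooth_on_has_derivative[OF assms(2,3)]]]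
  by (simp add: fun_eq_iff)

lemma partial_deriv_scaleR:
  assumes "smooth_on W \<sigma>" "smooth_on W f" "x \<in> W"
  shows "partial_deriv j (\<lambda>x. \<sigma> x *\<^sub>R f x) x = \<sigma> x *\<^sub>R partial_deriv j f x + partial_deriv j \<sigma> x *\<^sub>R f x"
  unfolding partial_deriv_def
  using frechet_derivative_at[OF has_derivative_scaleR[OF smooth_on_has_derivative[OF assms(1,3)] smooth_on_has_derivative[OF assms(2,3)]]]
  by (simp add: fun_eq_iff)

lemma iter_partial_add:
  assumes "open W" "smooth_on W f" "smooth_on W g" "x \<in> W"
  shows "iter_partial js (\<lambda>x. f x + g x) x = iter_partial js f x + iter_partial js g x"
  using assms(4)
proof (induction js arbitrary: x)
  case (Cons j js)
  let ?F = "iter_partial js f" and ?G = "iter_partial js g"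
  have sm: "smooth_on W ?F" "smooth_on W ?G" using assms smooth_on_iter_partial by auto
  have "partial_deriv j (\<lambda>x. ?F x + ?G x) x = partial_deriv j (iter_partial js (\<lambda>x. f x + g x)) x"
    using smooth_on_has_derivative[OF smooth_on_add[OF assms(1) sm] Cons.prems] Cons.IH
    by (intro partial_deriv_cong[OF assms(1) Cons.prems]) (auto simp: differentiable_def)
  then show ?case using partial_deriv_add[OF sm Cons.prems] by simp
qed simp

lemma iter_partial_scale:
  assumes "open W" "smooth_on W f" "x \<in> W"
  shows "iter_partial js (\<lambda>x. c *\<^sub>R f x) x = c *\<^sub>R iter_partial js f x"
  using assms(3)
proof (induction js arbitrary: x)
  case (Cons j js)
  let ?F = "iter_partial js f"
  have sm: "smooth_on W ?F" using assms smooth_on_iter_partial by auto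
  have "((\<lambda>x. c *\<^sub>R ?F x) has_derivative (\<lambda>v. c *\<^sub>R frechet ?F x v)) (at x)"
    by (intro has_derivative_scaleR_right smooth_on_has_derivative[OF sm Cons.prems])
  then have "(iter_partial js (\<lambda>x. c *\<^sub>R f x) has_derivative (\<lambda>v. c *\<^sub>R frechet ?F x v)) (at x)"
    by (rule has_derivative_transform_within_open[OF _ assms(1) Cons.prems]) (simp add: Cons.IH)
  from frechet_derivative_at[OF this] show ?case by (simp add: partial_deriv_def fun_eq_iff)
qed simp

lemma iter_partial_sum:
  assumes "open W" "finite I" "\<And>i. i \<in> I \<Longrightarrow> smooth_on W (f i)" "x \<in> W"
  shows "iter_partial js (\<lambda>x. \<Sum>i\<in>I. f i x) x = (\<Sum>i\<in>I. iter_partial js (f i) x)"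
  using assms(2,3)
proof (induction I)
  case empty
  then show ?case using iter_partial_scale[OF assms(1) smooth_on_const[OF assms(1), of 0] assms(4), of js 0] by simp
next
  case (insert i I)
  then show ?case
    using iter_partial_add[OF assms(1) _ smooth_on_sum[OF assms(1)] assms(4), of "f i" I f js] by simp
qed

lemma has_vector_derivative_along_axis:
  assumes "smooth_on W f" "y + t *\<^sub>R axis j 1 \<in> W"
  shows "((\<lambda>t. f (y + t *\<^sub>R axis j 1)) has_vector_derivative partial_deriv j f (y + t *\<^sub>R axis j 1)) (at t within S)"
proof -
  let ?e = "axis j (1::real)"
  have f: "(f has_derivative frechet f (y + t *\<^sub>R ?e)) (at (y + t *\<^sub>R ?e))"
    by (rule smooth_on_has_derivative[OF assms])
  have "((\<lambda>t. y + t *\<^sub>R ?e) has_derivative (\<lambda>s. s *\<^sub>R ?e)) (at t within S)"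
    by (auto intro!: derivative_eq_intros)
  from has_derivative_compose[OF this f]
  show ?thesis
    using linear_cmul[OF has_derivative_linear[OF f]]
    by (simp add: has_vector_derivative_def partial_deriv_def)
qed

text \<open>
  The mean value inequality for \<open>g t - t v\<close>.
\<close>

lemma vector_mean_value_bound:
  fixes g :: "real \<Rightarrow> 'b::real_normed_vector"
  assumes "a \<le> b" "\<And>t. t \<in> {a..b} \<Longrightarrow> (g has_vector_derivative g' t) (at t within {a..b})"
    "\<And>t. t \<in> {a..b} \<Longrightarrow> norm (g' t - v) \<le> B"
  shows "norm (g b - g a - (b - a) *\<^sub>R v) \<le> B * (b - a)"
proof -
  have "norm ((g b - b *\<^sub>R v) - (g a - a *\<^sub>R v)) \<le> B * norm (b - a)"
  proof (rule differentiable_bound[where S = "{a..b}" and f' = "\<lambda>t s. s *\<^sub>R (g' t - v)"])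
    fix t assume t: "t \<in> {a..b}"
    show "((\<lambda>t. g t - t *\<^sub>R v) has_derivative (\<lambda>s. s *\<^sub>R (g' t - v))) (at t within {a..b})"
      using assms(2)[OF t] unfolding has_vector_derivative_def
      by (auto intro!: derivative_eq_intros simp: algebra_simps)
    show "onorm (\<lambda>s. s *\<^sub>R (g' t - v)) \<le> B"
      using assms(3)[OF t] by (intro onorm_le) (simp add: mult.commute[of B] mult_left_mono)
  qed (use assms in auto)
  then show ?thesis using assms(1) by (simp add: algebra_simps)
qed

text \<open>
  The mean value inequality in direction \<open>j\<close> for the derivative in direction \<open>i\<close>, followed by
  the one in direction \<open>i\<close>. The second difference is symmetric in \<open>i\<close> and \<open>j\<close>, which makes
  partial derivatives commute.
\<close>

lemma second_difference_quotient:
  fixes f :: "real^'n::finite \<Rightarrow> 'b::real_normed_vector"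
  assumes W: "open W" "x \<in> W" and f: "smooth_on W f" and e: "0 < e"
  obtains \<delta> where "0 < \<delta>" "\<And>h. 0 < h \<Longrightarrow> h < \<delta> \<Longrightarrow>
    norm (f (x + h *\<^sub>R axis i 1 + h *\<^sub>R axis j 1) - f (x + h *\<^sub>R axis i 1) - f (x + h *\<^sub>R axis j 1) + f x
      - (h * h) *\<^sub>R partial_deriv j (partial_deriv i f) x) \<le> e * (h * h)"
proof -
  let ?i = "axis i (1::real)" and ?j = "axis j (1::real)"
  let ?g = "partial_deriv j (partial_deriv i f)"
  have "continuous_on W ?g" by (intro smooth_on_imp_continuous_on smooth_on_partial_deriv f)
  then have "continuous (at x) ?g" using W by (simp add: continuous_on_eq_continuous_at)
  then obtain d1 where d1: "0 < d1" "\<And>y. dist y x < d1 \<Longrightarrow> dist (?g y) (?g x) < e"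
    unfolding continuous_at_eps_delta using e by metis
  obtain d2 where d2: "0 < d2" "ball x d2 \<subseteq> W" using W openE by blast
  define \<delta> where "\<delta> = min d1 d2 / 2"
  show ?thesis
  proof (rule that[of \<delta>])
    show "0 < \<delta>" using d1 d2 by (simp add: \<delta>_def)
    fix h assume h: "0 < h" "h < \<delta>"
    have near: "dist (x + s *\<^sub>R ?i + t *\<^sub>R ?j) x < min d1 d2" if "s \<in> {0..h}" "t \<in> {0..h}" for s t
    proof -
      have "dist (x + s *\<^sub>R ?i + t *\<^sub>R ?j) x = norm (s *\<^sub>R ?i + t *\<^sub>R ?j)" by (simp add: dist_norm)
      also have "\<dots> \<le> \<bar>s\<bar> + \<bar>t\<bar>" by (rule order_trans[OF norm_triangle_ineq]) simp
      also have "\<dots> < min d1 d2" using that h by (auto simp: \<delta>_def)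
      finally show ?thesis .
    qed
    have inW: "x + s *\<^sub>R ?i + t *\<^sub>R ?j \<in> W" if "s \<in> {0..h}" "t \<in> {0..h}" for s t
      using near[OF that] d2 by (auto simp: dist_commute)
    have inW': "x + s *\<^sub>R ?i \<in> W" if "s \<in> {0..h}" for s
      using inW[OF that, of 0] h by auto
    have "norm ((f (x + h *\<^sub>R ?j + h *\<^sub>R ?i) - f (x + h *\<^sub>R ?i)) - (f (x + h *\<^sub>R ?j + 0 *\<^sub>R ?i) - f (x + 0 *\<^sub>R ?i))
        - (h - 0) *\<^sub>R (h *\<^sub>R ?g x)) \<le> (e * h) * (h - 0)"
    proof (rule vector_mean_value_bound[where g = "\<lambda>s. f (x + h *\<^sub>R ?j + s *\<^sub>R ?i) - f (x + s *\<^sub>R ?i)"])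
      fix s assume s: "s \<in> {0..h}"
      show "((\<lambda>s. f (x + h *\<^sub>R ?j + s *\<^sub>R ?i) - f (x + s *\<^sub>R ?i)) has_vector_derivative
          (partial_deriv i f (x + h *\<^sub>R ?j + s *\<^sub>R ?i) - partial_deriv i f (x + s *\<^sub>R ?i))) (at s within {0..h})"
        using inW[OF s, of h] inW'[OF s] h
        by (intro has_vector_derivative_diff has_vector_derivative_along_axis[OF f]) (auto simp: add_ac)
      have "norm (partial_deriv i f (x + s *\<^sub>R ?i + h *\<^sub>R ?j) - partial_deriv i f (x + s *\<^sub>R ?i + 0 *\<^sub>R ?j) - (h - 0) *\<^sub>R ?g x)
          \<le> e * (h - 0)"
      proof (rule vector_mean_value_bound[where g = "\<lambda>t. partial_deriv i f (x + s *\<^sub>R ?i + t *\<^sub>R ?j)"])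
        fix t assume t: "t \<in> {0..h}"
        show "((\<lambda>t. partial_deriv i f (x + s *\<^sub>R ?i + t *\<^sub>R ?j)) has_vector_derivative ?g (x + s *\<^sub>R ?i + t *\<^sub>R ?j)) (at t within {0..h})"
          by (intro has_vector_derivative_along_axis[OF smooth_on_partial_deriv[OF f]] inW s t)
        show "norm (?g (x + s *\<^sub>R ?i + t *\<^sub>R ?j) - ?g x) \<le> e"
          using d1(2)[of "x + s *\<^sub>R ?i + t *\<^sub>R ?j"] near[OF s t] by (simp add: dist_norm)
      qed (use h in auto)
      then show "norm (partial_deriv i f (x + h *\<^sub>R ?j + s *\<^sub>R ?i) - partial_deriv i f (x + s *\<^sub>R ?i) - h *\<^sub>R ?g x) \<le> e * h"
        by (simp add: add_ac)
    qed (use h in auto)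
    then show "norm (f (x + h *\<^sub>R ?i + h *\<^sub>R ?j) - f (x + h *\<^sub>R ?i) - f (x + h *\<^sub>R ?j) + f x - (h * h) *\<^sub>R ?g x) \<le> e * (h * h)"
      by (simp add: algebra_simps)
  qed
qed

lemma partial_deriv_commute:
  fixes f :: "real^'n::finite \<Rightarrow> 'b::real_normed_vector"
  assumes "open W" "smooth_on W f" "x \<in> W"
  shows "partial_deriv i (partial_deriv j f) x = partial_deriv j (partial_deriv i f) x"
proof -
  let ?c = "partial_deriv i (partial_deriv j f) x" and ?d = "partial_deriv j (partial_deriv i f) x"
  have "norm (?c - ?d) \<le> 2 * e" if e: "0 < e" for e
  proof -
    obtain d1 where d1: "0 < d1" "\<And>h. 0 < h \<Longrightarrow> h < d1 \<Longrightarrow>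
      norm (f (x + h *\<^sub>R axis i 1 + h *\<^sub>R axis j 1) - f (x + h *\<^sub>R axis i 1) - f (x + h *\<^sub>R axis j 1) + f x
      - (h * h) *\<^sub>R ?d) \<le> e * (h * h)"
      using second_difference_quotient[OF assms(1,3,2) e] by blast
    obtain d2 where d2: "0 < d2" "\<And>h. 0 < h \<Longrightarrow> h < d2 \<Longrightarrow>
      norm (f (x + h *\<^sub>R axis j 1 + h *\<^sub>R axis i 1) - f (x + h *\<^sub>R axis j 1) - f (x + h *\<^sub>R axis i 1) + f x
      - (h * h) *\<^sub>R ?c) \<le> e * (h * h)"
      using second_difference_quotient[OF assms(1,3,2) e] by blast
    define h where "h = min d1 d2 / 2"
    have h: "0 < h" "h < d1" "h < d2" using d1 d2 by (auto simp: h_def)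
    let ?D = "f (x + h *\<^sub>R axis i 1 + h *\<^sub>R axis j 1) - f (x + h *\<^sub>R axis i 1) - f (x + h *\<^sub>R axis j 1) + f x"
    have "norm (?D - (h * h) *\<^sub>R ?d) \<le> e * (h * h)" by (rule d1(2)[OF h(1,2)])
    moreover have "norm (?D - (h * h) *\<^sub>R ?c) \<le> e * (h * h)" using d2(2)[OF h(1,3)] by (simp add: algebra_simps)
    ultimately have "norm ((?D - (h * h) *\<^sub>R ?d) - (?D - (h * h) *\<^sub>R ?c)) \<le> e * (h * h) + e * (h * h)"
      using norm_triangle_ineq4 by (rule order_trans[OF _ add_mono, rotated])
    also have "(?D - (h * h) *\<^sub>R ?d) - (?D - (h * h) *\<^sub>R ?c) = (h * h) *\<^sub>R (?c - ?d)"
      by (simp add: scaleR_diff_right)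
    finally have "(h * h) * norm (?c - ?d) \<le> (h * h) * (2 * e)" by (simp add: mult.commute mult.left_commute)
    then show ?thesis using h by (simp del: mult.assoc)
  qed
  from this[of "norm (?c - ?d) / 3"] have "norm (?c - ?d) \<le> 0" by (cases "?c = ?d") auto
  then show ?thesis by simp
qed

lemma iter_partial_move:
  assumes "open W" "smooth_on W f" "x \<in> W"
  shows "iter_partial (js @ j # ks) f x = iter_partial (j # js @ ks) f x"
  using assms(3)
proof (induction js arbitrary: x)
  case (Cons i js)
  have sm: "smooth_on W (iter_partial (js @ ks) f)" "smooth_on W (iter_partial (js @ j # ks) f)"
    by (intro smooth_on_iter_partial assms)+
  have "partial_deriv i (iter_partial (js @ j # ks) f) x = partial_deriv i (iter_partial (j # js @ ks) f) x"
    using smooth_on_has_derivative[OF sm(2) Cons.prems] Cons.IH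
    by (intro partial_deriv_cong[OF assms(1) Cons.prems]) (auto simp: differentiable_def)
  then show ?case using partial_deriv_commute[OF assms(1) sm(1) Cons.prems, of i j] by simp
qed simp

lemma iter_partial_mset_cong:
  assumes "open W" "smooth_on W f" "x \<in> W" "mset js = mset ks"
  shows "iter_partial js f x = iter_partial ks f x"
  using assms(3,4)
proof (induction js arbitrary: x ks)
  case (Cons j js)
  then have "j \<in> set ks" by (metis list.set_intros(1) set_mset_mset)
  then obtain k1 k2 where ks: "ks = k1 @ j # k2" by (meson split_list)
  then have "mset js = mset (k1 @ k2)" using Cons.prems by simp
  then have IH: "iter_partial js f y = iter_partial (k1 @ k2) f y" if "y \<in> W" for y
    using Cons.IH that by blast
  have "partial_deriv j (iter_partial js f) x = partial_deriv j (iter_partial (k1 @ k2) f) x"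
    using smooth_on_has_derivative[OF smooth_on_iter_partial[OF assms(2)] Cons.prems(1)]
    by (intro partial_deriv_cong[OF assms(1) Cons.prems(1) IH]) (auto simp: differentiable_def)
  then show ?case using iter_partial_move[OF assms(1,2) Cons.prems(1), of k1 j k2] ks by simp
qed simp

text \<open>
  The directions appear in the order in which \<open>multi_deriv\<close> applies them.
\<close>

definition multi_list :: "('n::finite \<Rightarrow> nat) \<Rightarrow> 'n list" where
  "multi_list \<beta> = concat (map (\<lambda>j. replicate (\<beta> j) j) coords)"

lemma coords: "distinct (coords :: 'n::finite list)" "set (coords :: 'n list) = UNIV"
proof -
  have "\<exists>js :: 'n list. distinct js \<and> set js = UNIV"
    using finite_distinct_list[of "UNIV :: 'n set"] by auto
  from someI_ex[OF this] show "distinct (coords :: 'n list)" "set (coords :: 'n list) = UNIV"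
    by (auto simp: coords_def)
qed

lemma multi_deriv_eq_iter_partial: "multi_deriv \<beta> f = iter_partial (multi_list \<beta>) f"
proof -
  have "foldr (\<lambda>j g. (partial_deriv j ^^ \<beta> j) g) js f = iter_partial (concat (map (\<lambda>j. replicate (\<beta> j) j) js)) f" for js
    by (induction js) (simp_all add: iter_partial_append iter_partial_replicate)
  then show ?thesis by (simp add: multi_deriv_def multi_list_def)
qed

lemma count_multi_list:
  fixes \<beta> :: "'n::finite \<Rightarrow> nat"
  shows "count (mset (multi_list \<beta>)) j = \<beta> j"
proof -
  have "count (mset (concat (map (\<lambda>j. replicate (\<beta> j) j) js))) j = (if j \<in> set js then \<beta> j else 0)"
    if "distinct js" for js
    using that by (induction js) auto
  from this[OF coords(1)] show ?thesis using coords(2)[where 'n = 'n] by (simp add: multi_list_def)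
qed

lemma iter_partial_eq_multi_deriv:
  assumes "open W" "smooth_on W f" "x \<in> W"
  shows "iter_partial js f x = multi_deriv (count (mset js)) f x"
  unfolding multi_deriv_eq_iter_partial
  by (rule iter_partial_mset_cong[OF assms]) (simp add: multiset_eq_iff count_multi_list)

text \<open>
  A qualitative form of the Leibniz rule; what matters is that the constant does not depend on
  \<open>u\<close>. The induction splits off the innermost derivative, so that the product rule is applied to
  the product itself and the multipliers \<open>\<sigma>\<close> and \<open>\<partial>\<^sub>j \<sigma>\<close> are covered by the induction hypothesis.
\<close>

lemma leibniz_bound:
  fixes \<sigma> :: "real^'n::finite \<Rightarrow> real"
  assumes "open W" "smooth_on W \<sigma>" "compact K" "K \<subseteq> W"
  shows "\<exists>C\<ge>0. \<forall>(u :: real^'n \<Rightarrow> 'b::real_normed_vector) D. smooth_on W u \<longrightarrow>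
    (\<forall>ks. length ks \<le> length js \<longrightarrow> (\<forall>x\<in>K. norm (iter_partial ks u x) \<le> D)) \<longrightarrow>
    (\<forall>x\<in>K. norm (iter_partial js (\<lambda>x. \<sigma> x *\<^sub>R u x) x) \<le> C * D)"
  using assms(2)
proof (induction js arbitrary: \<sigma> rule: rev_induct)
  case Nil
  have "compact (\<sigma> ` K)"
    by (intro compact_continuous_image continuous_on_subset[OF smooth_on_imp_continuous_on[OF Nil]] assms)
  then obtain C where C: "\<And>x. x \<in> K \<Longrightarrow> \<bar>\<sigma> x\<bar> \<le> C"
    using compact_imp_bounded bounded_iff by (metis imageI real_norm_def)
  show ?case
  proof (rule exI[of _ "max 0 C"], safe)
    fix u :: "real^'n \<Rightarrow> 'b" and D x
    assume "\<forall>ks. length ks \<le> length [] \<longrightarrow> (\<forall>x\<in>K. norm (iter_partial ks u x) \<le> D)" and x: "x \<in> K"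
    then have "norm (u x) \<le> D" by auto
    then show "norm (iter_partial [] (\<lambda>x. \<sigma> x *\<^sub>R u x) x) \<le> max 0 C * D"
      using C[OF x] by (auto intro!: mult_mono simp: le_max_iff_disj)
  qed auto
next
  case (snoc j js)
  obtain C1 where C1: "0 \<le> C1" "\<And>(u :: real^'n \<Rightarrow> 'b) D x. smooth_on W u \<Longrightarrow>
    (\<forall>ks. length ks \<le> length js \<longrightarrow> (\<forall>x\<in>K. norm (iter_partial ks u x) \<le> D)) \<Longrightarrow>
    x\<in>K \<Longrightarrow> norm (iter_partial js (\<lambda>x. \<sigma> x *\<^sub>R u x) x) \<le> C1 * D"
    using snoc.IH[OF snoc.prems] by blast
  obtain C2 where C2: "0 \<le> C2" "\<And>(u :: real^'n \<Rightarrow> 'b) D x. smooth_on W u \<Longrightarrow>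
    (\<forall>ks. length ks \<le> length js \<longrightarrow> (\<forall>x\<in>K. norm (iter_partial ks u x) \<le> D)) \<Longrightarrow>
    x\<in>K \<Longrightarrow> norm (iter_partial js (\<lambda>x. partial_deriv j \<sigma> x *\<^sub>R u x) x) \<le> C2 * D"
    using snoc.IH[OF smooth_on_partial_deriv[OF snoc.prems, of j]] by blast
  show ?case
  proof (rule exI[of _ "C1 + C2"], safe)
    fix u :: "real^'n \<Rightarrow> 'b" and D x
    assume u: "smooth_on W u" and D: "\<forall>ks. length ks \<le> length (js @ [j]) \<longrightarrow> (\<forall>x\<in>K. norm (iter_partial ks u x) \<le> D)"
      and x: "x \<in> K"
    then have xW: "x \<in> W" using assms by auto
    let ?a = "\<lambda>x. \<sigma> x *\<^sub>R partial_deriv j u x" and ?b = "\<lambda>x. partial_deriv j \<sigma> x *\<^sub>R u x"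
    have sm: "smooth_on W ?a" "smooth_on W ?b"
      by (intro smooth_on_scaleR smooth_on_partial_deriv u snoc.prems assms)+
    have D1: "\<forall>ks. length ks \<le> length js \<longrightarrow> (\<forall>x\<in>K. norm (iter_partial ks (partial_deriv j u) x) \<le> D)"
    proof safe
      fix ks :: "'n list" and y assume "length ks \<le> length js" "y \<in> K"
      then have "norm (iter_partial (ks @ [j]) u y) \<le> D" using D by fastforce
      then show "norm (iter_partial ks (partial_deriv j u) y) \<le> D" by (simp add: iter_partial_append)
    qed
    have "iter_partial (js @ [j]) (\<lambda>x. \<sigma> x *\<^sub>R u x) x = iter_partial js (\<lambda>x. ?a x + ?b x) x"
      unfolding iter_partial_append
      by (rule iter_partial_cong[OF assms(1)])
         (use partial_deriv_scaleR[OF snoc.prems u] xW in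
           \<open>auto intro!: smooth_on_partial_deriv smooth_on_scaleR assms u snoc.prems\<close>)
    also have "\<dots> = iter_partial js ?a x + iter_partial js ?b x"
      by (rule iter_partial_add[OF assms(1) sm xW])
    also have "norm \<dots> \<le> C1 * D + C2 * D"
      using D by (intro norm_triangle_mono C1(2)[OF smooth_on_partial_deriv[OF u] D1 x] C2(2)[OF u _ x]) auto
    finally show "norm (iter_partial (js @ [j]) (\<lambda>x. \<sigma> x *\<^sub>R u x) x) \<le> (C1 + C2) * D"
      by (simp add: distrib_right)
  qed (use C1 C2 in auto)
qed


section \<open>R-bounds on cubes from derivatives\<close>

text \<open>
  The Euler sum stops at \<open>u\<close>, possibly inside a step, and the weights say how much of each step
  lies before \<open>u\<close>. Only the weights depend on \<open>u\<close>; the points at which \<open>g'\<close> is evaluated do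
  not.
\<close>

lemma euler_sum_error:
  fixes g :: "real \<Rightarrow> 'b::real_normed_vector"
  assumes g: "\<And>t. t \<in> {a..b} \<Longrightarrow> (g has_vector_derivative g' t) (at t within {a..b})"
    and u: "u \<in> {a..b}" and h: "0 \<le> h" "a + real M * h = b"
    and e: "\<And>s t. s \<in> {a..b} \<Longrightarrow> t \<in> {a..b} \<Longrightarrow> \<bar>t - s\<bar> \<le> h \<Longrightarrow> norm (g' t - g' s) \<le> e"
  shows "norm (g u - (g a + (\<Sum>m<M. max 0 (min h (u - (a + real m * h))) *\<^sub>R g' (a + real m * h)))) \<le> e * (u - a)"
proof -
  define c where "c m = min u (a + real m * h)" for m
  define w where "w m = max 0 (min h (u - (a + real m * h)))" for m
  have cw: "c (Suc m) = c m + w m" for m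
    using h(1) by (auto simp: c_def w_def min_def max_def algebra_simps)
  have c0: "c 0 = a" using u by (simp add: c_def)
  have cM: "c M = u" using u h by (simp add: c_def)
  have step: "norm (g (c (Suc m)) - g (c m) - w m *\<^sub>R g' (a + real m * h)) \<le> e * w m" if "m < M" for m
  proof (cases "w m = 0")
    case True
    then show ?thesis using cw[of m] by simp
  next
    case False
    then have wpos: "0 < w m" by (simp add: w_def)
    then have cm: "c m = a + real m * h" and wh: "w m \<le> h"
      by (auto simp: c_def w_def min_def max_def split: if_splits)
    have bd: "c m + w m \<le> b" "a \<le> c m"
      using cw[of m] u h(1) cm by (auto simp: c_def)
    have "norm (g (c m + w m) - g (c m) - ((c m + w m) - c m) *\<^sub>R g' (c m)) \<le> e * ((c m + w m) - c m)"
    proof (rule vector_mean_value_bound)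
      fix t assume t: "t \<in> {c m..c m + w m}"
      then show "(g has_vector_derivative g' t) (at t within {c m..c m + w m})"
        using bd by (intro has_vector_derivative_within_subset[OF g]) auto
      show "norm (g' t - g' (c m)) \<le> e"
        using t bd wh wpos by (intro e) auto
    qed (use wpos in simp)
    then show ?thesis using cw[of m] cm by simp
  qed
  have "g u - (g a + (\<Sum>m<M. w m *\<^sub>R g' (a + real m * h)))
      = (\<Sum>m<M. g (c (Suc m)) - g (c m) - w m *\<^sub>R g' (a + real m * h))"
    using sum_lessThan_telescope[of "\<lambda>m. g (c m)" M] by (simp add: sum_subtractf c0 cM)
  also have "norm \<dots> \<le> (\<Sum>m<M. e * w m)"
    by (intro sum_norm_le step) simp
  also have "\<dots> = e * (\<Sum>m<M. c (Suc m) - c m)"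
    by (simp add: cw sum_distrib_left)
  also have "\<dots> = e * (u - a)"
    using sum_lessThan_telescope[of c M] by (simp add: c0 cM)
  finally show ?thesis by (simp add: w_def)
qed

lemma euler_sum_tendsto:
  fixes g :: "real \<Rightarrow> 'b::real_normed_vector"
  assumes g: "\<And>t. t \<in> {a..b} \<Longrightarrow> (g has_vector_derivative g' t) (at t within {a..b})"
    and cont: "continuous_on {a..b} g'" and u: "u \<in> {a..b}"
  defines "h \<equiv> \<lambda>M. (b - a) / real (Suc M)"
  shows "(\<lambda>M. g a + (\<Sum>m<Suc M. max 0 (min (h M) (u - (a + real m * h M))) *\<^sub>R g' (a + real m * h M))) \<longlonglongrightarrow> g u"
proof (rule LIMSEQ_I)
  fix r :: real assume r: "0 < r"
  define e where "e = r / (u - a + 1)"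
  have e: "0 < e" "e * (u - a) < r" using r u by (auto simp: e_def field_simps)
  have ab: "a \<le> b" using u by simp
  have "uniformly_continuous_on {a..b} g'" by (rule compact_uniformly_continuous[OF cont]) simp
  then obtain d where d: "0 < d" "\<And>s t. s \<in> {a..b} \<Longrightarrow> t \<in> {a..b} \<Longrightarrow> dist t s < d \<Longrightarrow> dist (g' t) (g' s) < e"
    unfolding uniformly_continuous_on_def using e by metis
  have "h \<longlonglongrightarrow> 0" unfolding h_def
    by (rule LIMSEQ_Suc[of "\<lambda>M. (b - a) / real M"]) (rule lim_const_over_n)
  then obtain N where N: "\<And>M. N \<le> M \<Longrightarrow> norm (h M) < d"
    using LIMSEQ_D[of h 0 d] d by auto
  show "\<exists>N. \<forall>M\<ge>N. norm (g a + (\<Sum>m<Suc M. max 0 (min (h M) (u - (a + real m * h M))) *\<^sub>R g' (a + real m * h M)) - g u) < r"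
  proof (intro exI[of _ N] allI impI)
    fix M assume "N \<le> M"
    have "norm (g u - (g a + (\<Sum>m<Suc M. max 0 (min (h M) (u - (a + real m * h M))) *\<^sub>R g' (a + real m * h M)))) \<le> e * (u - a)"
    proof (rule euler_sum_error[OF g u])
      show "0 \<le> h M" using ab by (simp add: h_def)
      show "a + real (Suc M) * h M = b" by (simp add: h_def del: of_nat_Suc)
      fix s t assume "s \<in> {a..b}" "t \<in> {a..b}" "\<bar>t - s\<bar> \<le> h M"
      then show "norm (g' t - g' s) \<le> e"
        using d(2)[of s t] N[OF \<open>N \<le> M\<close>] by (simp add: dist_norm)
    qed
    with e(2) show "norm (g a + (\<Sum>m<Suc M. max 0 (min (h M) (u - (a + real m * h M))) *\<^sub>R g' (a + real m * h M)) - g u) < r"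
      by (simp only: norm_minus_commute)
  qed
qed

definition set_coord :: "'n \<Rightarrow> real \<Rightarrow> real^'n::finite \<Rightarrow> real^'n" where
  "set_coord j t \<xi> = \<xi> + (t - \<xi> $ j) *\<^sub>R axis j 1"

lemma set_coord_nth: "set_coord j t \<xi> $ i = (if i = j then t else \<xi> $ i)"
  by (simp add: set_coord_def axis_def)

text \<open>
  Induction on the number of free coordinates. In the coordinate \<open>j\<close> the value at \<open>\<xi>\<close> is the
  value at the lower end of the side plus the integral of the partial derivative, and the
  integral is a limit of Euler sums with nodes \<open>t\<close> independent of \<open>\<xi>\<close>. For a fixed node, the
  partial derivative has one free coordinate less, so the induction hypothesis bounds its
  R-bound; the weights of the Euler sum are bounded by the step width, and the step widths add up
  to the length of the side.
\<close>

lemma R_estimate_face: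
  fixes f :: "real^'n::finite \<Rightarrow> 'x::real_normed_vector \<Rightarrow>\<^sub>L 'y::real_normed_vector"
  assumes p: "1 \<le> p" and s: "0 \<le> s" "\<And>i. b $ i - a $ i \<le> s"
    and "distinct js" "smooth_on UNIV f" "\<eta> \<in> cbox a b"
    and "\<And>ks \<xi>. length ks \<le> length js \<Longrightarrow> \<xi> \<in> cbox a b \<Longrightarrow> norm (iter_partial ks f \<xi>) \<le> D"
  shows "R_estimate p ((1 + s) ^ length js * D) (f ` {\<xi> \<in> cbox a b. \<forall>i. i \<notin> set js \<longrightarrow> \<xi> $ i = \<eta> $ i})"
  using assms(4-7)
proof (induction js arbitrary: f \<eta>)
  case Nil
  then have "R_estimate p D {f \<eta>}"
    using Nil.prems(4)[of "[]" \<eta>] by (intro R_estimate_singleton p) auto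
  moreover have "{\<xi> \<in> cbox a b. \<forall>i. i \<notin> set [] \<longrightarrow> \<xi> $ i = \<eta> $ i} = {\<eta>}"
    using Nil by (auto simp: vec_eq_iff)
  ultimately show ?case by simp
next
  case (Cons j js)
  let ?A = "{\<xi> \<in> cbox a b. \<forall>i. i \<notin> set (j # js) \<longrightarrow> \<xi> $ i = \<eta> $ i}"
  define K where "K = (1 + s) ^ length js * D"
  have D: "0 \<le> D" using order_trans[OF norm_ge_zero Cons.prems(4)[of "[]" \<eta>]] Cons.prems(3) by simp
  have K: "0 \<le> K" using D s by (simp add: K_def)
  have "a $ j \<le> \<eta> $ j" "\<eta> $ j \<le> b $ j" using Cons.prems(3) by (auto simp: mem_box_cart)
  then have ab: "a $ j \<le> b $ j" by (rule order_trans)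
  have box: "set_coord j t \<xi> \<in> cbox a b" if "\<xi> \<in> cbox a b" "t \<in> {a $ j..b $ j}" for t \<xi>
    using that by (auto simp: mem_box_cart set_coord_nth)
  have IH: "R_estimate p K (g ` {\<xi> \<in> cbox a b. \<forall>i. i \<notin> set js \<longrightarrow> \<xi> $ i = set_coord j t \<eta> $ i})"
    if "smooth_on UNIV g" "t \<in> {a $ j..b $ j}"
      "\<And>ks \<xi>. length ks \<le> length js \<Longrightarrow> \<xi> \<in> cbox a b \<Longrightarrow> norm (iter_partial ks g \<xi>) \<le> D" for g :: "real^'n \<Rightarrow> 'x \<Rightarrow>\<^sub>L 'y" and t
    unfolding K_def using Cons.prems(1) by (intro Cons.IH that box Cons.prems(3)) simp
  have slice: "R_estimate p K ((\<lambda>\<xi>. g (set_coord j t \<xi>)) ` ?A)"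
    if "smooth_on UNIV g" "t \<in> {a $ j..b $ j}"
      "\<And>ks \<xi>. length ks \<le> length js \<Longrightarrow> \<xi> \<in> cbox a b \<Longrightarrow> norm (iter_partial ks g \<xi>) \<le> D" for g :: "real^'n \<Rightarrow> 'x \<Rightarrow>\<^sub>L 'y" and t
    by (rule R_estimate_mono[OF IH[OF that] _ order_refl])
       (use that(2) in \<open>auto simp: set_coord_nth box intro!: imageI\<close>)
  \<comment> \<open>step width, nodes and weights of the Euler sum with \<open>Suc M\<close> steps; \<open>Suc\<close> avoids an empty subdivision\<close>
  let ?h = "\<lambda>M. (b $ j - a $ j) / real (Suc M)"
  let ?t = "\<lambda>M m. a $ j + real m * ?h M"
  let ?w = "\<lambda>M m \<xi>. max 0 (min (?h M) (\<xi> $ j - ?t M m))"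
  let ?S = "\<lambda>M \<xi>. f (set_coord j (a $ j) \<xi>) + (\<Sum>m<Suc M. ?w M m \<xi> *\<^sub>R partial_deriv j f (set_coord j (?t M m) \<xi>))"
  have sm: "smooth_on UNIV (partial_deriv j f)" by (intro smooth_on_partial_deriv Cons.prems)
  have "R_estimate p (K + (\<Sum>m<Suc M. ?h M * K)) (?S M ` ?A)" for M
  proof (rule R_estimate_add[OF p slice R_estimate_sum[OF p]])
    fix m assume m: "m \<in> {..<Suc M}"
    have h0: "0 \<le> ?h M" using ab by simp
    have "real m * ?h M \<le> real (Suc M) * ?h M" using m h0 by (intro mult_right_mono) auto
    then have "?t M m \<in> {a $ j..b $ j}" using h0 mult_nonneg_nonneg[OF of_nat_0_le_iff h0, of m] by (auto simp del: of_nat_Suc)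
    then have est: "R_estimate p K ((\<lambda>\<xi>. partial_deriv j f (set_coord j (?t M m) \<xi>)) ` ?A)"
    proof (rule slice[OF sm])
      fix ks :: "'n list" and \<xi> assume "length ks \<le> length js" "\<xi> \<in> cbox a b"
      then show "norm (iter_partial ks (partial_deriv j f) \<xi>) \<le> D"
        using Cons.prems(4)[of "ks @ [j]" \<xi>] by (simp add: iter_partial_append)
    qed
    show "R_estimate p (?h M * K) ((\<lambda>\<xi>. ?w M m \<xi> *\<^sub>R partial_deriv j f (set_coord j (?t M m) \<xi>)) ` ?A)"
      by (rule R_estimate_scaleR[OF p est _ h0]) (use h0 in auto)
  qed (use Cons.prems ab in auto)
  moreover have "K + (\<Sum>m<Suc M. ?h M * K) \<le> (1 + s) * K" for M
  proof -
    have "(\<Sum>m<Suc M. ?h M * K) = (b $ j - a $ j) * K"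
      by (simp del: of_nat_Suc sum.lessThan_Suc)
    also have "\<dots> \<le> s * K" by (intro mult_right_mono s K)
    finally show ?thesis by (simp add: distrib_right)
  qed
  ultimately have est: "R_estimate p ((1 + s) * K) (?S M ` ?A)" for M
    using R_estimate_mono by blast
  have "R_estimate p ((1 + s) * K) (f ` ?A)"
  proof (rule R_estimate_limit[OF p est])
    fix \<xi> assume "\<xi> \<in> ?A"
    then have \<xi>: "\<xi> $ j \<in> {a $ j..b $ j}" by (auto simp: mem_box_cart)
    let ?y = "\<xi> - (\<xi> $ j) *\<^sub>R axis j 1"
    have line: "set_coord j t \<xi> = ?y + t *\<^sub>R axis j 1" for t
      by (simp add: set_coord_def algebra_simps)
    have "(\<lambda>M. f (set_coord j (a $ j) \<xi>) + (\<Sum>m<Suc M. ?w M m \<xi> *\<^sub>R partial_deriv j f (set_coord j (?t M m) \<xi>)))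
        \<longlonglongrightarrow> f (set_coord j (\<xi> $ j) \<xi>)"
    proof (rule euler_sum_tendsto[where g = "\<lambda>t. f (set_coord j t \<xi>)" and g' = "\<lambda>t. partial_deriv j f (set_coord j t \<xi>)", OF _ _ \<xi>])
      show "((\<lambda>t. f (set_coord j t \<xi>)) has_vector_derivative partial_deriv j f (set_coord j t \<xi>)) (at t within {a $ j..b $ j})" for t
        unfolding line by (rule has_vector_derivative_along_axis[OF Cons.prems(2)]) simp
      show "continuous_on {a $ j..b $ j} (\<lambda>t. partial_deriv j f (set_coord j t \<xi>))"
        unfolding line
        by (rule continuous_on_compose2[OF smooth_on_imp_continuous_on[OF sm]]) (auto intro!: continuous_intros)
    qed
    moreover have "set_coord j (\<xi> $ j) \<xi> = \<xi>" by (simp add: set_coord_def)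
    ultimately show "(\<lambda>M. ?S M \<xi>) \<longlonglongrightarrow> f \<xi>" by simp
  qed
  then show ?case by (simp add: K_def mult.assoc)
qed

text \<open>
  The case of \<open>R_estimate_face\<close> in which all coordinates are free.
\<close>

lemma R_estimate_cube:
  fixes f :: "real^'n::finite \<Rightarrow> 'x::real_normed_vector \<Rightarrow>\<^sub>L 'y::real_normed_vector"
  assumes p: "1 \<le> p" and s: "0 \<le> s" "\<And>i. b $ i - a $ i \<le> s" and f: "smooth_on UNIV f"
    and D: "\<And>ks \<xi>. length ks \<le> CARD('n) \<Longrightarrow> \<xi> \<in> cbox a b \<Longrightarrow> norm (iter_partial ks f \<xi>) \<le> D"
  shows "R_estimate p ((1 + s) ^ CARD('n) * D) (f ` cbox a b)"
proof (cases "cbox a b = {}")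
  case True
  then show ?thesis by (force simp: R_estimate_iff)
next
  case False
  then obtain \<eta> where \<eta>: "\<eta> \<in> cbox a b" by blast
  have "length (coords :: 'n list) = CARD('n)"
    using distinct_card[OF coords(1)[where 'n = 'n]] coords(2)[where 'n = 'n] by simp
  then show ?thesis
    using R_estimate_face[OF p s coords(1)[where 'n = 'n] f \<eta>, of D] D coords(2)[where 'n = 'n] by simp
qed


section \<open>Anisotropic weights\<close>

text \<open>
  The polynomial \<open>|\<xi>|\<^sub>l ^ (2 l\<^sub>1 \<cdots> l\<^sub>n)\<close>. Estimates for the anisotropic length and bracket
  are reduced to estimates for this polynomial.
\<close>

definition aniso_poly :: "('n::finite \<Rightarrow> nat) \<Rightarrow> real^'n \<Rightarrow> real" where
  "aniso_poly l \<xi> = (\<Sum>j\<in>UNIV. (\<xi> $ j) ^ (2 * co_weight l j))"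

definition aniso_exponent :: "('n::finite \<Rightarrow> nat) \<Rightarrow> nat" where
  "aniso_exponent l = 2 * (\<Prod>j\<in>UNIV. l j)"

lemma aniso_length_eq: "aniso_length l \<xi> = aniso_poly l \<xi> powr (1 / real (aniso_exponent l))"
  and aniso_bracket_eq: "aniso_bracket l \<xi> = (1 + aniso_poly l \<xi>) powr (1 / real (aniso_exponent l))"
  by (simp_all add: aniso_length_def aniso_bracket_def aniso_poly_def aniso_exponent_def)

lemma aniso_poly_nonneg [simp]: "0 \<le> aniso_poly l \<xi>"
  by (simp add: aniso_poly_def sum_nonneg)

lemma aniso_poly_component: "(\<xi> $ j) ^ (2 * co_weight l j) \<le> aniso_poly l \<xi>"
  unfolding aniso_poly_def by (rule member_le_sum) auto

lemma aniso_length_nonneg [simp]: "0 \<le> aniso_length l \<xi>"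
  by (simp add: aniso_length_eq)

context
  fixes l :: "'n::finite \<Rightarrow> nat"
  assumes l: "\<forall>j. 1 \<le> l j"
begin

lemma co_weight_pos: "1 \<le> co_weight l j"
  unfolding co_weight_def using l by (intro prod_ge_1) auto

lemma aniso_exponent_pos: "2 \<le> aniso_exponent l"
  unfolding aniso_exponent_def using l prod_ge_1[of UNIV l] by simp

lemma aniso_exponent_co_weight: "l j * (2 * co_weight l j) = aniso_exponent l"
  unfolding aniso_exponent_def co_weight_def
  using prod.remove[of UNIV j l] by simp

lemma abs_component_le: "\<bar>\<xi> $ j\<bar> \<le> max 1 (aniso_poly l \<xi>)"
proof (cases "\<bar>\<xi> $ j\<bar> \<le> 1")
  case False
  have "\<bar>\<xi> $ j\<bar> ^ 1 \<le> \<bar>\<xi> $ j\<bar> ^ (2 * co_weight l j)"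
    using False co_weight_pos[of j] by (intro power_increasing) auto
  also have "\<dots> \<le> aniso_poly l \<xi>" using aniso_poly_component[of \<xi> j l] by (simp add: power_even_abs)
  finally show ?thesis by simp
qed simp

lemma aniso_bracket_ge_1: "1 \<le> aniso_bracket l \<xi>"
  unfolding aniso_bracket_eq by (rule ge_one_powr_ge_zero) auto

lemma aniso_bracket_powr: "aniso_bracket l \<xi> powr real (aniso_exponent l) = 1 + aniso_poly l \<xi>"
  using aniso_exponent_pos aniso_poly_nonneg[of l \<xi>] unfolding aniso_bracket_eq powr_powr by simp

lemma aniso_length_powr: "aniso_length l \<xi> powr real (aniso_exponent l) = aniso_poly l \<xi>"
  using aniso_exponent_pos unfolding aniso_length_eq powr_powr by simp

text \<open>
  On unit cubes the bracket is constant up to a factor, since \<open>(1 + |t|) ^ (2 w)\<close> is dominated by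
  \<open>4 ^ w (1 + t ^ (2 w))\<close>.
\<close>

lemma aniso_bracket_slowly_varying:
  obtains A where "1 \<le> A" "\<And>\<xi> \<eta>. (\<And>i. \<bar>\<xi> $ i - \<eta> $ i\<bar> \<le> 1) \<Longrightarrow> aniso_bracket l \<xi> \<le> A * aniso_bracket l \<eta>"
proof -
  define B where "B = 1 + (\<Sum>j\<in>UNIV. 4 ^ co_weight l j :: real)"
  have B: "1 \<le> B" by (simp add: B_def sum_nonneg)
  show ?thesis
  proof (rule that[of "B powr (1 / real (aniso_exponent l))"])
    show "1 \<le> B powr (1 / real (aniso_exponent l))" using B by (intro ge_one_powr_ge_zero) auto
    fix \<xi> \<eta> :: "real^'n" assume near: "\<And>i. \<bar>\<xi> $ i - \<eta> $ i\<bar> \<le> 1"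
    have comp: "(\<xi> $ j) ^ (2 * co_weight l j) \<le> 4 ^ co_weight l j * (1 + aniso_poly l \<eta>)" for j
    proof -
      let ?c = "co_weight l j"
      have "\<bar>\<xi> $ j\<bar> \<le> 2 * max 1 \<bar>\<eta> $ j\<bar>" using near[of j] by linarith
      then have "\<bar>\<xi> $ j\<bar> ^ (2 * ?c) \<le> (2 * max 1 \<bar>\<eta> $ j\<bar>) ^ (2 * ?c)" by (intro power_mono) auto
      also have "\<dots> = 4 ^ ?c * max 1 \<bar>\<eta> $ j\<bar> ^ (2 * ?c)"
        by (simp add: power_mult_distrib power_mult)
      also have "max 1 \<bar>\<eta> $ j\<bar> ^ (2 * ?c) \<le> 1 + aniso_poly l \<eta>"
        using aniso_poly_component[of \<eta> j l] aniso_poly_nonneg[of l \<eta>]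
        by (cases "\<bar>\<eta> $ j\<bar> \<le> 1") (auto simp: max_def power_even_abs)
      finally show ?thesis by (simp add: power_even_abs)
    qed
    have "1 + aniso_poly l \<xi> \<le> 1 + (\<Sum>j\<in>UNIV. 4 ^ co_weight l j * (1 + aniso_poly l \<eta>))"
      unfolding aniso_poly_def[of l \<xi>] by (intro add_left_mono sum_mono comp)
    also have "\<dots> \<le> B * (1 + aniso_poly l \<eta>)"
      by (simp add: B_def distrib_right flip: sum_distrib_right)
    finally have "(1 + aniso_poly l \<xi>) powr (1 / real (aniso_exponent l)) \<le> (B * (1 + aniso_poly l \<eta>)) powr (1 / real (aniso_exponent l))"
      by (intro powr_mono2) auto
    then show "aniso_bracket l \<xi> \<le> B powr (1 / real (aniso_exponent l)) * aniso_bracket l \<eta>"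
      unfolding aniso_bracket_eq using B by (simp add: powr_mult)
  qed
qed

lemma aniso_bracket_dominates_lattice_weight:
  "(\<Prod>i\<in>UNIV. (1 + \<bar>\<xi> $ i\<bar>)\<^sup>2) \<le> 4 ^ CARD('n) * aniso_bracket l \<xi> powr real (2 * CARD('n) * aniso_exponent l)"
proof -
  have "(\<Prod>i\<in>UNIV. (1 + \<bar>\<xi> $ i\<bar>)\<^sup>2) \<le> (\<Prod>i\<in>(UNIV :: 'n set). (2 * (1 + aniso_poly l \<xi>))\<^sup>2)"
  proof (intro prod_mono conjI power_mono)
    fix i
    show "1 + \<bar>\<xi> $ i\<bar> \<le> 2 * (1 + aniso_poly l \<xi>)"
      using abs_component_le[of \<xi> i] aniso_poly_nonneg[of l \<xi>] by (smt (verit) max_def)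
  qed auto
  also have "\<dots> = 4 ^ CARD('n) * (1 + aniso_poly l \<xi>) ^ (2 * CARD('n))"
  proof -
    have four: "(4::real) = 2\<^sup>2" by simp
    show ?thesis unfolding four by (simp only: prod_constant power_mult_distrib power_mult)
  qed
  also have "(1 + aniso_poly l \<xi>) ^ (2 * CARD('n)) = (1 + aniso_poly l \<xi>) powr real (2 * CARD('n))"
    using aniso_poly_nonneg[of l \<xi>] by (subst powr_realpow) (auto intro: add_pos_nonneg)
  also have "\<dots> = aniso_bracket l \<xi> powr real (2 * CARD('n) * aniso_exponent l)"
    unfolding aniso_bracket_powr[symmetric] powr_powr by (simp add: mult_ac)
  finally show ?thesis .
qed

end

lemma powr_comparable:
  fixes x y A e :: real
  assumes "0 < x" "0 < y" "0 < A" "x \<le> A * y" "y \<le> A * x"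
  shows "x powr e \<le> A powr \<bar>e\<bar> * y powr e"
proof (cases "0 \<le> e")
  case True
  then have "x powr e \<le> (A * y) powr e" using assms by (intro powr_mono2) auto
  then show ?thesis using assms True by (simp add: powr_mult)
next
  case False
  then have "(A * x) powr e \<le> y powr e" using assms by (intro powr_mono2') auto
  then have "A powr (-e) * (A powr e * x powr e) \<le> A powr (-e) * y powr e"
    using assms by (intro mult_left_mono) (auto simp: powr_mult)
  moreover have "A powr (-e) * (A powr e * x powr e) = x powr e"
    using assms by (simp add: powr_minus)
  ultimately show ?thesis using False by simp
qed

text \<open>
  The right-hand side telescopes: \<open>2 / (N + 2)\<^sup>2 \<le> 2 / (N + 1) - 2 / (N + 2)\<close>.
\<close>

lemma sum_inverse_squares_int: "(\<Sum>k\<in>{- int N..int N}. 1 / (1 + \<bar>real_of_int k\<bar>)\<^sup>2) \<le> 4 - 2 / (real N + 1)"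
proof (induction N)
  case (Suc N)
  have "{- int (Suc N)..int (Suc N)} = insert (int (Suc N)) (insert (- int (Suc N)) {- int N..int N})"
    by auto
  then have "(\<Sum>k\<in>{- int (Suc N)..int (Suc N)}. 1 / (1 + \<bar>real_of_int k\<bar>)\<^sup>2)
      = 2 / (real N + 2)\<^sup>2 + (\<Sum>k\<in>{- int N..int N}. 1 / (1 + \<bar>real_of_int k\<bar>)\<^sup>2)"
    by (simp add: add_ac)
  also have "\<dots> \<le> 2 / (real N + 2)\<^sup>2 + (4 - 2 / (real N + 1))" using Suc by simp
  also have "\<dots> \<le> 4 - 2 / (real N + 2)"
  proof -
    have "2 / (real N + 2)\<^sup>2 \<le> 2 / ((real N + 1) * (real N + 2))"
      by (intro divide_left_mono) (auto simp: power2_eq_square intro: mult_right_mono)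
    also have "\<dots> = 2 / (real N + 1) - 2 / (real N + 2)" by (simp add: field_simps)
    finally show ?thesis by simp
  qed
  finally show ?case by (simp add: add_ac)
qed simp

text \<open>
  The sum over a box of lattice points factorises into one-dimensional sums.
\<close>

lemma sum_lattice_weight:
  assumes "finite (J :: ('n::finite \<Rightarrow> int) set)"
  shows "(\<Sum>m\<in>J. \<Prod>i\<in>UNIV. 1 / (1 + \<bar>real_of_int (m i)\<bar>)\<^sup>2) \<le> 4 ^ CARD('n)"
proof -
  define N where "N = nat (\<Sum>m\<in>J. \<Sum>i\<in>UNIV. \<bar>m i\<bar>)"
  have mN: "\<bar>m i\<bar> \<le> int N" if "m \<in> J" for m i
  proof -
    have "\<bar>m i\<bar> \<le> (\<Sum>i\<in>UNIV. \<bar>m i\<bar>)" by (rule member_le_sum) auto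
    also have "\<dots> \<le> (\<Sum>m\<in>J. \<Sum>i\<in>UNIV. \<bar>m i\<bar>)"
      using that assms by (intro member_le_sum) (auto intro: sum_nonneg)
    finally show ?thesis unfolding N_def by linarith
  qed
  let ?B = "PiE (UNIV :: 'n set) (\<lambda>_. {- int N..int N})"
  have "J \<subseteq> ?B" 
  proof
    fix m assume "m \<in> J"
    then have "- int N \<le> m i \<and> m i \<le> int N" for i using mN[of m i] by (simp add: abs_le_iff)
    then show "m \<in> ?B" by (simp add: PiE_iff)
  qed
  moreover have "finite ?B" by (intro finite_PiE) auto
  ultimately have "(\<Sum>m\<in>J. \<Prod>i\<in>UNIV. 1 / (1 + \<bar>real_of_int (m i)\<bar>)\<^sup>2) \<le> (\<Sum>m\<in>?B. \<Prod>i\<in>UNIV. 1 / (1 + \<bar>real_of_int (m i)\<bar>)\<^sup>2)"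
    by (intro sum_mono2) (auto intro: prod_nonneg)
  also have "\<dots> = (\<Prod>i\<in>(UNIV :: 'n set). \<Sum>k\<in>{- int N..int N}. 1 / (1 + \<bar>real_of_int k\<bar>)\<^sup>2)"
    by (rule prod_sum_PiE[symmetric]) auto
  also have "\<dots> \<le> (\<Prod>i\<in>(UNIV :: 'n set). 4)"
  proof (intro prod_mono conjI sum_nonneg)
    have "4 - 2 / (real N + 1) \<le> 4" by simp
    then show "(\<Sum>k\<in>{- int N..int N}. 1 / (1 + \<bar>real_of_int k\<bar>)\<^sup>2) \<le> 4"
      using sum_inverse_squares_int[of N] by linarith
  qed auto
  finally show ?thesis by simp
qed


section \<open>Symbols of sufficiently low order\<close>

text \<open>
  The multi-index of the derivative \<open>\<partial>\<^sup>\<beta>\<close> followed by the directions in \<open>ks\<close>.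
\<close>

definition multi_add :: "('n::finite \<Rightarrow> nat) \<Rightarrow> 'n list \<Rightarrow> 'n \<Rightarrow> nat" where
  "multi_add \<beta> ks = (\<lambda>i. \<beta> i + count (mset ks) i)"

lemma aniso_order_multi_add: "aniso_order l \<beta> \<le> aniso_order l (multi_add \<beta> ks)"
  unfolding aniso_order_def multi_add_def by (intro sum_mono) simp

lemma iter_partial_multi_deriv:
  assumes "open W" "smooth_on W f" "x \<in> W"
  shows "iter_partial ks (multi_deriv \<beta> f) x = multi_deriv (multi_add \<beta> ks) f x"
proof -
  have "iter_partial ks (multi_deriv \<beta> f) x = iter_partial (ks @ multi_list \<beta>) f x"
    by (simp add: multi_deriv_eq_iter_partial iter_partial_append)
  also have "\<dots> = multi_deriv (multi_add \<beta> ks) f x"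
    unfolding iter_partial_eq_multi_deriv[OF assms]
    by (rule arg_cong[where f = "\<lambda>g. multi_deriv g f x"]) (simp add: fun_eq_iff multi_add_def count_multi_list)
  finally show ?thesis .
qed

lemma smooth_on_multi_deriv: "smooth_on W f \<Longrightarrow> smooth_on W (multi_deriv \<beta> f)"
  by (simp add: multi_deriv_eq_iter_partial smooth_on_iter_partial)

text \<open>
  The gain in order that makes the lattice sum converge: \<open>\<langle>\<xi>\<rangle>\<^sub>l\<close> to the power
  \<open>aniso_exponent l\<close> dominates every \<open>1 + |\<xi>\<^sub>i|\<close> up to a constant, so its power \<open>2 n\<close> dominates the
  product of the \<open>(1 + |\<xi>\<^sub>i|)\<^sup>2\<close>.
\<close>

definition remainder_order :: "('n::finite \<Rightarrow> nat) \<Rightarrow> nat" where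
  "remainder_order l = 2 * CARD('n) * aniso_exponent l"

text \<open>
  On the unit cube with corner \<open>v m\<close> both the weight and the derivatives are comparable to their
  values at the corner. The growth of the weight cancels against the order of the derivatives
  and the factor \<open>\<langle>v m\<rangle> ^ (-k)\<close> remains, which is summable over the lattice.
\<close>

lemma R_estimate_low_order:
  fixes l :: "'n::finite \<Rightarrow> nat"
  assumes l: "\<forall>j. 1 \<le> l j" and p: "1 \<le> p"
  shows "\<exists>C\<ge>0. \<forall>(r :: real^'n \<Rightarrow> 'x::real_normed_vector \<Rightarrow>\<^sub>L 'y::real_normed_vector) D. smooth_on UNIV r \<longrightarrow>
    (\<forall>ks \<xi>. length ks \<le> CARD('n) \<longrightarrow>
      norm (weighted_deriv l (\<mu> - real (remainder_order l)) (multi_add \<beta> ks) r \<xi>) \<le> D) \<longrightarrow>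
    R_estimate p (C * D) (range (weighted_deriv l \<mu> \<beta> r))"
proof -
  obtain A where A: "1 \<le> A"
    "\<And>\<xi> \<eta>. (\<And>i. \<bar>\<xi> $ i - \<eta> $ i\<bar> \<le> 1) \<Longrightarrow> aniso_bracket l \<xi> \<le> A * aniso_bracket l \<eta>"
    using aniso_bracket_slowly_varying[OF l] by blast
  define k where "k = real (remainder_order l)"
  define e where "e = - \<mu> + real (aniso_order l \<beta>)"
  \<comment> \<open>the factor \<open>2 ^ n\<close> comes from unit cubes, the powers of \<open>A\<close> from comparing brackets with exponents \<open>e\<close> and \<open>- e - k\<close>\<close>
  define E where "E = 2 ^ CARD('n) * A powr \<bar>- e - k\<bar> * A powr \<bar>e\<bar>"
  have E: "0 \<le> E" by (simp add: E_def)
  have bpos: "0 < aniso_bracket l \<xi>" for \<xi> using aniso_bracket_ge_1[OF l, of \<xi>] by linarith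
  have compare: "aniso_bracket l \<xi> powr s \<le> A powr \<bar>s\<bar> * aniso_bracket l \<eta> powr s"
    if "\<And>i. \<bar>\<xi> $ i - \<eta> $ i\<bar> \<le> 1" for \<xi> \<eta> s
  proof (rule powr_comparable[OF bpos bpos _ A(2) A(2)])
    show "\<bar>\<eta> $ i - \<xi> $ i\<bar> \<le> 1" for i using that[of i] by linarith
  qed (use A that in auto)
  show ?thesis
  proof (rule exI[of _ "E * (4 ^ CARD('n) * 4 ^ CARD('n))"], intro conjI allI impI)
    show "0 \<le> E * (4 ^ CARD('n) * 4 ^ CARD('n))" using E by simp
    fix r :: "real^'n \<Rightarrow> 'x \<Rightarrow>\<^sub>L 'y" and D
    assume r: "smooth_on UNIV r" and "\<forall>ks \<xi>. length ks \<le> CARD('n) \<longrightarrow>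
      norm (weighted_deriv l (\<mu> - real (remainder_order l)) (multi_add \<beta> ks) r \<xi>) \<le> D"
    then have D: "norm (weighted_deriv l (\<mu> - k) (multi_add \<beta> ks) r \<xi>) \<le> D"
      if "length ks \<le> CARD('n)" for ks \<xi> using that by (simp add: k_def)
    have D0: "0 \<le> D" using order_trans[OF norm_ge_zero D[of "[]"]] by simp
    define g where "g = multi_deriv \<beta> r"
    have gs: "smooth_on UNIV g" unfolding g_def by (rule smooth_on_multi_deriv[OF r])
    have gD: "norm (iter_partial ks g \<eta>) \<le> D * aniso_bracket l \<eta> powr (- e - k)"
      if "length ks \<le> CARD('n)" for ks \<eta>
    proof -
      let ?b = "aniso_bracket l \<eta>" and ?s = "- (\<mu> - k) + real (aniso_order l (multi_add \<beta> ks))"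
      have ig: "iter_partial ks g \<eta> = multi_deriv (multi_add \<beta> ks) r \<eta>"
        unfolding g_def by (rule iter_partial_multi_deriv[OF open_UNIV r]) simp
      have "?b powr (e + k) * norm (iter_partial ks g \<eta>) \<le> ?b powr ?s * norm (iter_partial ks g \<eta>)"
        using aniso_bracket_ge_1[OF l, of \<eta>] aniso_order_multi_add[of l \<beta> ks]
        by (intro mult_right_mono powr_mono) (auto simp: e_def)
      also have "\<dots> = norm (weighted_deriv l (\<mu> - k) (multi_add \<beta> ks) r \<eta>)"
        by (simp add: weighted_deriv_def ig)
      also have "\<dots> \<le> D" by (rule D[OF that])
      finally have "?b powr (- e - k) * (?b powr (e + k) * norm (iter_partial ks g \<eta>)) \<le> ?b powr (- e - k) * D"
        by (intro mult_left_mono) auto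
      moreover have "?b powr (- e - k) * (?b powr (e + k) * norm (iter_partial ks g \<eta>)) = norm (iter_partial ks g \<eta>)"
        using bpos[of \<eta>] by (simp flip: powr_add mult.assoc)
      ultimately show ?thesis by (metis mult.commute)
    qed
    define v :: "('n \<Rightarrow> int) \<Rightarrow> real^'n" where "v m = (\<chi> i. real_of_int (m i))" for m
    define Q where "Q m = cbox (v m) (v m + (\<chi> i. 1))" for m
    have Q: "\<bar>\<xi> $ i - v m $ i\<bar> \<le> 1" if "\<xi> \<in> Q m" for \<xi> m i
      using that by (auto simp: Q_def mem_box_cart abs_le_iff) (smt (verit, best))+
    define Cm where "Cm m = E * (D * aniso_bracket l (v m) powr (- k))" for m
    have "R_estimate p (E * (4 ^ CARD('n) * 4 ^ CARD('n)) * D) (weighted_deriv l \<mu> \<beta> r ` UNIV)"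
    proof (rule R_estimate_cover[OF p, where I = UNIV and Q = Q and C = Cm])
      show "UNIV \<subseteq> (\<Union>m\<in>UNIV. Q m)"
      proof
        fix \<xi> :: "real^'n"
        have "\<xi> \<in> Q (\<lambda>i. \<lfloor>\<xi> $ i\<rfloor>)"
          unfolding Q_def v_def mem_box_cart by simp
        then show "\<xi> \<in> (\<Union>m\<in>UNIV. Q m)" by blast
      qed
      fix m
      let ?b = "aniso_bracket l (v m)"
      show "0 \<le> Cm m" using E D0 by (simp add: Cm_def)
      have "R_estimate p ((1 + 1) ^ CARD('n) * (D * (A powr \<bar>- e - k\<bar> * ?b powr (- e - k)))) (g ` Q m)"
        unfolding Q_def
      proof (rule R_estimate_cube[OF p _ _ gs])
        fix ks :: "'n list" and \<xi> assume ks: "length ks \<le> CARD('n)" and "\<xi> \<in> cbox (v m) (v m + (\<chi> i. 1))"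
        then have "\<xi> \<in> Q m" by (simp add: Q_def)
        then have "aniso_bracket l \<xi> powr (- e - k) \<le> A powr \<bar>- e - k\<bar> * ?b powr (- e - k)"
          by (intro compare Q)
        then show "norm (iter_partial ks g \<xi>) \<le> D * (A powr \<bar>- e - k\<bar> * ?b powr (- e - k))"
          using gD[OF ks, of \<xi>] D0 by (meson mult_left_mono order_trans)
      qed auto
      then have "R_estimate p ((A powr \<bar>e\<bar> * ?b powr e) * ((1 + 1) ^ CARD('n) * (D * (A powr \<bar>- e - k\<bar> * ?b powr (- e - k)))))
          ((\<lambda>\<xi>. aniso_bracket l \<xi> powr e *\<^sub>R g \<xi>) ` Q m)"
        by (rule R_estimate_scaleR[OF p]) (auto intro: compare Q)
      moreover have "(A powr \<bar>e\<bar> * ?b powr e) * ((1 + 1) ^ CARD('n) * (D * (A powr \<bar>- e - k\<bar> * ?b powr (- e - k)))) = Cm m"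
      proof -
        have "?b powr (- k) = ?b powr e * ?b powr (- e - k)" by (simp flip: powr_add)
        then show ?thesis by (simp add: Cm_def E_def)
      qed
      ultimately show "R_estimate p (Cm m) (weighted_deriv l \<mu> \<beta> r ` Q m)"
        by (simp add: weighted_deriv_def[abs_def] e_def g_def)
    next
      fix J :: "('n \<Rightarrow> int) set" assume J: "finite J"
      have "Cm m \<le> E * (D * (4 ^ CARD('n) * (\<Prod>i\<in>UNIV. 1 / (1 + \<bar>real_of_int (m i)\<bar>)\<^sup>2)))" for m
      proof -
        let ?b = "aniso_bracket l (v m)" and ?P = "\<Prod>i\<in>UNIV. (1 + \<bar>real_of_int (m i)\<bar>)\<^sup>2"
        have P: "0 < ?P" by (intro prod_pos) (auto intro!: zero_less_power add_pos_nonneg)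
        have "?P \<le> 4 ^ CARD('n) * ?b powr k"
          using aniso_bracket_dominates_lattice_weight[OF l, of "v m"] by (simp add: v_def k_def remainder_order_def)
        then have "?b powr (- k) \<le> 4 ^ CARD('n) * (1 / ?P)"
          using P bpos[of "v m"] by (simp add: powr_minus field_simps)
        then show ?thesis
          unfolding Cm_def using E D0 by (intro mult_left_mono) (auto simp: prod_dividef)
      qed
      then have "(\<Sum>m\<in>J. Cm m) \<le> (\<Sum>m\<in>J. E * (D * (4 ^ CARD('n) * (\<Prod>i\<in>UNIV. 1 / (1 + \<bar>real_of_int (m i)\<bar>)\<^sup>2))))"
        by (intro sum_mono)
      also have "\<dots> = E * (D * (4 ^ CARD('n) * (\<Sum>m\<in>J. \<Prod>i\<in>UNIV. 1 / (1 + \<bar>real_of_int (m i)\<bar>)\<^sup>2)))"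
        by (simp only: sum_distrib_left)
      also have "\<dots> \<le> E * (D * (4 ^ CARD('n) * 4 ^ CARD('n)))"
        using E D0 by (intro mult_left_mono sum_lattice_weight J) auto
      finally show "(\<Sum>m\<in>J. Cm m) \<le> E * (4 ^ CARD('n) * 4 ^ CARD('n)) * D"
        by (simp add: mult_ac)
    qed
    then show "R_estimate p (E * (4 ^ CARD('n) * 4 ^ CARD('n)) * D) (range (weighted_deriv l \<mu> \<beta> r))" .
  qed
qed


section \<open>Anisotropic homogeneous functions\<close>

lemma smooth_on_component: "open W \<Longrightarrow> smooth_on W (\<lambda>\<xi>::real^'n::finite. \<xi> $ j)"
  using smooth_on_bounded_linear[OF _ bounded_linear_vec_nth smooth_on_id] .

lemma smooth_on_aniso_poly: "open W \<Longrightarrow> smooth_on W (aniso_poly l)"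
  unfolding aniso_poly_def[abs_def] by (intro smooth_on_sum smooth_on_power smooth_on_component) auto

lemma aniso_dilate_nth: "aniso_dilate l \<rho> \<xi> $ j = \<rho> ^ l j * \<xi> $ j"
  by (simp add: aniso_dilate_def)

lemma aniso_dilate_dilate: "aniso_dilate l \<rho> (aniso_dilate l \<sigma> \<xi>) = aniso_dilate l (\<rho> * \<sigma>) \<xi>"
  by (simp add: vec_eq_iff aniso_dilate_nth power_mult_distrib)

lemma aniso_dilate_1 [simp]: "aniso_dilate l 1 \<xi> = \<xi>"
  by (simp add: vec_eq_iff aniso_dilate_nth)

lemma aniso_dilate_eq_0_iff: "0 < \<rho> \<Longrightarrow> aniso_dilate l \<rho> \<xi> = 0 \<longleftrightarrow> \<xi> = 0"
  by (simp add: vec_eq_iff aniso_dilate_nth)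

text \<open>
  The retraction along the orbits of the dilations onto the sphere \<open>|\<xi>|\<^sub>l = 1\<close>. It is a smooth map
  into the sphere, so pull-back along it is one of the maps that define the topology of
  smooth functions on the sphere.
\<close>

definition radial_retraction :: "('n::finite \<Rightarrow> nat) \<Rightarrow> real^'n \<Rightarrow> real^'n" where
  "radial_retraction l \<xi> = aniso_dilate l (1 / aniso_length l \<xi>) \<xi>"

context
  fixes l :: "'n::finite \<Rightarrow> nat"
  assumes l: "\<forall>j. 1 \<le> l j"
begin

lemma aniso_poly_0: "aniso_poly l 0 = 0"
proof -
  have "2 * co_weight l j \<noteq> 0" for j using co_weight_pos[OF l, of j] by simp
  then show ?thesis unfolding aniso_poly_def by (intro sum.neutral) (simp add: power_0_left)
qed

lemma aniso_poly_pos: "\<xi> \<noteq> 0 \<Longrightarrow> 0 < aniso_poly l \<xi>"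
proof -
  assume "\<xi> \<noteq> 0"
  then obtain j where "\<xi> $ j \<noteq> 0" by (auto simp: vec_eq_iff)
  then have "0 < (\<xi> $ j) ^ (2 * co_weight l j)" by (simp add: zero_less_power_eq)
  then show ?thesis using aniso_poly_component[of \<xi> j l] by linarith
qed

lemma aniso_length_pos: "\<xi> \<noteq> 0 \<Longrightarrow> 0 < aniso_length l \<xi>"
  using aniso_poly_pos[of \<xi>] by (simp add: aniso_length_eq)

lemma aniso_length_sphere_nonzero: "{\<xi>. aniso_length l \<xi> = 1} \<subseteq> - {0}"
  by (auto simp: aniso_length_eq aniso_poly_0)

lemma aniso_poly_dilate: "aniso_poly l (aniso_dilate l \<rho> \<xi>) = \<rho> ^ aniso_exponent l * aniso_poly l \<xi>"
proof -
  have "(aniso_dilate l \<rho> \<xi> $ j) ^ (2 * co_weight l j) = \<rho> ^ aniso_exponent l * (\<xi> $ j) ^ (2 * co_weight l j)" for j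
    by (simp only: aniso_dilate_nth power_mult_distrib aniso_exponent_co_weight[OF l, of j] flip: power_mult)
  then show ?thesis by (simp only: aniso_poly_def sum_distrib_left)
qed

lemma aniso_length_dilate:
  assumes "0 < \<rho>"
  shows "aniso_length l (aniso_dilate l \<rho> \<xi>) = \<rho> * aniso_length l \<xi>"
proof -
  have "(\<rho> ^ aniso_exponent l) powr (1 / real (aniso_exponent l)) = \<rho>"
    using assms aniso_exponent_pos[OF l] by (simp add: powr_powr flip: powr_realpow)
  then show ?thesis using assms by (simp add: aniso_length_eq aniso_poly_dilate powr_mult)
qed

lemma smooth_on_aniso_length_powr: "smooth_on (- {0}) (\<lambda>\<xi>. aniso_length l \<xi> powr s)"
  unfolding aniso_length_eq powr_powr
  by (intro smooth_on_powr smooth_on_aniso_poly aniso_poly_pos) auto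

lemma radial_retraction_sphere: "radial_retraction l ` (- {0}) \<subseteq> {\<xi>. aniso_length l \<xi> = 1}"
  using aniso_length_pos by (auto simp: radial_retraction_def aniso_length_dilate less_imp_neq[THEN not_sym])

lemma smooth_on_radial_retraction: "smooth_on (- {0}) (radial_retraction l)"
proof (rule smooth_on_cong)
  show "smooth_on (- {0}) (\<lambda>\<xi>. \<Sum>j\<in>UNIV. (aniso_length l \<xi> powr (- real (l j)) * \<xi> $ j) *\<^sub>R axis j 1)"
    by (intro smooth_on_sum smooth_on_scaleR smooth_on_mult smooth_on_aniso_length_powr smooth_on_component smooth_on_const) auto
  fix \<xi> :: "real^'n" assume "\<xi> \<in> - {0}"
  then have "0 < aniso_length l \<xi>" using aniso_length_pos by auto
  then have "aniso_length l \<xi> powr (- real (l j)) = (1 / aniso_length l \<xi>) ^ l j" for j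
    by (simp add: powr_minus powr_realpow power_one_over inverse_eq_divide)
  then show "(\<Sum>j\<in>UNIV. (aniso_length l \<xi> powr (- real (l j)) * \<xi> $ j) *\<^sub>R axis j 1) = radial_retraction l \<xi>"
    by (simp add: vec_eq_iff radial_retraction_def aniso_dilate_nth axis_def if_distrib cong: if_cong)
qed auto

lemma aniso_homogeneous_from_sphere:
  assumes "aniso_homogeneous l m b" "\<xi> \<noteq> 0"
  shows "b \<xi> = aniso_length l \<xi> powr m *\<^sub>R (b \<circ> radial_retraction l) \<xi>"
proof -
  have r: "0 < aniso_length l \<xi>" using aniso_length_pos assms by simp
  then have "radial_retraction l \<xi> \<noteq> 0"
    using assms by (simp add: radial_retraction_def aniso_dilate_eq_0_iff)
  then have "b (aniso_dilate l (aniso_length l \<xi>) (radial_retraction l \<xi>)) = aniso_length l \<xi> powr m *\<^sub>R b (radial_retraction l \<xi>)"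
    using assms r unfolding aniso_homogeneous_def by blast
  then show ?thesis using r by (simp add: radial_retraction_def aniso_dilate_dilate)
qed

text \<open>
  The sphere avoids the origin, so this is the chain rule.
\<close>

lemma aniso_homogeneous_smooth_on_sphere:
  assumes "aniso_homogeneous l m b"
  shows "smooth_on_submanifold {\<xi>. aniso_length l \<xi> = 1} b"
  unfolding smooth_on_submanifold_def
proof safe
  fix W :: "(real^'n) set" and \<phi> :: "real^'n \<Rightarrow> real^'n"
  assume "open W" "smooth_on W \<phi>" "\<phi> ` W \<subseteq> {\<xi>. aniso_length l \<xi> = 1}"
  then show "smooth_on W (b \<circ> \<phi>)"
    using assms aniso_length_sphere_nonzero unfolding aniso_homogeneous_def
    by (intro smooth_on_compose[of W "- {0}"]) auto
qed

lemma smooth_on_homogeneous_retraction: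
  assumes "aniso_homogeneous l m b"
  shows "smooth_on (- {0}) (b \<circ> radial_retraction l)"
  using aniso_homogeneous_smooth_on_sphere[OF assms] smooth_on_radial_retraction radial_retraction_sphere
  unfolding smooth_on_submanifold_def by blast

end

text \<open>
  Differentiate \<open>b (\<rho>\<cdot>\<xi>) = \<rho>\<^sup>m b \<xi>\<close>, where \<open>\<rho>\<cdot>\<xi>\<close> is linear in \<open>\<xi>\<close> and stretches the direction \<open>j\<close>
  by \<open>\<rho> ^ l j\<close>.
\<close>

lemma aniso_homogeneous_partial_deriv:
  fixes l :: "'n::finite \<Rightarrow> nat" and b :: "real^'n \<Rightarrow> 'b::real_normed_vector"
  assumes b: "aniso_homogeneous l m b"
  shows "aniso_homogeneous l (m - real (l j)) (partial_deriv j b)"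
  unfolding aniso_homogeneous_def
proof safe
  have sm: "smooth_on (- {0}) b" and
    hom: "\<And>\<rho> \<xi>. 0 < \<rho> \<Longrightarrow> \<xi> \<noteq> 0 \<Longrightarrow> b (aniso_dilate l \<rho> \<xi>) = (\<rho> powr m) *\<^sub>R b \<xi>"
    using b by (auto simp: aniso_homogeneous_def)
  show "smooth_on (- {0}) (partial_deriv j b)" by (rule smooth_on_partial_deriv[OF sm])
  fix \<rho> :: real and \<xi> :: "real^'n" assume \<rho>: "0 < \<rho>" and \<xi>: "\<xi> \<noteq> 0"
  let ?d = "aniso_dilate l \<rho>"
  have lin: "bounded_linear ?d"
    by (rule linear_conv_bounded_linear[THEN iffD1], rule linearI)
       (simp_all add: vec_eq_iff aniso_dilate_nth algebra_simps)
  have d0: "?d \<xi> \<in> - {0}" using \<xi> \<rho> by (simp add: aniso_dilate_eq_0_iff)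
  have fr: "(b has_derivative frechet b (?d \<xi>)) (at (?d \<xi>))" by (rule smooth_on_has_derivative[OF sm d0])
  have "((\<lambda>x. b (?d x)) has_derivative (\<lambda>v. frechet b (?d \<xi>) (?d v))) (at \<xi>)"
    by (rule has_derivative_compose[OF bounded_linear_imp_has_derivative[OF lin] fr])
  moreover have "((\<lambda>x. b (?d x)) has_derivative (\<lambda>v. (\<rho> powr m) *\<^sub>R frechet b \<xi> v)) (at \<xi>)"
  proof (rule has_derivative_transform_within_open)
    show "((\<lambda>x. (\<rho> powr m) *\<^sub>R b x) has_derivative (\<lambda>v. (\<rho> powr m) *\<^sub>R frechet b \<xi> v)) (at \<xi>)"
      by (intro has_derivative_scaleR_right smooth_on_has_derivative[OF sm]) (use \<xi> in auto)
    show "open (- {0 :: real^'n})" by auto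
  qed (use \<xi> hom[OF \<rho>] in auto)
  ultimately have "(\<lambda>v. frechet b (?d \<xi>) (?d v)) = (\<lambda>v. (\<rho> powr m) *\<^sub>R frechet b \<xi> v)"
    by (rule has_derivative_unique)
  then have "frechet b (?d \<xi>) (?d (axis j 1)) = (\<rho> powr m) *\<^sub>R partial_deriv j b \<xi>"
    by (auto simp: partial_deriv_def dest: fun_cong)
  moreover have "?d (axis j 1) = (\<rho> ^ l j) *\<^sub>R axis j 1"
    by (simp add: vec_eq_iff aniso_dilate_nth axis_def)
  ultimately have "(\<rho> ^ l j) *\<^sub>R partial_deriv j b (?d \<xi>) = (\<rho> powr m) *\<^sub>R partial_deriv j b \<xi>"
    by (simp add: partial_deriv_def linear_cmul[OF has_derivative_linear[OF fr]])
  then have "(1 / \<rho> ^ l j) *\<^sub>R (\<rho> ^ l j) *\<^sub>R partial_deriv j b (?d \<xi>) = (1 / \<rho> ^ l j) *\<^sub>R (\<rho> powr m) *\<^sub>R partial_deriv j b \<xi>"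
    by (rule arg_cong)
  then show "partial_deriv j b (?d \<xi>) = (\<rho> powr (m - real (l j))) *\<^sub>R partial_deriv j b \<xi>"
    using \<rho> by (simp add: powr_diff powr_realpow)
qed

lemma aniso_homogeneous_iter_partial:
  "aniso_homogeneous l m b \<Longrightarrow> aniso_homogeneous l (m - real (sum_list (map l ks))) (iter_partial ks b)"
proof (induction ks)
  case (Cons j ks)
  from aniso_homogeneous_partial_deriv[OF Cons.IH[OF Cons.prems], of j] show ?case
    by (simp add: algebra_simps)
qed simp

lemma sum_list_multi_list: "sum_list (map l (multi_list \<beta>)) = aniso_order l (\<beta> :: 'n::finite \<Rightarrow> nat)"
proof -
  have "sum_list (map l (concat (map (\<lambda>j. replicate (\<beta> j) j) js))) = sum_list (map (\<lambda>j. l j * \<beta> j) js)" for js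
    by (induction js) (simp_all add: sum_list_replicate mult.commute)
  then show ?thesis
    using coords[where 'n = 'n] by (simp add: multi_list_def aniso_order_def sum_list_distinct_conv_sum_set)
qed

lemma aniso_homogeneous_multi_deriv:
  "aniso_homogeneous l m b \<Longrightarrow> aniso_homogeneous l (m - real (aniso_order l \<beta>)) (multi_deriv \<beta> b)"
  unfolding multi_deriv_eq_iter_partial sum_list_multi_list[symmetric] by (rule aniso_homogeneous_iter_partial)

lemma excision_radii:
  assumes "excision c"
  shows "\<exists>\<delta>>0. \<exists>B. (\<forall>\<xi>. norm \<xi> < \<delta> \<longrightarrow> c \<xi> = 0) \<and> (\<forall>\<xi>. B \<le> norm \<xi> \<longrightarrow> c \<xi> = 1)"
proof -
  obtain \<delta> where \<delta>: "0 < \<delta>" "\<forall>\<xi>. dist \<xi> 0 < \<delta> \<longrightarrow> c \<xi> = 0"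
    using assms unfolding excision_def eventually_nhds_metric by blast
  obtain B where "\<forall>\<xi>. B \<le> norm \<xi> \<longrightarrow> c \<xi> = 1"
    using assms unfolding excision_def eventually_at_infinity by blast
  with \<delta> show ?thesis by (metis dist_0_norm dist_commute)
qed

text \<open>
  Near the origin the product vanishes identically.
\<close>

lemma smooth_on_excised:
  fixes h :: "real^'n::finite \<Rightarrow> 'b::real_normed_vector"
  assumes "excision c" "smooth_on (- {0}) h"
  shows "smooth_on UNIV (\<lambda>\<xi>. c \<xi> *\<^sub>R h \<xi>)"
proof -
  obtain \<delta> where \<delta>: "0 < \<delta>" "\<And>\<xi>. norm \<xi> < \<delta> \<Longrightarrow> c \<xi> = 0"
    using excision_radii[OF assms(1)] by blast
  have "smooth_on (ball 0 \<delta>) (\<lambda>\<xi>. c \<xi> *\<^sub>R h \<xi>)"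
    by (rule smooth_on_cong[OF open_ball _ smooth_on_const[OF open_ball, of 0]]) (use \<delta> in auto)
  moreover have "smooth_on (- {0}) (\<lambda>\<xi>. c \<xi> *\<^sub>R h \<xi>)"
    using assms by (intro smooth_on_scaleR) (auto simp: excision_def intro: smooth_on_subset)
  ultimately have "smooth_on (ball 0 \<delta> \<union> - {0}) (\<lambda>\<xi>. c \<xi> *\<^sub>R h \<xi>)"
    by (intro smooth_on_Un) auto
  moreover have "ball 0 \<delta> \<union> - {0 :: real^'n} = UNIV" using \<delta>(1) by auto
  ultimately show ?thesis by (simp only:)
qed

lemma leibniz_bound_uniform:
  fixes \<sigma> :: "real^'n::finite \<Rightarrow> real"
  assumes "open W" "smooth_on W \<sigma>" "compact K" "K \<subseteq> W" "K \<noteq> {}"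
  shows "\<exists>C\<ge>0. \<forall>(u :: real^'n \<Rightarrow> 'b::real_normed_vector) D. smooth_on W u \<longrightarrow>
    (\<forall>ks. length ks \<le> N \<longrightarrow> (\<forall>x\<in>K. norm (iter_partial ks u x) \<le> D)) \<longrightarrow>
    (\<forall>js x. length js \<le> N \<longrightarrow> x \<in> K \<longrightarrow> norm (iter_partial js (\<lambda>x. \<sigma> x *\<^sub>R u x) x) \<le> C * D)"
proof -
  have "\<forall>js. \<exists>C. 0 \<le> C \<and> (\<forall>(u :: real^'n \<Rightarrow> 'b) D. smooth_on W u \<longrightarrow>
    (\<forall>ks. length ks \<le> length js \<longrightarrow> (\<forall>x\<in>K. norm (iter_partial ks u x) \<le> D)) \<longrightarrow>
    (\<forall>x\<in>K. norm (iter_partial js (\<lambda>x. \<sigma> x *\<^sub>R u x) x) \<le> C * D))"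
    using leibniz_bound[OF assms(1-4)] by (intro allI)
  from choice[OF this] obtain C where C: "\<And>js. 0 \<le> C js" "\<And>js (u :: real^'n \<Rightarrow> 'b) D x. smooth_on W u \<Longrightarrow>
    (\<forall>ks. length ks \<le> length js \<longrightarrow> (\<forall>x\<in>K. norm (iter_partial ks u x) \<le> D)) \<Longrightarrow> x \<in> K \<Longrightarrow>
    norm (iter_partial js (\<lambda>x. \<sigma> x *\<^sub>R u x) x) \<le> C js * D"
    by blast
  let ?L = "{js :: 'n list. length js \<le> N}"
  have fin: "finite ?L" using finite_lists_length_le[of "UNIV :: 'n set" N] by simp
  show ?thesis
  proof (rule exI[of _ "\<Sum>js\<in>?L. C js"], intro conjI allI impI)
    show "0 \<le> (\<Sum>js\<in>?L. C js)" by (intro sum_nonneg C)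
    fix u :: "real^'n \<Rightarrow> 'b" and D and js :: "'n list" and x
    assume u: "smooth_on W u" and D: "\<forall>ks. length ks \<le> N \<longrightarrow> (\<forall>x\<in>K. norm (iter_partial ks u x) \<le> D)"
      and js: "length js \<le> N" and x: "x \<in> K"
    have "norm (u x) \<le> D" using D[rule_format, of "[]" x] x by simp
    then have D0: "0 \<le> D" using norm_ge_zero order_trans by blast
    have "norm (iter_partial js (\<lambda>x. \<sigma> x *\<^sub>R u x) x) \<le> C js * D"
      using D js by (intro C(2)[OF u _ x]) auto
    also have "\<dots> \<le> (\<Sum>js\<in>?L. C js) * D"
      using fin js C(1) by (intro mult_right_mono D0 member_le_sum) auto
    finally show "norm (iter_partial js (\<lambda>x. \<sigma> x *\<^sub>R u x) x) \<le> (\<Sum>js\<in>?L. C js) * D" .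
  qed
qed

text \<open>
  For \<open>|\<xi>|\<^sub>l \<ge> \<rho>\<close> the excision function is \<open>1\<close>, and dilation by \<open>1 / t\<close> with \<open>t = |\<xi>|\<^sub>l / \<rho>\<close> moves
  \<open>\<xi>\<close> to a point with \<open>|\<eta>|\<^sub>l = \<rho>\<close>; for smaller \<open>\<xi>\<close> put \<open>t = 1\<close>. In both cases the weighted derivative at
  \<open>\<xi>\<close> is a bounded scalar multiple of the derivative at a point of a fixed cube, and
  \<open>R_estimate_cube\<close> applies to the excised function there. Its derivatives are controlled by those of the
  pull-back of \<open>h\<close> to the punctured space, because \<open>h = |\<xi>|\<^sub>l\<^sup>m (h \<circ> retraction)\<close>; near the origin they
  vanish, so only a compact set \<open>K\<close> away from the origin matters.
\<close>

lemma R_estimate_homogeneous: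
  fixes l :: "'n::finite \<Rightarrow> nat" and c :: "real^'n \<Rightarrow> real"
  assumes l: "\<forall>j. 1 \<le> l j" and p: "1 \<le> p" and c: "excision c" and m: "m \<le> \<mu>"
  shows "\<exists>C K. 0 \<le> C \<and> compact K \<and> K \<noteq> {} \<and> K \<subseteq> - {0} \<and>
    (\<forall>(h :: real^'n \<Rightarrow> 'x::real_normed_vector \<Rightarrow>\<^sub>L 'y::real_normed_vector) D. aniso_homogeneous l m h \<longrightarrow>
      (\<forall>ks. length ks \<le> CARD('n) + length (multi_list \<beta>) \<longrightarrow>
        (\<forall>\<xi>\<in>K. norm (iter_partial ks (h \<circ> radial_retraction l) \<xi>) \<le> D)) \<longrightarrow>
      R_estimate p (C * D) (range (weighted_deriv l \<mu> \<beta> (\<lambda>\<xi>. c \<xi> *\<^sub>R h \<xi>))))"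
proof -
  obtain \<delta> B where \<delta>: "0 < \<delta>" "\<And>\<xi>. norm \<xi> < \<delta> \<Longrightarrow> c \<xi> = 0" and B: "\<And>\<xi>. B \<le> norm \<xi> \<Longrightarrow> c \<xi> = 1"
    using excision_radii[OF c] by blast
  let ?N = "CARD('n) + length (multi_list \<beta>)"
  have "compact (aniso_poly l ` cball 0 \<bar>B\<bar>)"
    by (intro compact_continuous_image smooth_on_imp_continuous_on
        smooth_on_subset[OF _ smooth_on_aniso_poly[OF open_UNIV]]) auto
  then obtain R where R: "\<And>\<xi>. \<xi> \<in> cball 0 \<bar>B\<bar> \<Longrightarrow> \<bar>aniso_poly l \<xi>\<bar> \<le> R"
    using compact_imp_bounded bounded_iff by (metis imageI real_norm_def)
  have R0: "0 \<le> R" using order_trans[OF abs_ge_zero R[of 0]] by simp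
  \<comment> \<open>\<open>R\<close> bounds the polynomial on the ball where \<open>c\<close> may differ from \<open>1\<close>; the radius \<open>\<rho> \<ge> 1\<close> below is chosen such that all \<open>\<xi>\<close> with \<open>|\<xi>|\<^sub>l \<ge> \<rho>\<close> lie in \<open>V\<close>\<close>
  define V where "V = {\<xi>. R < aniso_poly l \<xi>}"
  have V: "open V" unfolding V_def
    by (intro open_Collect_less continuous_on_const smooth_on_imp_continuous_on smooth_on_aniso_poly open_UNIV)
  have V0: "V \<subseteq> - {0}" using R0 aniso_poly_0[OF l] by (auto simp: V_def)
  have Vc: "c \<xi> = 1" if "\<xi> \<in> V" for \<xi>
  proof (rule B, rule ccontr)
    assume "\<not> B \<le> norm \<xi>"
    then have "norm \<xi> \<le> \<bar>B\<bar>" by linarith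
    then show False using R[of \<xi>] that by (auto simp: V_def)
  qed
  define \<rho> where "\<rho> = (R + 2) powr (1 / real (aniso_exponent l))"
  have \<rho>: "1 \<le> \<rho>" "\<rho> powr real (aniso_exponent l) = R + 2"
    using R0 aniso_exponent_pos[OF l] by (auto simp: \<rho>_def powr_powr intro: ge_one_powr_ge_zero)
  have length_poly: "aniso_poly l \<xi> \<le> (t * \<rho>) powr real (aniso_exponent l)" if "aniso_length l \<xi> \<le> t * \<rho>" for \<xi> t
    using powr_mono2[OF _ _ that, of "real (aniso_exponent l)"] aniso_length_powr[OF l, of \<xi>] by simp
  define b where "b = (\<chi> i::'n. R + 2)"
  define s where "s = 2 * (R + 2)"
  have box: "\<xi> \<in> cbox (- b) b" if "aniso_length l \<xi> \<le> \<rho>" for \<xi>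
  proof -
    have "aniso_poly l \<xi> \<le> R + 2" using length_poly[of \<xi> 1] that \<rho> by simp
    then have "\<bar>\<xi> $ j\<bar> \<le> R + 2" for j using abs_component_le[OF l, of \<xi> j] R0 by linarith
    then have "- (R + 2) \<le> \<xi> $ j \<and> \<xi> $ j \<le> R + 2" for j by (metis abs_le_iff minus_le_iff)
    then show ?thesis unfolding mem_box_cart b_def vector_uminus_component vec_lambda_beta by blast
  qed
  define K where "K = cbox (- b) b \<inter> {\<xi>. min \<delta> 1 \<le> norm \<xi>}"
  have K: "compact K" "K \<subseteq> - {0}"
    unfolding K_def using \<delta>(1)
    by (auto intro!: closed_Int_compact[of "{\<xi>. _ \<le> norm \<xi>}", simplified Int_commute] closed_Collect_le continuous_intros)
  have "axis (undefined :: 'n) 1 \<in> cbox (- b) b"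
    using R0 by (auto simp: b_def mem_box_cart axis_def)
  then have "axis (undefined :: 'n) 1 \<in> K" by (simp add: K_def)
  then have Kne: "K \<noteq> {}" by blast
  define \<sigma> where "\<sigma> = (\<lambda>\<xi>. c \<xi> * aniso_length l \<xi> powr m)"
  have \<sigma>: "smooth_on (- {0}) \<sigma>"
    unfolding \<sigma>_def using c
    by (intro smooth_on_mult smooth_on_aniso_length_powr[OF l]) (auto simp: excision_def intro: smooth_on_subset)
  obtain C0 where C0: "0 \<le> C0" "\<And>(u :: real^'n \<Rightarrow> 'x \<Rightarrow>\<^sub>L 'y) D js x. smooth_on (- {0}) u \<Longrightarrow>
    (\<forall>ks. length ks \<le> ?N \<longrightarrow> (\<forall>x\<in>K. norm (iter_partial ks u x) \<le> D)) \<Longrightarrow>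
    length js \<le> ?N \<Longrightarrow> x \<in> K \<Longrightarrow> norm (iter_partial js (\<lambda>x. \<sigma> x *\<^sub>R u x) x) \<le> C0 * D"
    using leibniz_bound_uniform[OF open_Compl[OF closed_singleton] \<sigma> K Kne, where N = ?N] by blast
  define e where "e = - \<mu> + real (aniso_order l \<beta>)"
  define C where "C = (2 * \<rho>) powr \<bar>e\<bar> * ((1 + s) ^ CARD('n) * C0)"
  show ?thesis
  proof (rule exI[of _ C], rule exI[of _ K], intro conjI allI impI K Kne)
    show "0 \<le> C" using R0 C0 by (simp add: C_def s_def)
    fix h :: "real^'n \<Rightarrow> 'x \<Rightarrow>\<^sub>L 'y" and D
    assume h: "aniso_homogeneous l m h" and
      D: "\<forall>ks. length ks \<le> ?N \<longrightarrow> (\<forall>\<xi>\<in>K. norm (iter_partial ks (h \<circ> radial_retraction l) \<xi>) \<le> D)"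
    define u where "u = h \<circ> radial_retraction l"
    define f where "f = (\<lambda>\<xi>. c \<xi> *\<^sub>R h \<xi>)"
    define g where "g = multi_deriv \<beta> f"
    obtain x0 where "x0 \<in> K" using Kne by blast
    then have D0: "0 \<le> D" using order_trans[OF norm_ge_zero D[rule_format, of "[]" x0]] by simp
    have u: "smooth_on (- {0}) u" unfolding u_def by (rule smooth_on_homogeneous_retraction[OF l h])
    have hs: "smooth_on (- {0}) h" using h by (simp add: aniso_homogeneous_def)
    have f: "smooth_on UNIV f" unfolding f_def by (rule smooth_on_excised[OF c hs])
    have f_bound: "norm (iter_partial js f \<xi>) \<le> C0 * D" if js: "length js \<le> ?N" and \<xi>: "\<xi> \<in> cbox (- b) b" for js \<xi>
    proof (cases "\<xi> \<in> K")
      case True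
      have "iter_partial js f \<xi> = iter_partial js (\<lambda>\<xi>. \<sigma> \<xi> *\<^sub>R u \<xi>) \<xi>"
      proof (rule iter_partial_cong[of "- {0}"])
        show "f x = \<sigma> x *\<^sub>R u x" if "x \<in> - {0}" for x
          using aniso_homogeneous_from_sphere[OF l h, of x] that by (simp add: f_def \<sigma>_def u_def)
      qed (use f True K in \<open>auto intro: smooth_on_subset\<close>)
      then show ?thesis using C0(2)[OF u _ js True] D by (simp add: u_def)
    next
      case False
      have "iter_partial js f \<xi> = iter_partial js (\<lambda>\<xi>. 0 *\<^sub>R f \<xi>) \<xi>"
        by (rule iter_partial_cong[of "ball 0 \<delta>"])
           (use f False \<xi> \<delta> in \<open>auto simp: f_def K_def intro: smooth_on_subset\<close>)
      then show ?thesis using iter_partial_scale[OF open_UNIV f, of \<xi> js 0] C0(1) D0 by simp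
    qed
    have est: "R_estimate p ((1 + s) ^ CARD('n) * (C0 * D)) (g ` cbox (- b) b)"
    proof (rule R_estimate_cube[OF p])
      show "smooth_on UNIV g" unfolding g_def by (rule smooth_on_multi_deriv[OF f])
      fix ks :: "'n list" and \<xi> assume "length ks \<le> CARD('n)" "\<xi> \<in> cbox (- b) b"
      then show "norm (iter_partial ks g \<xi>) \<le> C0 * D"
        using f_bound[of "ks @ multi_list \<beta>" \<xi>] by (simp add: g_def multi_deriv_eq_iter_partial iter_partial_append)
    qed (use R0 in \<open>auto simp: b_def s_def\<close>)
    define t where "t \<xi> = max 1 (aniso_length l \<xi> / \<rho>)" for \<xi>
    define w where "w \<xi> = aniso_bracket l \<xi> powr e * t \<xi> powr (m - real (aniso_order l \<beta>))" for \<xi>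
    have t1: "1 \<le> t \<xi>" and t2: "aniso_length l \<xi> \<le> t \<xi> * \<rho>" for \<xi>
      using \<rho>(1) by (auto simp: t_def max_def field_simps)
    have rescale: "g \<xi> = t \<xi> powr (m - real (aniso_order l \<beta>)) *\<^sub>R g (aniso_dilate l (1 / t \<xi>) \<xi>)" for \<xi>
    proof (cases "t \<xi> = 1")
      case False
      let ?\<eta> = "aniso_dilate l (1 / t \<xi>) \<xi>"
      have t: "t \<xi> = aniso_length l \<xi> / \<rho>" "1 < t \<xi>"
        using False t1[of \<xi>] by (simp_all add: t_def max_def split: if_splits)
      have t0: "0 < t \<xi>" using t(2) by simp
      have len: "\<rho> < aniso_length l \<xi>"
        using mult_strict_right_mono[OF t(2), of \<rho>] t(1) \<rho>(1) by simp
      have len': "aniso_length l ?\<eta> = \<rho>" using t \<rho>(1) len by (simp add: aniso_length_dilate[OF l])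
      have inV: "x \<in> V" if "\<rho> \<le> aniso_length l x" for x
      proof -
        have "\<rho> powr real (aniso_exponent l) \<le> aniso_length l x powr real (aniso_exponent l)"
          using that \<rho>(1) by (intro powr_mono2) auto
        then show ?thesis using \<rho>(2) aniso_length_powr[OF l, of x] by (simp add: V_def)
      qed
      have gh: "g x = multi_deriv \<beta> h x" if "x \<in> V" for x
        unfolding g_def multi_deriv_eq_iter_partial
        by (rule iter_partial_cong[OF V]) (use f that Vc in \<open>auto simp: f_def intro: smooth_on_subset\<close>)
      have \<eta>: "?\<eta> \<in> V" and \<xi>: "\<xi> \<in> V" using inV len len' by auto
      have "multi_deriv \<beta> h (aniso_dilate l (t \<xi>) ?\<eta>) = t \<xi> powr (m - real (aniso_order l \<beta>)) *\<^sub>R multi_deriv \<beta> h ?\<eta>"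
      proof -
        have "?\<eta> \<noteq> 0" using \<eta> V0 by blast
        then show ?thesis
          using aniso_homogeneous_multi_deriv[OF h, of \<beta>] t0 unfolding aniso_homogeneous_def by blast
      qed
      then show ?thesis using t0 gh[OF \<eta>] gh[OF \<xi>] by (simp add: aniso_dilate_dilate)
    qed simp
    have inbox: "aniso_dilate l (1 / t \<xi>) \<xi> \<in> cbox (- b) b" for \<xi>
      using t1[of \<xi>] t2[of \<xi>] by (intro box) (simp add: aniso_length_dilate[OF l] pos_divide_le_eq mult.commute)
    have w_bound: "\<bar>w \<xi>\<bar> \<le> (2 * \<rho>) powr \<bar>e\<bar>" for \<xi>
    proof -
      have "aniso_bracket l \<xi> \<le> (2 * \<rho>) * t \<xi>"
      proof -
        let ?L = "real (aniso_exponent l)"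
        have "1 + aniso_poly l \<xi> \<le> 2 * (t \<xi> * \<rho>) powr ?L"
        proof -
          have "1 \<le> (t \<xi> * \<rho>) powr ?L" using t1[of \<xi>] \<rho>(1) mult_mono[of 1 "t \<xi>" 1 \<rho>]
            by (intro ge_one_powr_ge_zero) auto
          then show ?thesis using length_poly[OF t2] by (smt (verit))
        qed
        also have "\<dots> \<le> 2 powr ?L * (t \<xi> * \<rho>) powr ?L"
          using powr_mono[of 1 ?L 2] aniso_exponent_pos[OF l] by (intro mult_right_mono) auto
        finally have "(1 + aniso_poly l \<xi>) powr (1 / ?L) \<le> (2 powr ?L * (t \<xi> * \<rho>) powr ?L) powr (1 / ?L)"
          by (intro powr_mono2) auto
        also have "\<dots> = 2 * (t \<xi> * \<rho>)"
          using aniso_exponent_pos[OF l] t1[of \<xi>] \<rho>(1) by (simp add: powr_mult powr_powr)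
        finally show ?thesis by (simp add: aniso_bracket_eq mult_ac)
      qed
      moreover have "t \<xi> \<le> (2 * \<rho>) * aniso_bracket l \<xi>"
      proof -
        have "aniso_length l \<xi> \<le> aniso_bracket l \<xi>"
          unfolding aniso_length_eq aniso_bracket_eq by (intro powr_mono2) auto
        moreover have "aniso_length l \<xi> / \<rho> \<le> aniso_length l \<xi> / 1"
          using \<rho>(1) by (intro divide_left_mono) auto
        ultimately have "t \<xi> \<le> aniso_bracket l \<xi>"
          using aniso_bracket_ge_1[OF l, of \<xi>] by (simp add: t_def)
        also have "\<dots> \<le> (2 * \<rho>) * aniso_bracket l \<xi>"
          using \<rho>(1) aniso_bracket_ge_1[OF l, of \<xi>] mult_right_mono[of 1 "2 * \<rho>" "aniso_bracket l \<xi>"] by simp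
        finally show ?thesis .
      qed
      ultimately have "aniso_bracket l \<xi> powr e \<le> (2 * \<rho>) powr \<bar>e\<bar> * t \<xi> powr e"
        using \<rho>(1) t1[of \<xi>] aniso_bracket_ge_1[OF l, of \<xi>] by (intro powr_comparable) auto
      moreover have "t \<xi> powr (m - real (aniso_order l \<beta>)) \<le> t \<xi> powr (- e)"
        using t1[of \<xi>] m by (intro powr_mono) (auto simp: e_def)
      ultimately have "w \<xi> \<le> ((2 * \<rho>) powr \<bar>e\<bar> * t \<xi> powr e) * t \<xi> powr (- e)"
        unfolding w_def by (intro mult_mono) auto
      also have "\<dots> = (2 * \<rho>) powr \<bar>e\<bar>" using t1[of \<xi>] by (simp flip: powr_add)
      finally show ?thesis by (simp add: w_def)
    qed
    have "R_estimate p ((2 * \<rho>) powr \<bar>e\<bar> * ((1 + s) ^ CARD('n) * (C0 * D)))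
        (range (\<lambda>\<xi>. w \<xi> *\<^sub>R g (aniso_dilate l (1 / t \<xi>) \<xi>)))"
      by (rule R_estimate_scaleR[OF p est]) (use inbox w_bound in auto)
    moreover have "weighted_deriv l \<mu> \<beta> f \<xi> = w \<xi> *\<^sub>R g (aniso_dilate l (1 / t \<xi>) \<xi>)" for \<xi>
      using rescale[of \<xi>] by (simp add: weighted_deriv_def w_def e_def flip: g_def scaleR_scaleR)
    ultimately show "R_estimate p (C * D) (range (weighted_deriv l \<mu> \<beta> (\<lambda>\<xi>. c \<xi> *\<^sub>R h \<xi>)))"
      by (simp add: C_def mult.assoc flip: f_def)
  qed
qed


section \<open>Classical symbols\<close>

lemma multi_deriv_add:
  assumes "open W" "smooth_on W f" "smooth_on W g" "\<xi> \<in> W"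
  shows "multi_deriv \<beta> (\<lambda>x. f x + g x) \<xi> = multi_deriv \<beta> f \<xi> + multi_deriv \<beta> g \<xi>"
  unfolding multi_deriv_eq_iter_partial by (rule iter_partial_add[OF assms])

lemma multi_deriv_diff:
  assumes "open W" "smooth_on W f" "smooth_on W g" "\<xi> \<in> W"
  shows "multi_deriv \<beta> (\<lambda>x. f x - g x) \<xi> = multi_deriv \<beta> f \<xi> - multi_deriv \<beta> g \<xi>"
proof -
  have "multi_deriv \<beta> f \<xi> = multi_deriv \<beta> (\<lambda>x. (f x - g x) + g x) \<xi>" by simp
  also have "\<dots> = multi_deriv \<beta> (\<lambda>x. f x - g x) \<xi> + multi_deriv \<beta> g \<xi>"
    using assms by (intro multi_deriv_add[OF assms(1)] smooth_on_diff)
  finally show ?thesis by simp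
qed

lemma weighted_deriv_diff:
  assumes "smooth_on UNIV f" "smooth_on UNIV g"
  shows "weighted_deriv l \<mu> \<beta> (\<lambda>x. f x - g x) = (\<lambda>\<xi>. weighted_deriv l \<mu> \<beta> f \<xi> - weighted_deriv l \<mu> \<beta> g \<xi>)"
  by (simp add: weighted_deriv_def fun_eq_iff multi_deriv_diff[OF open_UNIV assms] scaleR_diff_right)

lemma symbols_diff:
  assumes "f \<in> symbols l \<mu>" "g \<in> symbols l \<mu>"
  shows "(\<lambda>x. f x - g x) \<in> symbols l \<mu>"
proof -
  have sm: "smooth_on UNIV f" "smooth_on UNIV g" using assms by (auto simp: symbols_def)
  have "bdd_above (range (\<lambda>\<xi>. norm (weighted_deriv l \<mu> \<beta> (\<lambda>x. f x - g x) \<xi>)))" for \<beta>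
  proof -
    obtain A B where "\<And>\<xi>. norm (weighted_deriv l \<mu> \<beta> f \<xi>) \<le> A" "\<And>\<xi>. norm (weighted_deriv l \<mu> \<beta> g \<xi>) \<le> B"
      using assms unfolding symbols_def bdd_above_def by blast
    then show ?thesis unfolding weighted_deriv_diff[OF sm]
      by (intro bdd_aboveI[of _ "A + B"]) (auto intro!: order_trans[OF norm_triangle_ineq4] add_mono)
  qed
  then show ?thesis by (auto simp: symbols_def smooth_on_diff sm)
qed

lemma aniso_homogeneous_diff:
  assumes "aniso_homogeneous l m f" "aniso_homogeneous l m g"
  shows "aniso_homogeneous l m (\<lambda>x. f x - g x)"
  using assms unfolding aniso_homogeneous_def by (auto intro!: smooth_on_diff simp: scaleR_diff_right)

lemma homogeneous_components:
  assumes "a \<in> classical_symbols c l \<mu>"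
  shows "homogeneous_expansion c l \<mu> a (homogeneous_components c l \<mu> a)"
  using assms someI_ex[of "homogeneous_expansion c l \<mu> a"]
  by (simp add: classical_symbols_def homogeneous_components_def)

text \<open>
  The constant \<open>C\<close>, the compact sets \<open>K j\<close> and the number \<open>N\<close> of derivatives do not depend on \<open>r\<close>
  and \<open>h\<close>. This uniformity gives both the inclusion of the spaces and its continuity.
\<close>

lemma R_estimate_classical:
  fixes l :: "'n::finite \<Rightarrow> nat" and c :: "real^'n \<Rightarrow> real"
  assumes l: "\<forall>j. 1 \<le> l j" and p: "1 \<le> p" and c: "excision c"
  shows "\<exists>C K N. 0 \<le> C \<and> (\<forall>j. compact (K j) \<and> K j \<noteq> {} \<and> K j \<subseteq> - {0}) \<and>
    (\<forall>(r :: real^'n \<Rightarrow> 'x::real_normed_vector \<Rightarrow>\<^sub>L 'y::real_normed_vector) h D.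
      smooth_on UNIV r \<longrightarrow>
      (\<forall>j<remainder_order l. aniso_homogeneous l (\<mu> - real j) (h j)) \<longrightarrow>
      (\<forall>ks \<xi>. length ks \<le> N \<longrightarrow> norm (weighted_deriv l (\<mu> - real (remainder_order l)) (multi_add \<beta> ks) r \<xi>) \<le> D) \<longrightarrow>
      (\<forall>j<remainder_order l. \<forall>ks. length ks \<le> N \<longrightarrow>
        (\<forall>\<xi>\<in>K j. norm (multi_deriv (count (mset ks)) (h j \<circ> radial_retraction l) \<xi>) \<le> D)) \<longrightarrow>
      R_estimate p (C * D) (range (weighted_deriv l \<mu> \<beta>
        (\<lambda>\<xi>. r \<xi> + (\<Sum>j<remainder_order l. c \<xi> *\<^sub>R h j \<xi>)))))"
proof -
  let ?k = "remainder_order l" and ?N = "CARD('n) + length (multi_list \<beta>)"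
  obtain C0 where C0: "0 \<le> C0" "\<And>(r :: real^'n \<Rightarrow> 'x \<Rightarrow>\<^sub>L 'y) D. smooth_on UNIV r \<Longrightarrow>
    (\<forall>ks \<xi>. length ks \<le> CARD('n) \<longrightarrow>
      norm (weighted_deriv l (\<mu> - real ?k) (multi_add \<beta> ks) r \<xi>) \<le> D) \<Longrightarrow>
    R_estimate p (C0 * D) (range (weighted_deriv l \<mu> \<beta> r))"
    using R_estimate_low_order[OF l p, where 'x = 'x and 'y = 'y and \<mu> = \<mu> and \<beta> = \<beta>] by blast
  \<comment> \<open>constant and compact set are chosen together, as a pair, for every degree \<open>\<mu> - j\<close>\<close>
  define P where "P j CK \<longleftrightarrow> 0 \<le> fst CK \<and> compact (snd CK) \<and> snd CK \<noteq> {} \<and> snd CK \<subseteq> - {0} \<and>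
    (\<forall>(h :: real^'n \<Rightarrow> 'x \<Rightarrow>\<^sub>L 'y) D. aniso_homogeneous l (\<mu> - real j) h \<longrightarrow>
      (\<forall>ks. length ks \<le> ?N \<longrightarrow>
        (\<forall>\<xi>\<in>snd CK. norm (iter_partial ks (h \<circ> radial_retraction l) \<xi>) \<le> D)) \<longrightarrow>
      R_estimate p (fst CK * D) (range (weighted_deriv l \<mu> \<beta> (\<lambda>\<xi>. c \<xi> *\<^sub>R h \<xi>))))" for j :: nat and CK
  have "\<forall>j. \<exists>CK. P j CK"
  proof
    fix j :: nat
    have "\<mu> - real j \<le> \<mu>" by simp
    from R_estimate_homogeneous[OF l p c this, where 'x = 'x and 'y = 'y and \<beta> = \<beta>]
    show "\<exists>CK. P j CK" unfolding P_def split_paired_Ex fst_conv snd_conv by blast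
  qed
  from choice[OF this] obtain CK where CK: "\<And>j. P j (CK j)" by blast
  define C1 where "C1 j = fst (CK j)" for j
  define K where "K j = snd (CK j)" for j
  have C1: "0 \<le> C1 j" and K: "compact (K j)" "K j \<noteq> {}" "K j \<subseteq> - {0}" for j
    using CK[of j] by (auto simp: P_def C1_def K_def)
  have C1': "R_estimate p (C1 j * D) (range (weighted_deriv l \<mu> \<beta> (\<lambda>\<xi>. c \<xi> *\<^sub>R h \<xi>)))"
    if "aniso_homogeneous l (\<mu> - real j) h"
      "\<And>ks \<xi>. length ks \<le> ?N \<Longrightarrow> \<xi> \<in> K j \<Longrightarrow> norm (iter_partial ks (h \<circ> radial_retraction l) \<xi>) \<le> D"
    for j and h :: "real^'n \<Rightarrow> 'x \<Rightarrow>\<^sub>L 'y" and D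
    using CK[of j] that unfolding P_def C1_def K_def by blast
  show ?thesis
  proof (intro exI[of _ "C0 + (\<Sum>j<?k. C1 j)"] exI[of _ K] exI[of _ ?N] conjI allI impI K)
    show "0 \<le> C0 + (\<Sum>j<?k. C1 j)" using C0(1) C1 by (simp add: sum_nonneg)
    fix r :: "real^'n \<Rightarrow> 'x \<Rightarrow>\<^sub>L 'y" and h :: "nat \<Rightarrow> real^'n \<Rightarrow> 'x \<Rightarrow>\<^sub>L 'y" and D
    assume r: "smooth_on UNIV r" and h: "\<forall>j<?k. aniso_homogeneous l (\<mu> - real j) (h j)"
      and rD: "\<forall>ks \<xi>. length ks \<le> ?N \<longrightarrow> norm (weighted_deriv l (\<mu> - real ?k) (multi_add \<beta> ks) r \<xi>) \<le> D"
      and hD: "\<forall>j<?k. \<forall>ks. length ks \<le> ?N \<longrightarrow>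
        (\<forall>\<xi>\<in>K j. norm (multi_deriv (count (mset ks)) (h j \<circ> radial_retraction l) \<xi>) \<le> D)"
    have sm: "smooth_on UNIV (\<lambda>\<xi>. c \<xi> *\<^sub>R h j \<xi>)" if "j < ?k" for j
      using h that by (intro smooth_on_excised[OF c]) (auto simp: aniso_homogeneous_def)
    have "R_estimate p (C0 * D + (\<Sum>j<?k. C1 j * D)) (range (\<lambda>\<xi>. weighted_deriv l \<mu> \<beta> r \<xi>
        + (\<Sum>j<?k. weighted_deriv l \<mu> \<beta> (\<lambda>\<xi>. c \<xi> *\<^sub>R h j \<xi>) \<xi>)))"
    proof (intro R_estimate_add[OF p] R_estimate_sum[OF p])
      show "R_estimate p (C0 * D) (range (weighted_deriv l \<mu> \<beta> r))"
        using rD by (intro C0(2)[OF r]) auto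
      fix j assume j: "j \<in> {..<?k}"
      show "R_estimate p (C1 j * D) (range (weighted_deriv l \<mu> \<beta> (\<lambda>\<xi>. c \<xi> *\<^sub>R h j \<xi>)))"
      proof (rule C1')
        show hj: "aniso_homogeneous l (\<mu> - real j) (h j)" using h j by simp
        fix ks :: "'n list" and \<xi> assume ks: "length ks \<le> ?N" and \<xi>: "\<xi> \<in> K j"
        have "iter_partial ks (h j \<circ> radial_retraction l) \<xi> = multi_deriv (count (mset ks)) (h j \<circ> radial_retraction l) \<xi>"
          using \<xi> K(3)[of j]
          by (intro iter_partial_eq_multi_deriv[OF open_Compl[OF closed_singleton] smooth_on_homogeneous_retraction[OF l hj]]) auto
        then show "norm (iter_partial ks (h j \<circ> radial_retraction l) \<xi>) \<le> D" using hD j ks \<xi> by simp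
      qed
    qed simp
    moreover have "weighted_deriv l \<mu> \<beta> (\<lambda>\<xi>. r \<xi> + (\<Sum>j<?k. c \<xi> *\<^sub>R h j \<xi>)) \<xi>
        = weighted_deriv l \<mu> \<beta> r \<xi> + (\<Sum>j<?k. weighted_deriv l \<mu> \<beta> (\<lambda>\<xi>. c \<xi> *\<^sub>R h j \<xi>) \<xi>)" for \<xi>
    proof -
      have "multi_deriv \<beta> (\<lambda>\<xi>. r \<xi> + (\<Sum>j<?k. c \<xi> *\<^sub>R h j \<xi>)) \<xi>
          = multi_deriv \<beta> r \<xi> + multi_deriv \<beta> (\<lambda>\<xi>. \<Sum>j<?k. c \<xi> *\<^sub>R h j \<xi>) \<xi>"
        using sm by (intro multi_deriv_add[OF open_UNIV r] smooth_on_sum) auto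
      also have "multi_deriv \<beta> (\<lambda>\<xi>. \<Sum>j<?k. c \<xi> *\<^sub>R h j \<xi>) \<xi> = (\<Sum>j<?k. multi_deriv \<beta> (\<lambda>\<xi>. c \<xi> *\<^sub>R h j \<xi>) \<xi>)"
        unfolding multi_deriv_eq_iter_partial using sm by (intro iter_partial_sum[OF open_UNIV]) auto
      finally show ?thesis by (simp add: weighted_deriv_def scaleR_add_right scaleR_sum_right)
    qed
    ultimately show "R_estimate p ((C0 + (\<Sum>j<?k. C1 j)) * D) (range (weighted_deriv l \<mu> \<beta>
        (\<lambda>\<xi>. r \<xi> + (\<Sum>j<?k. c \<xi> *\<^sub>R h j \<xi>))))"
      by (simp add: distrib_right sum_distrib_right)
  qed
qed

lemma symbol_deriv_bounded:
  assumes "a \<in> symbols l \<mu>"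
  shows "norm (weighted_deriv l \<mu> \<beta> a \<xi>) \<le> (SUP \<xi>. norm (weighted_deriv l \<mu> \<beta> a \<xi>))"
  using assms by (intro cSUP_upper) (auto simp: symbols_def)

lemma multi_deriv_bounded_on_compact:
  assumes "smooth_on W f" "compact K" "K \<subseteq> W" "\<xi> \<in> K"
  shows "norm (multi_deriv \<beta> f \<xi>) \<le> (SUP \<xi>\<in>K. norm (multi_deriv \<beta> f \<xi>))"
proof (rule cSUP_upper[OF assms(4)])
  have "compact ((\<lambda>\<xi>. norm (multi_deriv \<beta> f \<xi>)) ` K)"
    by (intro compact_continuous_image continuous_on_norm assms
        continuous_on_subset[OF smooth_on_imp_continuous_on[OF smooth_on_multi_deriv[OF assms(1)]]])
  then show "bdd_above ((\<lambda>\<xi>. norm (multi_deriv \<beta> f \<xi>)) ` K)"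
    by (intro bounded_imp_bdd_above compact_imp_bounded)
qed

lemma finite_lists_bounded_length: "finite {ks :: 'n::finite list. length ks \<le> N}"
  using finite_lists_length_le[of "UNIV :: 'n set" N] by simp

lemma classical_symbol_expansion:
  "a = (\<lambda>\<xi>. expansion_remainder c h k a \<xi> + (\<Sum>j<k. c \<xi> *\<^sub>R h j \<xi>))"
  by (simp add: expansion_remainder_def)

text \<open>
  Only finitely many seminorms of the remainder and of the components enter
  \<open>R_estimate_classical\<close>, and \<open>D\<close> is taken to be their sum.
\<close>

lemma classical_imp_R_symbol:
  fixes l :: "'n::finite \<Rightarrow> nat" and c :: "real^'n \<Rightarrow> real"
    and a :: "real^'n \<Rightarrow> 'x::real_normed_vector \<Rightarrow>\<^sub>L 'y::real_normed_vector"
  assumes l: "\<forall>j. 1 \<le> l j" and p: "1 \<le> p" and c: "excision c" and a: "a \<in> classical_symbols c l \<mu>"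
  shows "a \<in> R_symbols p l \<mu>"
proof -
  let ?k = "remainder_order l"
  define h where "h = homogeneous_components c l \<mu> a"
  define r where "r = expansion_remainder c h ?k a"
  have h: "aniso_homogeneous l (\<mu> - real j) (h j)" and r: "r \<in> symbols l (\<mu> - real ?k)" for j
    using homogeneous_components[OF a] by (auto simp: homogeneous_expansion_def h_def r_def)
  have "R_bounded p (range (weighted_deriv l \<mu> \<beta> a))" for \<beta>
  proof -
    obtain C K N where C: "0 \<le> C" and K: "\<And>j::nat. compact (K j)" "\<And>j. K j \<noteq> {}" "\<And>j. K j \<subseteq> - {0}" and
      est: "\<And>(r :: real^'n \<Rightarrow> 'x \<Rightarrow>\<^sub>L 'y) h D. smooth_on UNIV r \<Longrightarrow>
      (\<forall>j<?k. aniso_homogeneous l (\<mu> - real j) (h j)) \<Longrightarrow>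
      (\<forall>ks \<xi>. length ks \<le> N \<longrightarrow> norm (weighted_deriv l (\<mu> - real ?k) (multi_add \<beta> ks) r \<xi>) \<le> D) \<Longrightarrow>
      (\<forall>j<?k. \<forall>ks. length ks \<le> N \<longrightarrow>
        (\<forall>\<xi>\<in>K j. norm (multi_deriv (count (mset ks)) (h j \<circ> radial_retraction l) \<xi>) \<le> D)) \<Longrightarrow>
      R_estimate p (C * D) (range (weighted_deriv l \<mu> \<beta> (\<lambda>\<xi>. r \<xi> + (\<Sum>j<?k. c \<xi> *\<^sub>R h j \<xi>))))"
      using R_estimate_classical[OF l p c, where 'x = 'x and 'y = 'y and \<mu> = \<mu> and \<beta> = \<beta>] by blast
    let ?L = "{ks :: 'n list. length ks \<le> N}"
    define D1 where "D1 ks = (SUP \<xi>. norm (weighted_deriv l (\<mu> - real ?k) (multi_add \<beta> ks) r \<xi>))" for ks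
    define D2 where "D2 j ks = (SUP \<xi>\<in>K j. norm (multi_deriv (count (mset ks)) (h j \<circ> radial_retraction l) \<xi>))" for j ks
    define D where "D = (\<Sum>ks\<in>?L. \<bar>D1 ks\<bar>) + (\<Sum>j<?k. \<Sum>ks\<in>?L. \<bar>D2 j ks\<bar>)"
    note fin = finite_lists_bounded_length[of N, where 'n = 'n]
    have D0: "0 \<le> D" unfolding D_def by (intro add_nonneg_nonneg sum_nonneg) auto
    have D1: "D1 ks \<le> D" if "ks \<in> ?L" for ks
    proof -
      have "\<bar>D1 ks\<bar> \<le> (\<Sum>ks\<in>?L. \<bar>D1 ks\<bar>)" by (rule member_le_sum[OF that _ fin]) simp
      moreover have "0 \<le> (\<Sum>j<?k. \<Sum>ks\<in>?L. \<bar>D2 j ks\<bar>)" by (intro sum_nonneg) auto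
      ultimately show ?thesis by (simp add: D_def)
    qed
    have D2: "D2 j ks \<le> D" if "j < ?k" "ks \<in> ?L" for j ks
    proof -
      have "\<bar>D2 j ks\<bar> \<le> (\<Sum>ks\<in>?L. \<bar>D2 j ks\<bar>)" by (rule member_le_sum[OF that(2) _ fin]) simp
      also have "\<dots> \<le> (\<Sum>j<?k. \<Sum>ks\<in>?L. \<bar>D2 j ks\<bar>)"
        using that(1) by (intro member_le_sum[of j "{..<?k}" "\<lambda>j. \<Sum>ks\<in>?L. \<bar>D2 j ks\<bar>"] sum_nonneg) auto
      finally have "\<bar>D2 j ks\<bar> \<le> (\<Sum>j<?k. \<Sum>ks\<in>?L. \<bar>D2 j ks\<bar>)" .
      moreover have "0 \<le> (\<Sum>ks\<in>?L. \<bar>D1 ks\<bar>)" by (intro sum_nonneg) auto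
      ultimately show ?thesis unfolding D_def by linarith
    qed
    have "R_estimate p (C * D) (range (weighted_deriv l \<mu> \<beta> (\<lambda>\<xi>. r \<xi> + (\<Sum>j<?k. c \<xi> *\<^sub>R h j \<xi>))))"
    proof (intro est allI impI ballI h)
      show "smooth_on UNIV r" using r by (simp add: symbols_def)
      fix ks :: "'n list" and \<xi> assume "length ks \<le> N"
      then show "norm (weighted_deriv l (\<mu> - real ?k) (multi_add \<beta> ks) r \<xi>) \<le> D"
        using order_trans[OF symbol_deriv_bounded[OF r]] D1[of ks] by (simp add: D1_def)
    next
      fix j and ks :: "'n list" and \<xi> assume "j < ?k" "length ks \<le> N" and \<xi>: "\<xi> \<in> K j"
      then have "D2 j ks \<le> D" using D2 by simp
      then show "norm (multi_deriv (count (mset ks)) (h j \<circ> radial_retraction l) \<xi>) \<le> D"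
        unfolding D2_def
        by (rule order_trans[OF multi_deriv_bounded_on_compact[OF smooth_on_homogeneous_retraction[OF l h] K(1) K(3) \<xi>]])
    qed
    moreover have "(\<lambda>\<xi>. r \<xi> + (\<Sum>j<?k. c \<xi> *\<^sub>R h j \<xi>)) = a"
      unfolding r_def by (rule classical_symbol_expansion[symmetric])
    ultimately have "R_estimate p (C * D) (range (weighted_deriv l \<mu> \<beta> a))" by (simp only:)
    then show ?thesis using mult_nonneg_nonneg[OF C D0] unfolding R_bounded_def by blast
  qed
  moreover have "smooth_on UNIV a" using a by (auto simp: classical_symbols_def symbols_def)
  ultimately show ?thesis by (simp add: R_symbols_def)
qed


section \<open>Continuity of the embedding\<close>

text \<open>
  The basic open sets of the target are centred at arbitrary points of \<open>V\<close>, while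
  neighbourhoods are only known around points of the source; the triangle inequality moves the
  centre.
\<close>

lemma continuous_map_into_seminorm_topology:
  assumes sub: "topspace T \<subseteq> V"
    and tri: "\<And>q a b b0. q \<in> Q \<Longrightarrow> a \<in> V \<Longrightarrow> b \<in> V \<Longrightarrow> b0 \<in> V \<Longrightarrow>
      q (\<lambda>x. b x - a x) \<le> q (\<lambda>x. b x - b0 x) + q (\<lambda>x. b0 x - a x)"
    and nbhd: "\<And>q b0 e. q \<in> Q \<Longrightarrow> b0 \<in> topspace T \<Longrightarrow> 0 < e \<Longrightarrow>
      \<exists>U. openin T U \<and> b0 \<in> U \<and> (\<forall>b\<in>U. q (\<lambda>x. b x - b0 x) < e)"
  shows "continuous_map T (seminorm_topology V Q) (\<lambda>a. a)"
  unfolding seminorm_topology_def continuous_on_generated_topo_iff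
proof (intro conjI allI impI)
  fix U assume "U \<in> insert V {{b \<in> V. q (\<lambda>x. b x - a x) < r} | q a r. q \<in> Q \<and> a \<in> V \<and> 0 < r}"
  then consider "U = V" | q a r where "U = {b \<in> V. q (\<lambda>x. b x - a x) < r}" "q \<in> Q" "a \<in> V" "0 < r" by blast
  then show "openin T ((\<lambda>a. a) -` U \<inter> topspace T)"
  proof cases
    case 1
    then have "(\<lambda>a. a) -` U \<inter> topspace T = topspace T" using sub by auto
    then show ?thesis by simp
  next
    case 2
    show ?thesis
    proof (subst openin_subopen, intro ballI)
      fix b0 assume "b0 \<in> (\<lambda>a. a) -` U \<inter> topspace T"
      then have b0: "b0 \<in> topspace T" "b0 \<in> V" "q (\<lambda>x. b0 x - a x) < r" using 2 by auto
      obtain S where S: "openin T S" "b0 \<in> S" "\<And>b. b \<in> S \<Longrightarrow> q (\<lambda>x. b x - b0 x) < r - q (\<lambda>x. b0 x - a x)"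
        using nbhd[OF 2(2) b0(1), of "r - q (\<lambda>x. b0 x - a x)"] b0(3) by auto
      have "S \<subseteq> (\<lambda>a. a) -` U \<inter> topspace T"
      proof
        fix b assume b: "b \<in> S"
        then have bT: "b \<in> topspace T" using openin_subset[OF S(1)] by blast
        then have "b \<in> V" using sub by blast
        then have "q (\<lambda>x. b x - a x) < r" using tri[OF 2(2,3) _ b0(2), of b] S(3)[OF b] by linarith
        then show "b \<in> (\<lambda>a. a) -` U \<inter> topspace T" using bT \<open>b \<in> V\<close> 2(1) by simp
      qed
      then show "\<exists>S. openin T S \<and> b0 \<in> S \<and> S \<subseteq> (\<lambda>a. a) -` U \<inter> topspace T" using S by blast
    qed
  qed
next
  show "(\<lambda>a. a) ` topspace T \<subseteq> \<Union> (insert V {{b \<in> V. q (\<lambda>x. b x - a x) < r} | q a r. q \<in> Q \<and> a \<in> V \<and> 0 < r})"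
    using sub by auto
qed

lemma openin_seminorm_ball:
  assumes "q \<in> Q" "a \<in> V" "0 < r"
  shows "openin (seminorm_topology V Q) {b \<in> V. q (\<lambda>x. b x - a x) < r}"
  unfolding seminorm_topology_def by (rule topology_generated_by_Basis) (use assms in blast)

lemma openin_projective_preimage:
  assumes "(f, T) \<in> F" "openin T U"
  shows "openin (projective_topology V F) {a \<in> V. f a \<in> U}"
  unfolding projective_topology_def by (rule topology_generated_by_Basis) (use assms in blast)

lemma openin_classical_remainder_ball:
  fixes l :: "'n::finite \<Rightarrow> nat" and c :: "real^'n \<Rightarrow> real"
    and k :: nat and a :: "real^'n \<Rightarrow> 'x::real_normed_vector \<Rightarrow>\<^sub>L 'y::real_normed_vector"
  assumes a: "a \<in> classical_symbols c l \<mu>" and \<delta>: "0 < \<delta>"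
  defines "R \<equiv> \<lambda>b. expansion_remainder c (homogeneous_components c l \<mu> b) k b"
  shows "openin (classical_symbol_topology c l \<mu>)
    {b \<in> classical_symbols c l \<mu>. (SUP \<xi>. norm (weighted_deriv l (\<mu> - real k) \<gamma> (\<lambda>\<xi>. R b \<xi> - R a \<xi>) \<xi>)) < \<delta>}"
proof -
  have R: "R b \<in> symbols l (\<mu> - real k)" if "b \<in> classical_symbols c l \<mu>" for b :: "real^'n \<Rightarrow> 'x \<Rightarrow>\<^sub>L 'y"
    using homogeneous_components[OF that] by (simp add: homogeneous_expansion_def R_def)
  let ?q = "\<lambda>f :: real^'n \<Rightarrow> 'x \<Rightarrow>\<^sub>L 'y. SUP \<xi>. norm (weighted_deriv l (\<mu> - real k) \<gamma> f \<xi>)"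
  have "openin (symbol_topology l (\<mu> - real k)) {f \<in> symbols l (\<mu> - real k). ?q (\<lambda>\<xi>. f \<xi> - R a \<xi>) < \<delta>}"
    unfolding symbol_topology_def
    by (rule openin_seminorm_ball[where q = ?q, OF _ R[OF a] \<delta>]) blast
  then have "openin (classical_symbol_topology c l \<mu>)
      {b \<in> classical_symbols c l \<mu>. R b \<in> {f \<in> symbols l (\<mu> - real k). ?q (\<lambda>\<xi>. f \<xi> - R a \<xi>) < \<delta>}}"
    unfolding classical_symbol_topology_def
    by (rule openin_projective_preimage[rotated]) (auto simp: R_def)
  moreover have "{b \<in> classical_symbols c l \<mu>. R b \<in> {f \<in> symbols l (\<mu> - real k). ?q (\<lambda>\<xi>. f \<xi> - R a \<xi>) < \<delta>}}
      = {b \<in> classical_symbols c l \<mu>. ?q (\<lambda>\<xi>. R b \<xi> - R a \<xi>) < \<delta>}"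
    using R by auto
  ultimately show ?thesis by simp
qed

text \<open>
  Two projective topologies are passed here: \<open>j\<close>-th components are restricted to the sphere, and
  functions on the sphere are tested by pull-back along the radial retraction.
\<close>

lemma openin_classical_component_ball:
  fixes l :: "'n::finite \<Rightarrow> nat" and c :: "real^'n \<Rightarrow> real"
    and j :: nat and a :: "real^'n \<Rightarrow> 'x::real_normed_vector \<Rightarrow>\<^sub>L 'y::real_normed_vector"
  assumes l: "\<forall>j. 1 \<le> l j" and a: "a \<in> classical_symbols c l \<mu>" and \<delta>: "0 < \<delta>"
    and K: "compact K" "K \<noteq> {}" "K \<subseteq> - {0}"
  defines "H \<equiv> \<lambda>b. homogeneous_components c l \<mu> b j \<circ> radial_retraction l"
  shows "openin (classical_symbol_topology c l \<mu>)
    {b \<in> classical_symbols c l \<mu>. (SUP \<xi>\<in>K. norm (multi_deriv \<gamma> (\<lambda>\<xi>. H b \<xi> - H a \<xi>) \<xi>)) < \<delta>}"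
proof -
  let ?M = "{\<xi>. aniso_length l \<xi> = 1}"
  have hom: "aniso_homogeneous l (\<mu> - real j) (homogeneous_components c l \<mu> b j)"
    if "b \<in> classical_symbols c l \<mu>" for b :: "real^'n \<Rightarrow> 'x \<Rightarrow>\<^sub>L 'y"
    using homogeneous_components[OF that] by (simp add: homogeneous_expansion_def)
  have H: "smooth_on (- {0}) (H b)" if "b \<in> classical_symbols c l \<mu>" for b :: "real^'n \<Rightarrow> 'x \<Rightarrow>\<^sub>L 'y"
    unfolding H_def by (rule smooth_on_homogeneous_retraction[OF l hom[OF that]])
  let ?q = "\<lambda>f :: real^'n \<Rightarrow> 'x \<Rightarrow>\<^sub>L 'y. SUP \<xi>\<in>K. norm (multi_deriv \<gamma> f \<xi>)"
  let ?U = "{f \<in> {f. smooth_on (- {0}) f}. ?q (\<lambda>\<xi>. f \<xi> - H a \<xi>) < \<delta>}"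
  let ?V = "{f \<in> {f. smooth_on_submanifold ?M f}. f \<circ> radial_retraction l \<in> ?U}"
  have "openin (smooth_topology (- {0})) ?U"
    unfolding smooth_topology_def
    by (rule openin_seminorm_ball[where q = ?q, OF _ _ \<delta>]) (use K H[OF a] in blast)+
  then have "openin (submanifold_smooth_topology ?M) ?V"
    unfolding submanifold_smooth_topology_def
    by (rule openin_projective_preimage[where f = "\<lambda>f. f \<circ> radial_retraction l", rotated])
       (use smooth_on_radial_retraction[OF l] radial_retraction_sphere[OF l] in blast)
  then have "openin (classical_symbol_topology c l \<mu>)
      {b \<in> classical_symbols c l \<mu>. homogeneous_components c l \<mu> b j \<in> ?V}"
    unfolding classical_symbol_topology_def
    by (rule openin_projective_preimage[where f = "\<lambda>b. homogeneous_components c l \<mu> b j", rotated]) blast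
  moreover have "{b \<in> classical_symbols c l \<mu>. homogeneous_components c l \<mu> b j \<in> ?V}
      = {b \<in> classical_symbols c l \<mu>. ?q (\<lambda>\<xi>. H b \<xi> - H a \<xi>) < \<delta>}"
    using H aniso_homogeneous_smooth_on_sphere[OF l hom] by (auto simp: H_def)
  ultimately show ?thesis by simp
qed

text \<open>
  Finitely many seminorm balls of radius \<open>\<delta>\<close> around the remainder and the components of \<open>a\<close>
  suffice: on their intersection \<open>R_estimate_classical\<close> applies to the differences of the
  remainders and components with \<open>D = \<delta>\<close>.
\<close>

lemma classical_neighbourhood:
  fixes l :: "'n::finite \<Rightarrow> nat" and c :: "real^'n \<Rightarrow> real"
    and a :: "real^'n \<Rightarrow> 'x::real_normed_vector \<Rightarrow>\<^sub>L 'y::real_normed_vector"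
  assumes l: "\<forall>j. 1 \<le> l j" and p: "1 \<le> p" and c: "excision c" and a: "a \<in> classical_symbols c l \<mu>"
    and e: "0 < e"
  shows "\<exists>U. openin (classical_symbol_topology c l \<mu>) U \<and> a \<in> U \<and>
    (\<forall>b\<in>U. R_bound p (range (weighted_deriv l \<mu> \<beta> (\<lambda>\<xi>. b \<xi> - a \<xi>))) < e)"
proof -
  let ?k = "remainder_order l" and ?T = "classical_symbol_topology c l \<mu> :: (real^'n \<Rightarrow> 'x \<Rightarrow>\<^sub>L 'y) topology"
  let ?S = "classical_symbols c l \<mu> :: (real^'n \<Rightarrow> 'x \<Rightarrow>\<^sub>L 'y) set"
  obtain C K N where C: "0 \<le> C" and K: "\<And>j::nat. compact (K j)" "\<And>j. K j \<noteq> {}" "\<And>j. K j \<subseteq> - {0}" and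
    est: "\<And>(r :: real^'n \<Rightarrow> 'x \<Rightarrow>\<^sub>L 'y) h D. smooth_on UNIV r \<Longrightarrow>
    (\<forall>j<?k. aniso_homogeneous l (\<mu> - real j) (h j)) \<Longrightarrow>
    (\<forall>ks \<xi>. length ks \<le> N \<longrightarrow> norm (weighted_deriv l (\<mu> - real ?k) (multi_add \<beta> ks) r \<xi>) \<le> D) \<Longrightarrow>
    (\<forall>j<?k. \<forall>ks. length ks \<le> N \<longrightarrow>
      (\<forall>\<xi>\<in>K j. norm (multi_deriv (count (mset ks)) (h j \<circ> radial_retraction l) \<xi>) \<le> D)) \<Longrightarrow>
    R_estimate p (C * D) (range (weighted_deriv l \<mu> \<beta> (\<lambda>\<xi>. r \<xi> + (\<Sum>j<?k. c \<xi> *\<^sub>R h j \<xi>))))"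
    using R_estimate_classical[OF l p c, where 'x = 'x and 'y = 'y and \<mu> = \<mu> and \<beta> = \<beta>] by blast
  \<comment> \<open>\<open>C + 1\<close> instead of \<open>C\<close> makes the estimate strict and avoids division by \<open>0\<close>\<close>
  define \<delta> where "\<delta> = e / (C + 1)"
  have \<delta>: "0 < \<delta>" "C * \<delta> < e" using C e by (auto simp: \<delta>_def field_simps)
  let ?h = "homogeneous_components c l \<mu> :: (real^'n \<Rightarrow> 'x \<Rightarrow>\<^sub>L 'y) \<Rightarrow> _"
  let ?r = "\<lambda>b. expansion_remainder c (?h b) ?k b"
  let ?H = "\<lambda>b j. ?h b j \<circ> radial_retraction l"
  let ?L = "{ks :: 'n list. length ks \<le> N}"
  define U1 where "U1 ks = {b \<in> ?S. (SUP \<xi>. norm (weighted_deriv l (\<mu> - real ?k) (multi_add \<beta> ks) (\<lambda>\<xi>. ?r b \<xi> - ?r a \<xi>) \<xi>)) < \<delta>}" for ks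
  define U2 where "U2 j ks = {b \<in> ?S. (SUP \<xi>\<in>K j. norm (multi_deriv (count (mset ks)) (\<lambda>\<xi>. ?H b j \<xi> - ?H a j \<xi>) \<xi>)) < \<delta>}" for j ks
  \<comment> \<open>the whole space is included so that the intersection consists of classical symbols\<close>
  define F where "F = insert ?S (U1 ` ?L \<union> (\<lambda>(j, ks). U2 j ks) ` ({..<?k} \<times> ?L))"
  note fin = finite_lists_bounded_length[of N, where 'n = 'n]
  have U1: "openin ?T (U1 ks)" for ks
    unfolding U1_def by (rule openin_classical_remainder_ball[OF a \<delta>(1)])
  have U2: "openin ?T (U2 j ks)" for j ks
    unfolding U2_def by (rule openin_classical_component_ball[OF l a \<delta>(1) K])
  have ST: "openin ?T ?S" using openin_topspace[of ?T] by (simp add: classical_symbol_topology_def)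
  have "openin ?T (\<Inter> F)"
    using U1 U2 ST fin by (intro openin_Inter) (auto simp: F_def)
  moreover have "a \<in> \<Inter> F"
  proof -
    have z: "multi_deriv \<gamma> (\<lambda>\<xi>. 0 :: 'x \<Rightarrow>\<^sub>L 'y) \<xi> = 0" for \<gamma> and \<xi> :: "real^'n"
      using multi_deriv_diff[OF open_UNIV smooth_on_const[OF open_UNIV] smooth_on_const[OF open_UNIV], of \<xi> \<gamma> 0 0] by simp
    have "a \<in> U1 ks" for ks using a \<delta>(1) by (simp add: U1_def weighted_deriv_def z)
    moreover have "a \<in> U2 j ks" for j ks using a \<delta>(1) K(2)[of j] by (simp add: U2_def z)
    ultimately show ?thesis using a by (auto simp: F_def)
  qed
  moreover have "R_bound p (range (weighted_deriv l \<mu> \<beta> (\<lambda>\<xi>. b \<xi> - a \<xi>))) < e" if b: "b \<in> \<Inter> F" for b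
  proof -
    have bS: "b \<in> ?S" and bU1: "\<And>ks. ks \<in> ?L \<Longrightarrow> b \<in> U1 ks"
      and bU2: "\<And>j ks. j < ?k \<Longrightarrow> ks \<in> ?L \<Longrightarrow> b \<in> U2 j ks"
      using b by (auto simp: F_def)
    define r where "r = (\<lambda>\<xi>. ?r b \<xi> - ?r a \<xi>)"
    define h where "h j = (\<lambda>\<xi>. ?h b j \<xi> - ?h a j \<xi>)" for j
    have hH: "h j \<circ> radial_retraction l = (\<lambda>\<xi>. ?H b j \<xi> - ?H a j \<xi>)" for j
      by (simp add: h_def fun_eq_iff)
    have r: "r \<in> symbols l (\<mu> - real ?k)"
      unfolding r_def using homogeneous_components[OF bS] homogeneous_components[OF a]
      by (intro symbols_diff) (auto simp: homogeneous_expansion_def)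
    have h: "aniso_homogeneous l (\<mu> - real j) (h j)" for j
      unfolding h_def using homogeneous_components[OF bS] homogeneous_components[OF a]
      by (intro aniso_homogeneous_diff) (auto simp: homogeneous_expansion_def)
    have "R_estimate p (C * \<delta>) (range (weighted_deriv l \<mu> \<beta> (\<lambda>\<xi>. r \<xi> + (\<Sum>j<?k. c \<xi> *\<^sub>R h j \<xi>))))"
    proof (intro est allI impI ballI h)
      show "smooth_on UNIV r" using r by (simp add: symbols_def)
      fix ks :: "'n list" and \<xi> assume "length ks \<le> N"
      then have "(SUP \<xi>. norm (weighted_deriv l (\<mu> - real ?k) (multi_add \<beta> ks) r \<xi>)) < \<delta>"
        using bU1[of ks] by (simp add: U1_def r_def)
      then show "norm (weighted_deriv l (\<mu> - real ?k) (multi_add \<beta> ks) r \<xi>) \<le> \<delta>"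
        using symbol_deriv_bounded[OF r, of "multi_add \<beta> ks" \<xi>] by linarith
    next
      fix j and ks :: "'n list" and \<xi> assume j: "j < ?k" "length ks \<le> N" and \<xi>: "\<xi> \<in> K j"
      then have "(SUP \<xi>\<in>K j. norm (multi_deriv (count (mset ks)) (h j \<circ> radial_retraction l) \<xi>)) < \<delta>"
        using bU2[of j ks] by (simp add: U2_def hH)
      then show "norm (multi_deriv (count (mset ks)) (h j \<circ> radial_retraction l) \<xi>) \<le> \<delta>"
        using multi_deriv_bounded_on_compact[OF smooth_on_homogeneous_retraction[OF l h[of j]] K(1) K(3) \<xi>, of "count (mset ks)"]
        by linarith
    qed
    moreover have "(\<lambda>\<xi>. r \<xi> + (\<Sum>j<?k. c \<xi> *\<^sub>R h j \<xi>)) = (\<lambda>\<xi>. b \<xi> - a \<xi>)"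
      by (simp add: fun_eq_iff r_def h_def expansion_remainder_def scaleR_diff_right sum_subtractf)
    ultimately have "R_bound p (range (weighted_deriv l \<mu> \<beta> (\<lambda>\<xi>. b \<xi> - a \<xi>))) \<le> C * \<delta>"
      using C \<delta>(1) by (intro R_bound_le) auto
    then show ?thesis using \<delta>(2) by linarith
  qed
  ultimately show ?thesis by blast
qed

lemma R_symbols_diff_bounded:
  assumes "1 \<le> p" "f \<in> R_symbols p l \<mu>" "g \<in> R_symbols p l \<mu>"
  shows "R_bounded p (range (weighted_deriv l \<mu> \<beta> (\<lambda>\<xi>. f \<xi> - g \<xi>)))"
proof -
  have "R_bounded p (range (\<lambda>\<xi>. weighted_deriv l \<mu> \<beta> f \<xi> + - weighted_deriv l \<mu> \<beta> g \<xi>))"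
    using assms by (intro R_bounded_add R_bounded_uminus) (auto simp: R_symbols_def)
  then show ?thesis using assms by (simp add: weighted_deriv_diff R_symbols_def)
qed

lemma R_symbol_seminorm_triangle:
  assumes p: "1 \<le> p" and abc: "f \<in> R_symbols p l \<mu>" "g \<in> R_symbols p l \<mu>" "h \<in> R_symbols p l \<mu>"
  shows "R_bound p (range (weighted_deriv l \<mu> \<beta> (\<lambda>\<xi>. g \<xi> - f \<xi>)))
    \<le> R_bound p (range (weighted_deriv l \<mu> \<beta> (\<lambda>\<xi>. g \<xi> - h \<xi>))) + R_bound p (range (weighted_deriv l \<mu> \<beta> (\<lambda>\<xi>. h \<xi> - f \<xi>)))"
proof -
  have sm: "smooth_on UNIV f" "smooth_on UNIV g" "smooth_on UNIV h" using abc by (auto simp: R_symbols_def)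
  have "weighted_deriv l \<mu> \<beta> (\<lambda>\<xi>. g \<xi> - f \<xi>)
      = (\<lambda>\<xi>. weighted_deriv l \<mu> \<beta> (\<lambda>\<xi>. g \<xi> - h \<xi>) \<xi> + weighted_deriv l \<mu> \<beta> (\<lambda>\<xi>. h \<xi> - f \<xi>) \<xi>)"
    by (simp add: weighted_deriv_diff sm)
  then show ?thesis
    using R_bound_add_le[OF p R_symbols_diff_bounded[OF p abc(2,3)] R_symbols_diff_bounded[OF p abc(3,1)]] by simp
qed

theorem proposition3p10:
  fixes l :: "'n::finite \<Rightarrow> nat" and \<mu> p :: real and c :: "real^'n \<Rightarrow> real"
  assumes "\<forall>j. 1 \<le> l j"
    and "1 \<le> p"
    and "excision c"
  shows "(classical_symbols c l \<mu> :: (real^'n \<Rightarrow> 'x::banach \<Rightarrow>\<^sub>L 'y::banach) set) \<subseteq> R_symbols p l \<mu>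
    \<and> continuous_map
        (classical_symbol_topology c l \<mu> :: (real^'n \<Rightarrow> 'x \<Rightarrow>\<^sub>L 'y) topology)
        (R_symbol_topology p l \<mu>) (\<lambda>a. a)"
proof
  show sub: "(classical_symbols c l \<mu> :: (real^'n \<Rightarrow> 'x \<Rightarrow>\<^sub>L 'y) set) \<subseteq> R_symbols p l \<mu>"
    using classical_imp_R_symbol[OF assms] by blast
  have ts: "topspace (classical_symbol_topology c l \<mu>) = (classical_symbols c l \<mu> :: (real^'n \<Rightarrow> 'x \<Rightarrow>\<^sub>L 'y) set)"
    by (simp add: classical_symbol_topology_def)
  show "continuous_map (classical_symbol_topology c l \<mu> :: (real^'n \<Rightarrow> 'x \<Rightarrow>\<^sub>L 'y) topology)
      (R_symbol_topology p l \<mu>) (\<lambda>a. a)"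
    unfolding R_symbol_topology_def
  proof (rule continuous_map_into_seminorm_topology)
    show "topspace (classical_symbol_topology c l \<mu>) \<subseteq> (R_symbols p l \<mu> :: (real^'n \<Rightarrow> 'x \<Rightarrow>\<^sub>L 'y) set)"
      using sub ts by simp
  next
    fix q :: "(real^'n \<Rightarrow> 'x \<Rightarrow>\<^sub>L 'y) \<Rightarrow> real" and a b b0 :: "real^'n \<Rightarrow> 'x \<Rightarrow>\<^sub>L 'y"
    assume "q \<in> {(\<lambda>a. R_bound p (range (weighted_deriv l \<mu> \<beta> a))) | \<beta>. True}"
      and mem: "a \<in> R_symbols p l \<mu>" "b \<in> R_symbols p l \<mu>" "b0 \<in> R_symbols p l \<mu>"
    then obtain \<beta> where q: "q = (\<lambda>a. R_bound p (range (weighted_deriv l \<mu> \<beta> a)))" by blast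
    show "q (\<lambda>x. b x - a x) \<le> q (\<lambda>x. b x - b0 x) + q (\<lambda>x. b0 x - a x)"
      unfolding q by (rule R_symbol_seminorm_triangle[OF assms(2) mem])
  next
    fix q :: "(real^'n \<Rightarrow> 'x \<Rightarrow>\<^sub>L 'y) \<Rightarrow> real" and b0 :: "real^'n \<Rightarrow> 'x \<Rightarrow>\<^sub>L 'y" and e :: real
    assume "q \<in> {(\<lambda>a. R_bound p (range (weighted_deriv l \<mu> \<beta> a))) | \<beta>. True}"
      and b0: "b0 \<in> topspace (classical_symbol_topology c l \<mu>)" and e: "0 < e"
    then obtain \<beta> where q: "q = (\<lambda>a. R_bound p (range (weighted_deriv l \<mu> \<beta> a)))" by blast
    show "\<exists>U. openin (classical_symbol_topology c l \<mu>) U \<and> b0 \<in> U \<and> (\<forall>b\<in>U. q (\<lambda>x. b x - b0 x) < e)"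
      unfolding q by (rule classical_neighbourhood[OF assms b0[unfolded ts] e])
  qed
qed

end
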